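(* Let $\Phi:T\times\mathbb{R}^n\rightrightarrows\mathbb{R}^m$ be a set-valued normal integrand on a complete finite measure space $(T,\mathcal{A},\mu)$, and let $\bar x\in\operatorname{dom}E_\Phi$. Suppose that there exist $\rho>0$ and $\kappa\in L^1(T,\mathbb{R}_+)$ such that $\Phi_t(x)$ is convex for all $x\in\mathbb{B}_\rho(\bar x)$ and a.e. $t\in T_{na}$, and $\Phi_t(x)\subset\kappa(t)\mathbb{B}$ for all $x\in\mathbb{B}_\rho(\bar x)$ and a.e. $t\in T$. Let $\bar{\mathsf y}\in\mathcal{S}_\Phi(\bar x,\bar y)$ for some $\bar y\in E_\Phi(\bar x)$, and assume that $\Phi$ is integrably quasi-Lipschitzian around $(\bar x,\bar{\mathsf y})$. Then $$\hat D^*E_\Phi(\bar x,\bar y)(y^* )\subset\int_T D^*\Phi_t(\bar x,\bar{\mathsf y}(t))(y^* )\,d\mu\quad\text{for all } y^*\in\mathbb{R}^m.$$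
   Context: $\mathbb{R}_+:=\{\alpha\in\mathbb{R}:\alpha>0\}$; $L^p(T,\cdot)$ are the usual Lebesgue spaces; vectors are identified with constant functions; $\mathbb{B}_r(\cdot)$ is the closed ball, $\mathbb{B}$ the closed unit ball. $T=T_{pa}\cup T_{na}$ is the disjoint measurable decomposition of $T$ such that $\mu(\cdot\cap T_{pa})$ is purely atomic and $\mu(\cdot\cap T_{na})$ is nonatomic. For $\Phi:T\times\mathbb{R}^n\rightrightarrows\mathbb{R}^m$ write $\Phi_t:=\Phi(t,\cdot)$. $\Phi$ is a set-valued normal integrand if $\operatorname{gph}\Phi_t$ is closed for all $t\in T$ and $\operatorname{gph}\Phi\in\mathcal{A}\otimes\mathcal{B}(\mathbb{R}^n\times\mathbb{R}^m)$. The (Aumann) integral of $F:T\rightrightarrows\mathbb{R}^d$ is $\int_TF(t)d\mu=\{\int_T\mathsf{v}\,d\mu:\mathsf{v}\in L^1(T,\mathbb{R}^d),\ \mathsf{v}(t)\in F(t)\text{ a.e.}\}$. $E_\Phi(x):=\int_T\Phi_t(x)d\mu$. $\mathcal{S}_\Phi(x,y):=\{\mathsf{y}\in L^1(T,\mathbb{R}^m):\int_T\mathsf{y}\,d\mu=y,\ \mathsf{y}(t)\in\Phi_t(x)\text{ for a.e. }t\}$. Regular normal cone: $\hat N(\bar z;\Omega)=\{z^*:\limsup_{z\to\bar z,z\in\Omega}\langle z^*,z-\bar z\rangle/\|z-\bar z\|\le0\}$ for $\bar z\in\Omega$, $\emptyset$ otherwise. Limiting normal cone: $N(\bar z;\Omega)=\{z^*:\exists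 z_k\to\bar z,\ z_k^*\to z^*,\ z_k^*\in\hat N(z_k;\Omega)\}$. Regular and limiting coderivatives at $(x,y)\in\operatorname{gph}G$: $\hat D^*G(x,y)(y^* )=\{x^*:(x^*,-y^* )\in\hat N((x,y);\operatorname{gph}G)\}$, $D^*G(x,y)(y^* )=\{x^*:(x^*,-y^* )\in N((x,y);\operatorname{gph}G)\}$. $\Phi$ is integrably quasi-Lipschitzian around $(\bar x,\bar{\mathsf y})$ if there exist $\eta>0$ and $\ell\in L^1(T,\mathbb{R}_+)$ such that $\sup\{\|x^*\|:x^*\in D^*\Phi_t(\mathsf{x}(t),\mathsf{y}(t))(\mathsf{y}^*(t))\}\le\ell(t)\|\mathsf{y}^*(t)\|$ for a.e. $t\in T$ whenever $\mathsf{x}\in L^\infty(T,\mathbb{R}^n)$ with $\|\mathsf{x}-\bar x\|_\infty\le\eta$, $\mathsf{y}\in L^1(T,\mathbb{R}^m)$ with $\|\mathsf{y}-\bar{\mathsf y}\|_1\le\eta$ and $\mathsf{y}(t)\in\Phi_t(\mathsf{x}(t))$ a.e., and $\mathsf{y}^*\in L^\infty(T,\mathbb{R}^m)$ (the inequality being regarded as satisfied when the set is empty). *)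

theory Defs
  imports "HOL-Probability.Essential_Supremum"
begin

section \<open>Measure-theoretic notions\<close>

definition is_atom :: "'t measure \<Rightarrow> 't set \<Rightarrow> bool" where
  "is_atom M A \<longleftrightarrow> A \<in> sets M \<and> emeasure M A > 0 \<and>
     (\<forall>B\<in>sets M. B \<subseteq> A \<longrightarrow> emeasure M B = 0 \<or> emeasure M (A - B) = 0)"

definition nonatomic :: "'t measure \<Rightarrow> bool" where
  "nonatomic M \<longleftrightarrow> (\<nexists>A. is_atom M A)"

definition purely_atomic :: "'t measure \<Rightarrow> bool" where
  "purely_atomic M \<longleftrightarrow> (\<forall>A\<in>sets M. emeasure M A > 0 \<longrightarrow> (\<exists>B. B \<subseteq> A \<and> is_atom M B))"

text \<open>
  The measure \<^term>\<open>density M (indicator S)\<close> is \<open>\<mu>(\<cdot> \<inter> S)\<close>, see \<open>emeasure_restricted\<close>.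
\<close>

definition atomic_decomposition :: "'t measure \<Rightarrow> 't set \<Rightarrow> 't set \<Rightarrow> bool" where
  "atomic_decomposition M T_pa T_na \<longleftrightarrow>
     T_pa \<in> sets M \<and> T_na \<in> sets M \<and> T_pa \<inter> T_na = {} \<and> T_pa \<union> T_na = space M \<and>
     purely_atomic (density M (indicator T_pa)) \<and> nonatomic (density M (indicator T_na))"

text \<open>
  Elements of Lebesgue spaces are represented by functions rather than by equivalence classes;
  all properties below are invariant under modification on null sets.
  \<open>L1 M S\<close> is the set of integrable functions with values (almost everywhere) in \<open>S\<close>.
\<close>

definition L1 :: "'t measure \<Rightarrow> 'b::{banach, second_countable_topology} set \<Rightarrow> ('t \<Rightarrow> 'b) set" where
  "L1 M S = {f. integrable M f \<and> (AE t in M. f t \<in> S)}"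

definition L1_norm :: "'t measure \<Rightarrow> ('t \<Rightarrow> 'b::{banach, second_countable_topology}) \<Rightarrow> real" where
  "L1_norm M f = (\<integral>t. norm (f t) \<partial>M)"

definition Linf_norm :: "'t measure \<Rightarrow> ('t \<Rightarrow> 'b::{banach, second_countable_topology}) \<Rightarrow> ereal" where
  "Linf_norm M f = esssup M (\<lambda>t. ereal (norm (f t)))"

definition Linf :: "'t measure \<Rightarrow> ('t \<Rightarrow> 'b::{banach, second_countable_topology}) set" where
  "Linf M = {f. f \<in> borel_measurable M \<and> Linf_norm M f < \<infinity>}"


section \<open>Set-valued mappings and their integrals\<close>

definition gph :: "('a \<Rightarrow> 'b set) \<Rightarrow> ('a \<times> 'b) set" where
  "gph G = {(x, y). y \<in> G x}"

definition mdom :: "('a \<Rightarrow> 'b set) \<Rightarrow> 'a set" where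
  "mdom G = {x. G x \<noteq> {}}"

definition normal_integrand ::
  "'t measure \<Rightarrow> ('t \<Rightarrow> 'a::euclidean_space \<Rightarrow> 'b::euclidean_space set) \<Rightarrow> bool" where
  "normal_integrand M \<Phi> \<longleftrightarrow>
     (\<forall>t\<in>space M. closed (gph (\<Phi> t))) \<and>
     {(t, z). t \<in> space M \<and> z \<in> gph (\<Phi> t)} \<in> sets (M \<Otimes>\<^sub>M (borel :: ('a \<times> 'b) measure))"

definition aumann_integral ::
  "'t measure \<Rightarrow> ('t \<Rightarrow> 'b::euclidean_space set) \<Rightarrow> 'b set" where
  "aumann_integral M F = {(\<integral>t. v t \<partial>M) | v. v \<in> L1 M UNIV \<and> (AE t in M. v t \<in> F t)}"

definition expected_map ::
  "'t measure \<Rightarrow> ('t \<Rightarrow> 'a \<Rightarrow> 'b::euclidean_space set) \<Rightarrow> 'a \<Rightarrow> 'b set" where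
  "expected_map M \<Phi> x = aumann_integral M (\<lambda>t. \<Phi> t x)"

definition integral_selections ::
  "'t measure \<Rightarrow> ('t \<Rightarrow> 'a \<Rightarrow> 'b::euclidean_space set) \<Rightarrow> 'a \<Rightarrow> 'b \<Rightarrow> ('t \<Rightarrow> 'b) set" where
  "integral_selections M \<Phi> x y =
     {v. v \<in> L1 M UNIV \<and> (\<integral>t. v t \<partial>M) = y \<and> (AE t in M. v t \<in> \<Phi> t x)}"


section \<open>Normal cones and coderivatives\<close>

text \<open>
  If \<open>z\<close> is isolated in \<open>\<Omega>\<close>, then \<^term>\<open>at z within \<Omega>\<close> is the bottom filter, the \<open>Limsup\<close> is
  \<open>-\<infinity>\<close>, and the regular normal cone is the whole space, as it should be.
\<close>

definition regular_normal_cone :: "'a::euclidean_space \<Rightarrow> 'a set \<Rightarrow> 'a set" where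
  "regular_normal_cone z \<Omega> =
     (if z \<in> \<Omega>
      then {w. Limsup (at z within \<Omega>) (\<lambda>u. ereal (w \<bullet> (u - z) / norm (u - z))) \<le> 0}
      else {})"

definition limiting_normal_cone :: "'a::euclidean_space \<Rightarrow> 'a set \<Rightarrow> 'a set" where
  "limiting_normal_cone z \<Omega> =
     {w. \<exists>zs ws. zs \<longlonglongrightarrow> z \<and> ws \<longlonglongrightarrow> w \<and> (\<forall>k::nat. ws k \<in> regular_normal_cone (zs k) \<Omega>)}"

definition regular_coderivative ::
  "('a::euclidean_space \<Rightarrow> 'b::euclidean_space set) \<Rightarrow> 'a \<Rightarrow> 'b \<Rightarrow> 'b \<Rightarrow> 'a set" where
  "regular_coderivative G x y ys = {xs. (xs, - ys) \<in> regular_normal_cone (x, y) (gph G)}"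

definition coderivative ::
  "('a::euclidean_space \<Rightarrow> 'b::euclidean_space set) \<Rightarrow> 'a \<Rightarrow> 'b \<Rightarrow> 'b \<Rightarrow> 'a set" where
  "coderivative G x y ys = {xs. (xs, - ys) \<in> limiting_normal_cone (x, y) (gph G)}"

text \<open>
  The supremum is taken in \<^typ>\<open>ereal\<close>: it is \<open>-\<infinity>\<close> for the empty set, so the inequality then
  holds, and \<open>\<infinity>\<close> for an unbounded set.
\<close>

definition integrably_quasi_lipschitzian ::
  "'t measure \<Rightarrow> ('t \<Rightarrow> 'a::euclidean_space \<Rightarrow> 'b::euclidean_space set) \<Rightarrow> 'a \<Rightarrow> ('t \<Rightarrow> 'b) \<Rightarrow> bool" where
  "integrably_quasi_lipschitzian M \<Phi> xbar ybar \<longleftrightarrow>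
     (\<exists>\<eta>>0. \<exists>l\<in>L1 M {0::real<..}.
        \<forall>x\<in>Linf M. \<forall>y\<in>L1 M UNIV. \<forall>ys\<in>Linf M.
          Linf_norm M (\<lambda>t. x t - xbar) \<le> ereal \<eta> \<longrightarrow>
          L1_norm M (\<lambda>t. y t - ybar t) \<le> \<eta> \<longrightarrow>
          (AE t in M. y t \<in> \<Phi> t (x t)) \<longrightarrow>
          (AE t in M. (SUP xs\<in>coderivative (\<Phi> t) (x t) (y t) (ys t). ereal (norm xs))
                        \<le> ereal (l t * norm (ys t))))"

end

theory Submission
  imports Defs "HOL-Library.Diagonal_Subsequence"
begin

text \<open>
  Let \<open>(x\<^sup>*, -y\<^sup>*)\<close> be a regular normal to the graph of the expected map.  Up to a small error it is
  characterised by the minimality of \<open>-\<langle>x\<^sup>*, c\<rangle> + \<langle>y\<^sup>*, \<integral> y\<rangle>\<close> plus penalties, over \<open>c\<close> and selections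
  \<open>y(t) \<in> \<Phi>\<^sub>t(c)\<close>.  Replacing \<open>c\<close> by a function \<open>x(t)\<close> and penalising \<open>|x(t) - c|\<^sup>2\<close> makes the problem
  decomposable: it is minimised pointwise by measurable selection, and the optimality conditions in
  \<open>(x(t), y(t))\<close> and in \<open>c\<close> give an integrable \<open>p\<close> with values in regular coderivatives of \<open>\<Phi>\<^sub>t\<close> and
  integral close to \<open>x\<^sup>*\<close>.  The quasi-Lipschitz condition dominates these functions \<open>p\<close>, so that Fatou's
  lemma in several dimensions yields an integrable selection of their cluster points with integral
  \<open>x\<^sup>*\<close>; cluster points of regular coderivatives lie in the limiting coderivative.
\<close>


section \<open>Souslin sets and measurable selections\<close>

text \<open>The term K |s - ybar|^2 is not an integral of a function of y(t), so Cauchy-Schwarz with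
  the weight \<open>\<kappa>\<close> replaces it by an integral of |y - yb|^2 /
  \<open>\<kappa>\<close>. The gradient of this integrand perturbs y* by an amount \<open>b\<close>
  that is bounded, but small only in the sense that its integral against a function fixed in advance
  is small. Taking the modulus \<open>l\<close> for that function and tolerances in a geometric
  sequence, the series of all \<open>l * b\<close> is integrable, and this is what gives one
  dominating function. The weight \<open>\<kappa>\<close> in the penalty on x serves another end: it
  matches the bound |y - yb| <= 2 \<open>\<kappa>\<close>, so that x is close to xbar uniformly in
  t, as the quasi-Lipschitz condition demands. Since the graph is only assumed to be measurable in
  the product, selections are obtained from Souslin schemes, up to null sets.\<close>

definition souslin :: "'a set set \<Rightarrow> 'a set \<Rightarrow> bool" where
  "souslin \<R> S \<longleftrightarrow> (\<exists>R. (\<forall>s. R s \<in> \<R>) \<and>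
     S = {z. \<exists>\<sigma>::nat \<Rightarrow> nat. \<forall>n. z \<in> R (map \<sigma> [0..<Suc n])})"

lemma souslinI:
  assumes "\<And>s. R s \<in> \<R>" and "\<And>z. z \<in> S \<longleftrightarrow> (\<exists>\<sigma>::nat \<Rightarrow> nat. \<forall>n. z \<in> R (map \<sigma> [0..<Suc n]))"
  shows "souslin \<R> S"
  unfolding souslin_def using assms by (intro exI[of _ R]) blast

lemma souslinE:
  assumes "souslin \<R> S"
  obtains R where "\<And>s. R s \<in> \<R>"
    and "\<And>z. z \<in> S \<longleftrightarrow> (\<exists>\<sigma>::nat \<Rightarrow> nat. \<forall>n. z \<in> R (map \<sigma> [0..<Suc n]))"
  using assms unfolding souslin_def by blast

lemma souslin_base: "A \<in> \<R> \<Longrightarrow> souslin \<R> A"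
  by (rule souslinI[of "\<lambda>_. A"]) auto

text \<open>The first entry of a branch codes both the index \<open>i\<close> and the first entry of
  a branch for \<open>S i\<close>, so one scheme carries all the given ones.\<close>

lemma souslin_Union:
  assumes "\<And>i::nat. souslin \<R> (S i)"
  shows "souslin \<R> (\<Union>i. S i)"
proof -
  have "\<forall>i. \<exists>R. (\<forall>s. R s \<in> \<R>) \<and>
     (\<forall>z. z \<in> S i \<longleftrightarrow> (\<exists>\<sigma>::nat \<Rightarrow> nat. \<forall>n. z \<in> R (map \<sigma> [0..<Suc n])))"
    using assms by (metis souslinE)
  then obtain R where R: "\<And>i s. R i s \<in> \<R>"
    and S: "\<And>i z. z \<in> S i \<longleftrightarrow> (\<exists>\<sigma>::nat \<Rightarrow> nat. \<forall>n. z \<in> R i (map \<sigma> [0..<Suc n]))"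
    by metis
  \<comment> \<open>The value at \<open>[]\<close> is arbitrary, because branches are read only at
    nonempty initial segments.\<close>
  define Q where "Q s = (case s of [] \<Rightarrow> R 0 []
     | c # s' \<Rightarrow> R (fst (prod_decode c)) (snd (prod_decode c) # s'))" for s
  show ?thesis
  proof (rule souslinI[of Q])
    show "Q s \<in> \<R>" for s by (auto simp: Q_def R split: list.split)
    fix z
    show "z \<in> (\<Union>i. S i) \<longleftrightarrow> (\<exists>\<sigma>. \<forall>n. z \<in> Q (map \<sigma> [0..<Suc n]))"
    proof
      assume "z \<in> (\<Union>i. S i)"
      then obtain i \<sigma> where \<sigma>: "\<And>n. z \<in> R i (map \<sigma> [0..<Suc n])" using S by blast
      let ?\<sigma> = "\<sigma>(0 := prod_encode (i, \<sigma> 0))"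
      have "z \<in> Q (map ?\<sigma> [0..<Suc n])" for n
        using \<sigma>[of n] unfolding map_upt_Suc by (simp add: Q_def)
      then show "\<exists>\<sigma>. \<forall>n. z \<in> Q (map \<sigma> [0..<Suc n])" by blast
    next
      assume "\<exists>\<sigma>. \<forall>n. z \<in> Q (map \<sigma> [0..<Suc n])"
      then obtain \<sigma> where \<sigma>: "\<And>n. z \<in> Q (map \<sigma> [0..<Suc n])" by blast
      let ?\<sigma> = "\<sigma>(0 := snd (prod_decode (\<sigma> 0)))"
      have "z \<in> R (fst (prod_decode (\<sigma> 0))) (map ?\<sigma> [0..<Suc n])" for n
        using \<sigma>[of n] unfolding map_upt_Suc by (simp add: Q_def)
      then show "z \<in> (\<Union>i. S i)" using S by blast
    qed
  qed
qed

text \<open>One branch codes countably many: its entry at \<open>prod_encode (i, j)\<close> is entry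
  \<open>j\<close> of the branch for \<open>S i\<close>. A node of length
  \<open>prod_encode (i, m) + 1\<close> tests the scheme \<open>R i\<close> at level
  \<open>m\<close>.\<close>

lemma souslin_Inter:
  assumes "\<And>i::nat. souslin \<R> (S i)"
  shows "souslin \<R> (\<Inter>i. S i)"
proof -
  have "\<forall>i. \<exists>R. (\<forall>s. R s \<in> \<R>) \<and>
     (\<forall>z. z \<in> S i \<longleftrightarrow> (\<exists>\<sigma>::nat \<Rightarrow> nat. \<forall>n. z \<in> R (map \<sigma> [0..<Suc n])))"
    using assms by (metis souslinE)
  then obtain R where R: "\<And>i s. R i s \<in> \<R>"
    and S: "\<And>i z. z \<in> S i \<longleftrightarrow> (\<exists>\<sigma>::nat \<Rightarrow> nat. \<forall>n. z \<in> R i (map \<sigma> [0..<Suc n]))"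
    by metis
  define Q where "Q s = (case prod_decode (length s - 1) of (i, m) \<Rightarrow>
      R i (map (\<lambda>j. s ! prod_encode (i, j)) [0..<Suc m]))" for s
  \<comment> \<open>The entries of branch \<open>i\<close> up to index \<open>m\<close> sit at
    positions not beyond \<open>prod_encode (i, m)\<close>, so they are all known at the node that
    tests them.\<close>
  have mono: "prod_encode (i, j) \<le> prod_encode (i, m)" if "j \<le> m" for i j m
    using that unfolding prod_encode_def triangle_def
    by (auto intro!: add_mono div_le_mono mult_le_mono)
  have Qm: "Q (map \<sigma> [0..<Suc (prod_encode (i, m))]) = R i (map (\<lambda>j. \<sigma> (prod_encode (i, j))) [0..<Suc m])"
    for \<sigma> i m
  proof -
    have "map \<sigma> [0..<Suc (prod_encode (i, m))] ! prod_encode (i, j) = \<sigma> (prod_encode (i, j))"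
      if "j < Suc m" for j
      using mono[of j m i] that by (subst nth_map) (auto simp del: upt_Suc)
    then have "map (\<lambda>j. map \<sigma> [0..<Suc (prod_encode (i, m))] ! prod_encode (i, j)) [0..<Suc m]
        = map (\<lambda>j. \<sigma> (prod_encode (i, j))) [0..<Suc m]"
      by (intro map_cong) (auto simp del: upt_Suc)
    then show ?thesis unfolding Q_def by (simp del: upt_Suc map_eq_conv)
  qed
  show ?thesis
  proof (rule souslinI[of Q])
    show "Q s \<in> \<R>" for s by (auto simp: Q_def R split: prod.split)
    fix z
    show "z \<in> (\<Inter>i. S i) \<longleftrightarrow> (\<exists>\<sigma>. \<forall>n. z \<in> Q (map \<sigma> [0..<Suc n]))"
    proof
      assume "z \<in> (\<Inter>i. S i)"
      then have "\<forall>i. \<exists>\<sigma>. \<forall>n. z \<in> R i (map \<sigma> [0..<Suc n])" using S by blast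
      then obtain \<sigma> where \<sigma>: "\<And>i n. z \<in> R i (map (\<sigma> i) [0..<Suc n])" by metis
      define \<tau> where "\<tau> k = (case prod_decode k of (i, j) \<Rightarrow> \<sigma> i j)" for k
      have "z \<in> Q (map \<tau> [0..<Suc n])" for n
      proof -
        obtain i m where n: "n = prod_encode (i, m)" by (metis prod_decode_inverse surj_pair)
        show ?thesis unfolding n Qm using \<sigma>[of i m] by (simp add: \<tau>_def del: upt_Suc)
      qed
      then show "\<exists>\<sigma>. \<forall>n. z \<in> Q (map \<sigma> [0..<Suc n])" by blast
    next
      assume "\<exists>\<sigma>. \<forall>n. z \<in> Q (map \<sigma> [0..<Suc n])"
      then obtain \<sigma> where \<sigma>: "\<And>n. z \<in> Q (map \<sigma> [0..<Suc n])" by blast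
      have "z \<in> R i (map (\<lambda>j. \<sigma> (prod_encode (i, j))) [0..<Suc m])" for i m
        using \<sigma>[of "prod_encode (i, m)"] unfolding Qm .
      then show "z \<in> (\<Inter>i. S i)" using S by blast
    qed
  qed
qed

lemma souslin_Int:
  assumes "souslin \<R> A" "souslin \<R> B"
  shows "souslin \<R> (A \<inter> B)"
proof -
  have "souslin \<R> (\<Inter>i::nat. if i = 0 then A else B)"
    by (rule souslin_Inter) (use assms in auto)
  also have "(\<Inter>i::nat. if i = 0 then A else B) = A \<inter> B"
    by (auto split: if_splits)
  finally show ?thesis .
qed

lemma souslin_Un:
  assumes "souslin \<R> A" "souslin \<R> B"
  shows "souslin \<R> (A \<union> B)"
proof -
  have "souslin \<R> (\<Union>i::nat. if i = 0 then A else B)"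
    by (rule souslin_Union) (use assms in auto)
  also have "(\<Union>i::nat. if i = 0 then A else B) = A \<union> B"
    by (auto split: if_splits)
  finally show ?thesis .
qed

abbreviation compact_rectangles :: "'t measure \<Rightarrow> ('t \<times> 'b::euclidean_space) set set" where
  "compact_rectangles M \<equiv> {A \<times> K | A K. A \<in> sets M \<and> compact K}"

lemma souslin_rectangle_closed:
  fixes C :: "'b::euclidean_space set"
  assumes "A \<in> sets M" "closed C"
  shows "souslin (compact_rectangles M) (A \<times> C)"
proof -
  have "A \<times> C = (\<Union>i::nat. A \<times> (C \<inter> cball 0 (real i)))"
    by (auto simp: real_arch_simple)
  moreover have "souslin (compact_rectangles M) (\<Union>i::nat. A \<times> (C \<inter> cball 0 (real i)))"
    using assms by (intro souslin_Union souslin_base) (blast intro: closed_Int_compact compact_cball)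
  ultimately show ?thesis by simp
qed

lemma souslin_rectangle_open:
  fixes U :: "'b::euclidean_space set"
  assumes "A \<in> sets M" "open U"
  shows "souslin (compact_rectangles M) (A \<times> U)"
proof -
  obtain F where F: "\<And>n. F n \<subseteq> U" "\<And>n::nat. closed (F n)" "U = (\<Union>n. F n)"
  \<comment> \<open>This case is separate because \<open>infdist\<close> to the empty set is 0,
    which would make every \<open>F n\<close> empty.\<close>
  proof (cases "U = UNIV")
    case True then show ?thesis by (intro that[of "\<lambda>_. UNIV"]) auto
  next
    case False
    define F where "F n = {x. inverse (real (Suc n)) \<le> infdist x (- U)}" for n
    have ne: "- U \<noteq> {}" using False by auto
    have "closed (F n)" for n
      unfolding F_def by (intro closed_Collect_le continuous_intros)
    moreover have "F n \<subseteq> U" for n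
    proof
      fix x assume "x \<in> F n"
      then have "infdist x (-U) > 0" unfolding F_def
        by (smt (verit) inverse_positive_iff_positive mem_Collect_eq of_nat_0_less_iff zero_less_Suc)
      then show "x \<in> U" by (metis ComplI infdist_zero less_irrefl)
    qed
    moreover have "x \<in> (\<Union>n. F n)" if "x \<in> U" for x
    proof -
      have "infdist x (-U) > 0"
        using in_closed_iff_infdist_zero[of "-U" x] assms ne that infdist_nonneg[of x "-U"] by force
      then obtain n where "inverse (real (Suc n)) < infdist x (-U)" using reals_Archimedean by blast
      then show ?thesis by (auto simp: F_def intro!: exI[of _ n])
    qed
    ultimately show ?thesis by (intro that[of F]) blast+
  qed
  have "A \<times> U = (\<Union>i. A \<times> F i)" using F by auto
  moreover have "souslin (compact_rectangles M) (\<Union>i. A \<times> F i)"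
    using F assms by (intro souslin_Union souslin_rectangle_closed) auto
  ultimately show ?thesis by simp
qed

text \<open>Souslin sets are not closed under complements in general. The sets that are Souslin
  together with their complement do form a sigma-algebra, since countable unions and intersections
  stay Souslin, and it contains the measurable rectangles.\<close>

lemma souslin_pair_measure:
  fixes M :: "'t measure" and S :: "('t \<times> 'b::euclidean_space) set"
  assumes "S \<in> sets (M \<Otimes>\<^sub>M borel)"
  shows "souslin (compact_rectangles M) S"
proof -
  let ?R = "compact_rectangles M :: ('t \<times> 'b) set set"
  let ?\<Omega> = "space M \<times> (UNIV :: 'b set)"
  let ?G = "\<lambda>S. S \<subseteq> ?\<Omega> \<and> souslin ?R S \<and> souslin ?R (?\<Omega> - S)"
  have emp: "souslin ?R {}" using souslin_rectangle_closed[of "{}" M "{}"] by simp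
  have comp: "?G (?\<Omega> - S)" if "?G S" for S
    using that by (simp add: Diff_Diff_Int Int_absorb1)
  have Un: "?G (\<Union>i. S i)" if "\<And>i::nat. ?G (S i)" for S
  proof -
    have "?\<Omega> - (\<Union>i. S i) = (\<Inter>i. ?\<Omega> - S i)" by auto
    then show ?thesis using that souslin_Union[of ?R S] souslin_Inter[of ?R "\<lambda>i. ?\<Omega> - S i"] by auto
  qed
  have G1: "?G (A \<times> UNIV)" if "A \<in> sets M" for A
  proof -
    have "?\<Omega> - A \<times> UNIV = (space M - A) \<times> UNIV" by auto
    then show ?thesis using that sets.sets_into_space[OF that]
      by (auto intro!: souslin_rectangle_closed)
  qed
  have G2: "?G (space M \<times> B)" if "B \<in> sets borel" for B
  proof -
    have "B \<in> sigma_sets UNIV {S. open S}" using that by (simp add: borel_def)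
    then show ?thesis
    proof induction
      case (Basic U)
      have "?\<Omega> - space M \<times> U = space M \<times> (- U)" by auto
      moreover have "souslin ?R (space M \<times> (- U))"
        using Basic by (intro souslin_rectangle_closed) auto
      ultimately show ?case using Basic by (auto intro!: souslin_rectangle_open)
    next
      case Empty show ?case using emp souslin_rectangle_closed[of "space M" M UNIV] by auto
    next
      case (Compl B)
      have "space M \<times> (UNIV - B) = ?\<Omega> - space M \<times> B" by auto
      then show ?case using comp[OF Compl.IH] by simp
    next
      case (Union B)
      have "space M \<times> (\<Union>i. B i) = (\<Union>i. space M \<times> B i)" by auto
      then show ?case using Un[OF Union.IH] by simp
    qed
  qed
  have "S \<in> sigma_sets (space M \<times> UNIV) {a \<times> b |a b. a \<in> sets M \<and> b \<in> sets (borel :: 'b measure)}"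
    using assms by (simp add: sets_pair_measure)
  then have "?G S"
  proof induction
    case (Basic a)
    then obtain A B where a: "a = A \<times> B" "A \<in> sets M" "B \<in> sets borel" by auto
    have "a = (A \<times> UNIV) \<inter> (space M \<times> B)"
      using a sets.sets_into_space[of A M] by auto
    moreover have "?\<Omega> - (A \<times> UNIV) \<inter> (space M \<times> B) = (?\<Omega> - A \<times> UNIV) \<union> (?\<Omega> - space M \<times> B)" by auto
    ultimately show ?case
      using G1[OF a(2)] G2[OF a(3)] by (auto intro!: souslin_Int souslin_Un)
  next
    case Empty show ?case using emp souslin_rectangle_closed[of "space M" M UNIV] by auto
  next
    case (Compl B) then show ?case using comp by blast
  next
    case (Union B) then show ?case using Un by blast
  qed
  then show ?thesis by simp
qed

section \<open>From Souslin schemes to measurable selections\<close>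

lemma measurable_list_compose:
  fixes \<sigma> :: "'t \<Rightarrow> nat \<Rightarrow> nat"
  assumes [measurable]: "\<And>n. (\<lambda>t. \<sigma> t n) \<in> measurable M (count_space UNIV)"
  shows "(\<lambda>t. map (\<sigma> t) [0..<k]) \<in> measurable M (count_space UNIV)"
proof (induction k)
  case (Suc k)
  have "(\<lambda>t. map (\<sigma> t) [0..<k] @ [\<sigma> t k]) \<in> measurable M (count_space UNIV)"
    by (rule measurable_compose_countable[OF _ Suc],
        rule measurable_compose_countable[of "\<lambda>j t. _ @ [j]"]) auto
  then show ?case by simp
qed simp

lemma bounded_branches_finite:
  "finite {s. length s = k \<and> (\<forall>i<k. s ! i \<le> (m :: nat \<Rightarrow> nat) i)}"
proof (rule finite_subset)
  show "{s. length s = k \<and> (\<forall>i<k. s ! i \<le> m i)} \<subseteq> {s. set s \<subseteq> {..Max (m ` {..<k})} \<and> length s = k}"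
  proof safe
    fix s x assume s: "k = length s" "\<forall>i<length s. s ! i \<le> m i" "x \<in> set s"
    then obtain i where i: "i < length s" "x = s ! i" by (metis in_set_conv_nth)
    then have "x \<le> m i" "m i \<le> Max (m ` {..<length s})" using s by (auto intro!: Max_ge)
    then show "x \<le> Max (m ` {..<length s})" by linarith
  qed
qed (rule finite_lists_length_eq, simp)

text \<open>
  Choquet's capacity argument: bounds \<open>m\<close> on the branches are chosen one index at a time so that the
  set of points reached by a bounded branch keeps outer measure above \<open>a\<close>.  The tree of bounded
  branches is finitely branching, and the least living branch depends measurably on the point.
\<close>

lemma souslin_capacity:
  fixes A :: "nat list \<Rightarrow> 't set"
  assumes "finite_measure M" and A[measurable]: "\<And>s. A s \<in> sets M"
    and a: "a < outer_measure_of M {t. \<exists>\<tau>::nat \<Rightarrow> nat. \<forall>n. t \<in> A (map \<tau> [0..<Suc n])}"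
  shows "\<exists>B \<sigma>. B \<in> sets M \<and> a \<le> emeasure M B
    \<and> (\<forall>n. (\<lambda>t. \<sigma> t n) \<in> measurable M (count_space (UNIV :: nat set)))
    \<and> (\<forall>t\<in>B. \<forall>n. t \<in> A (map (\<sigma> t) [0..<Suc n]))"
proof -
  interpret finite_measure M by fact
  \<comment> \<open>The points reached by a branch whose first entries are bounded by the list
    \<open>b\<close>, all later entries being free.\<close>
  define Q where
      "Q b = {t. \<exists>\<tau>::nat \<Rightarrow> nat. (\<forall>i<length b. \<tau> i \<le> b ! i) \<and> (\<forall>n. t \<in> A (map \<tau> [0..<Suc n]))}" for b
  have Qsp: "Q b \<subseteq> space M" for b
  proof
    fix t assume "t \<in> Q b"
    then obtain \<tau> :: "nat \<Rightarrow> nat" where \<tau>: "\<forall>n. t \<in> A (map \<tau> [0..<Suc n])"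
      unfolding Q_def by (elim CollectE exE conjE)
    show "t \<in> space M" by (rule subsetD[OF sets.sets_into_space[OF A] \<tau>[rule_format, of 0]])
  qed
  \<comment> \<open>Outer measure is continuous along increasing sequences of arbitrary sets, so
    some bound \<open>j\<close> on the next entry keeps the value above \<open>a\<close>.\<close>
  have Qstep: "\<exists>j. a < outer_measure_of M (Q (b @ [j]))" if "a < outer_measure_of M (Q b)" for b
  proof -
    define br where "br t \<tau> \<longleftrightarrow> (\<forall>n. t \<in> A (map \<tau> [0..<Suc n]))" for t \<tau>
    have Qb: "t \<in> Q b \<longleftrightarrow> (\<exists>\<tau>. (\<forall>i<length b. \<tau> i \<le> b ! i) \<and> br t \<tau>)" for t
      by (simp add: Q_def br_def)
    have "(\<forall>i<length (b @ [j]). \<tau> i \<le> (b @ [j]) ! i) \<longleftrightarrow> (\<forall>i<length b. \<tau> i \<le> b ! i) \<and>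
        \<tau> (length b) \<le> j" for \<tau> :: "nat \<Rightarrow> nat" and j
      by (auto simp: All_less_Suc nth_append)
    then have Qsnoc:
        "t \<in> Q (b @ [j]) \<longleftrightarrow> (\<exists>\<tau>. (\<forall>i<length b. \<tau> i \<le> b ! i) \<and> \<tau> (length b) \<le> j \<and> br t \<tau>)" for t j
      unfolding Q_def br_def by (simp only: mem_Collect_eq conj_assoc)
    have "incseq (\<lambda>j. Q (b @ [j]))"
      by (rule incseq_SucI) (use le_SucI in \<open>auto simp: Qsnoc subset_iff simp del: le_Suc_eq\<close>)
    moreover have "Q b = (\<Union>j. Q (b @ [j]))"
      by (rule set_eqI) (use order_refl in \<open>auto simp: Qsnoc Qb\<close>)
    ultimately have "(SUP j. outer_measure_of M (Q (b @ [j]))) = outer_measure_of M (Q b)"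
      using SUP_outer_measure_of_incseq[of "\<lambda>j. Q (b @ [j])" M] Qsp by simp
    with that have "a < (SUP j. outer_measure_of M (Q (b @ [j])))" by (simp only:)
    then show ?thesis unfolding less_SUP_iff by auto
  qed
  define bs where "bs = rec_nat [] (\<lambda>_ b. b @ [SOME j. a < outer_measure_of M (Q (b @ [j]))])"
  define m where "m k = (SOME j. a < outer_measure_of M (Q (bs k @ [j])))" for k
  have bsS: "bs (Suc k) = bs k @ [m k]" for k by (simp add: bs_def m_def)
  have bs0: "bs 0 = []" by (simp add: bs_def)
  have bsm: "bs k = map m [0..<k]" for k by (induction k) (simp_all add: bs0 bsS)
  have big: "a < outer_measure_of M (Q (bs k))" for k
  proof (induction k)
    case 0 then show ?case using a by (simp add: bs0 Q_def)
  next
    case (Suc k) then show ?case unfolding bsS m_def by (rule someI_ex[OF Qstep])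
  qed
  define L where "L k = {s. length s = k \<and> (\<forall>i<k. s ! i \<le> m i)}" for k
  have finL: "finite (L k)" for k unfolding L_def by (rule bounded_branches_finite)
  \<comment> \<open>Some bounded node of length \<open>k\<close> extends \<open>s\<close>, and the
    point lies in \<open>A\<close> at all its nonempty initial segments. Unlike \<open>Q\<close>
    this involves finitely many nodes, so it is measurable.\<close>
  define V where
      "V k s = (\<Union>s'\<in>{s'\<in>L k. take (length s) s' = s}. space M \<inter> (\<Inter>n\<in>{..<k}. A (take (Suc n) s')))"
          for k s
  have V[measurable]: "V k s \<in> sets M" for k s
    unfolding V_def using finL[of k]
    by (intro sets.finite_UN finite_subset[OF _ finL[of k]]) (auto cong: conj_cong simp:
        lessThan_empty_iff intro!: sets.Int sets.finite_INT)
  have V_anti: "V (Suc k) s \<subseteq> V k s" if "length s \<le> k" for k s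
  proof
    fix t assume "t \<in> V (Suc k) s"
    then obtain s' where s': "s' \<in> L (Suc k)" "take (length s) s' = s" "t \<in> space M"
      "\<And>n. n < Suc k \<Longrightarrow> t \<in> A (take (Suc n) s')" by (auto simp: V_def)
    have "take k s' \<in> L k" using s' by (auto simp: L_def)
    moreover have "take (length s) (take k s') = s" using s' that by (simp add: min_def)
    moreover have "t \<in> A (take (Suc n) (take k s'))" if "n < k" for n
      using s'(4)[of n] that by (simp add: min_def)
    ultimately show "t \<in> V k s" using s'(3) unfolding V_def by blast
  qed
  have V_anti': "V k' s \<subseteq> V k s" if "length s \<le> k" "k \<le> k'" for k k' s
    using that(2)
  proof (induction k' rule: dec_induct)
    case (step n)
    then show ?case using V_anti[of s n] that(1) by (meson order_trans)
  qed simp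
  define Al where "Al s = (\<Inter>k\<in>{length s..}. V k s)" for s
  have Al[measurable]: "Al s \<in> sets M" for s
    unfolding Al_def by (intro sets.countable_INT') auto
  \<comment> \<open>Koenig's lemma: if each child of \<open>s\<close> were dead at some finite
    level, the finitely many admissible children would all be dead at the maximum \<open>k\<close>
    of these levels, against \<open>t \<in> V k s\<close>.\<close>
  have koenig: "\<exists>j. t \<in> Al (s @ [j])" if t: "t \<in> Al s" for t s
  proof (rule ccontr)
    assume "\<not> ?thesis"
    then have "\<forall>j. \<exists>k. k \<ge> Suc (length s) \<and> t \<notin> V k (s @ [j])" unfolding Al_def by auto
    then obtain K where K: "\<And>j. K j \<ge> Suc (length s)" "\<And>j. t \<notin> V (K j) (s @ [j])" by metis
    define k where "k = Max (insert (Suc (length s)) (K ` {..m (length s)}))"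
    have k: "k \<ge> Suc (length s)" "\<And>j. j \<le> m (length s) \<Longrightarrow> K j \<le> k"
      unfolding k_def by (rule Max_ge; simp)+
    have "t \<in> V k s" using t k(1) unfolding Al_def by simp
    then obtain s' where s': "s' \<in> L k" "take (length s) s' = s" "t \<in> space M"
      "\<And>n. n < k \<Longrightarrow> t \<in> A (take (Suc n) s')" by (auto simp: V_def)
    let ?j = "s' ! length s"
    have len: "length s < length s'" using s'(1) k(1) by (simp add: L_def)
    have "take (length (s @ [?j])) s' = s @ [?j]"
      using s'(2) len by (simp add: take_Suc_conv_app_nth)
    then have "t \<in> V k (s @ [?j])" using s' unfolding V_def by blast
    moreover have "?j \<le> m (length s)" using s'(1) len by (simp add: L_def)
    ultimately show False using K[of ?j] k(2)[of ?j] V_anti'[of "s @ [?j]" "K ?j" k] by auto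
  qed
  define path where "path t = rec_nat [] (\<lambda>_ s. s @ [LEAST j. t \<in> Al (s @ [j])])" for t
  define \<sigma> where "\<sigma> t n = (LEAST j. t \<in> Al (path t n @ [j]))" for t n
  have path0: "path t 0 = []" and pathS: "path t (Suc n) = path t n @ [\<sigma> t n]" for t n
    by (simp_all add: path_def \<sigma>_def)
  have path: "path t n = map (\<sigma> t) [0..<n]" for t n by (induction n) (simp_all add: path0 pathS)
  have path_meas: "(\<lambda>t. path t n) \<in> measurable M (count_space UNIV)"
    and \<sigma>_meas: "(\<lambda>t. \<sigma> t n) \<in> measurable M (count_space UNIV)" for n
  proof -
    have step: "(\<lambda>t. \<sigma> t n) \<in> measurable M (count_space UNIV)"
      if "(\<lambda>t. path t n) \<in> measurable M (count_space UNIV)" for n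
    proof -
      have "(\<lambda>t. LEAST j. t \<in> Al (s @ [j])) \<in> measurable M (count_space UNIV)" for s
        by measurable
      from measurable_compose_countable[OF this that] show ?thesis by (simp add: \<sigma>_def)
    qed
    show p: "(\<lambda>t. path t n) \<in> measurable M (count_space UNIV)" for n
    proof (induction n)
      case (Suc n)
      note [measurable] = step[OF Suc]
      have "(\<lambda>t. path t n @ [\<sigma> t n]) \<in> measurable M (count_space UNIV)"
        by (rule measurable_compose_countable[OF _ Suc],
            rule measurable_compose_countable[of "\<lambda>j t. _ @ [j]"]) auto
      then show ?case by (simp add: pathS)
    qed (simp add: path0)
    show "(\<lambda>t. \<sigma> t n) \<in> measurable M (count_space UNIV)" by (rule step[OF p])
  qed
  let ?B = "Al []"
  have alive: "t \<in> Al (path t n)" if "t \<in> ?B" for t n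
  proof (induction n)
    case 0 then show ?case using that by (simp add: path0)
  next
    case (Suc n) then show ?case unfolding pathS \<sigma>_def by (rule LeastI_ex[OF koenig])
  qed
  have inA: "t \<in> A (map (\<sigma> t) [0..<Suc n])" if "t \<in> ?B" for t n
  proof -
    have "t \<in> V (Suc n) (path t (Suc n))"
      using alive[OF that, of "Suc n"] unfolding Al_def by (simp add: path del: upt_Suc)
    then obtain s' where "take (length (path t (Suc n))) s' = path t (Suc n)" "s' \<in> L (Suc n)"
      "t \<in> A (take (Suc n) s')" unfolding V_def by blast
    then show ?thesis by (simp add: path L_def del: upt_Suc)
  qed
  have VQ: "Q (bs k) \<subseteq> V k []" for k
  proof
    fix t assume t: "t \<in> Q (bs k)"
    then obtain \<tau> where \<tau>: "\<forall>i<k. \<tau> i \<le> m i" "\<forall>n. t \<in> A (map \<tau> [0..<Suc n])"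
      unfolding Q_def bsm by auto
    have "map \<tau> [0..<k] \<in> L k" using \<tau> by (auto simp: L_def)
    moreover have "t \<in> A (take (Suc n) (map \<tau> [0..<k]))" if "n < k" for n
      using \<tau>(2)[rule_format, of n] that by (simp add: take_map del: upt_Suc)
    ultimately show "t \<in> V k []" using t Qsp unfolding V_def by auto
  qed
  \<comment> \<open>The measurable sets \<open>V k []\<close> contain \<open>Q (bs k)\<close> and
    decrease to \<open>Al []\<close>. Finiteness of the measure lets the lower bound
    \<open>a\<close> survive the limit.\<close>
  have "decseq (\<lambda>k. V k [])" by (rule decseq_SucI) (use V_anti in auto)
  then have "(INF k. emeasure M (V k [])) = emeasure M (\<Inter>k. V k [])"
    by (intro INF_emeasure_decseq) (auto simp: emeasure_finite)
  moreover have "a \<le> emeasure M (V k [])" for k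
  proof -
    have "a \<le> outer_measure_of M (Q (bs k))" using big by (simp add: less_imp_le)
    also have "\<dots> \<le> outer_measure_of M (V k [])" by (rule outer_measure_of_mono[OF VQ])
    finally show ?thesis by simp
  qed
  moreover have "?B = (\<Inter>k. V k [])" unfolding Al_def by auto
  ultimately have "a \<le> emeasure M ?B" by (metis INF_greatest)
  then show ?thesis
    by (intro exI[of _ ?B] exI[of _ \<sigma>] conjI allI ballI \<sigma>_meas inA) simp_all
qed

text \<open>The set \<open>P\<close> of points with an infinite branch need not be measurable.
  \<open>souslin_capacity\<close> supplies measurable pieces of it with measures approaching its
  outer measure; together they fill a measurable hull \<open>E\<close> up to a null set.\<close>

lemma souslin_branch_selection:
  fixes A :: "nat list \<Rightarrow> 't set"
  assumes "finite_measure M" and A: "\<And>s. A s \<in> sets M"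
  shows "\<exists>\<sigma>. (\<forall>n. (\<lambda>t. \<sigma> t n) \<in> measurable M (count_space (UNIV :: nat set)))
    \<and> (AE t in M. (\<exists>\<tau>. \<forall>n. t \<in> A (map \<tau> [0..<Suc n])) \<longrightarrow> (\<forall>n. t \<in> A (map (\<sigma> t) [0..<Suc n])))"
proof -
  interpret finite_measure M by fact
  define P where "P = {t. \<exists>\<tau>::nat \<Rightarrow> nat. \<forall>n. t \<in> A (map \<tau> [0..<Suc n])}"
  have "P \<subseteq> space M"
  proof
    fix t assume "t \<in> P"
    then obtain \<tau> :: "nat \<Rightarrow> nat" where \<tau>: "\<forall>n. t \<in> A (map \<tau> [0..<Suc n])"
      unfolding P_def by (elim CollectE exE)
    show "t \<in> space M" by (rule subsetD[OF sets.sets_into_space[OF A] \<tau>[rule_format, of 0]])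
  qed
  then obtain E where E: "E \<in> sets M" "P \<subseteq> E" "outer_measure_of M P = emeasure M E"
    using outer_measure_of_attain[of P M] by auto
  show ?thesis
  proof (cases "outer_measure_of M P = 0")
    case True
    then have "AE t in M. t \<notin> P" using E by (intro AE_I'[of E]) auto
    then show ?thesis by (intro exI[of _ "\<lambda>_ _. 0"]) (auto simp: P_def)
  next
    case False
    then have "0 < outer_measure_of M P" by (simp add: zero_less_iff_neq_zero)
    then obtain u :: "nat \<Rightarrow> ennreal" where u: "\<And>j. u j < outer_measure_of M P" "u \<longlonglongrightarrow> outer_measure_of M P"
      using approx_from_below_dense_linorder by metis
    have "\<forall>j. \<exists>B \<sigma>. B \<in> sets M \<and> u j \<le> emeasure M B
    \<and> (\<forall>n. (\<lambda>t. \<sigma> t n) \<in> measurable M (count_space (UNIV :: nat set)))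
    \<and> (\<forall>t\<in>B. \<forall>n. t \<in> A (map (\<sigma> t) [0..<Suc n]))"
      using u(1) unfolding P_def by (intro allI souslin_capacity assms) auto
    then obtain B \<sigma> where B[measurable]: "\<And>j::nat. B j \<in> sets M" and uB: "\<And>j. u j \<le> emeasure M (B j)"
      and \<sigma>: "\<And>j n. (\<lambda>t. \<sigma> j t n) \<in> measurable M (count_space (UNIV :: nat set))"
      and in_A: "\<And>j t n. t \<in> B j \<Longrightarrow> t \<in> A (map (\<sigma> j t) [0..<Suc n])"
      by metis
    have BE: "(\<Union>j. B j) \<subseteq> E" using E(2) in_A unfolding P_def by blast
    have "u j \<le> emeasure M (\<Union>j. B j)" for j
      by (rule order_trans[OF uB]) (auto intro!: emeasure_mono)
    then have "emeasure M E \<le> emeasure M (\<Union>j. B j)"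
      using u(2) unfolding E(3) by (intro LIMSEQ_le_const2) auto
    then have "emeasure M (E - (\<Union>j. B j)) = 0"
      using E(1) BE
          by (subst emeasure_Diff) (auto simp: emeasure_finite diff_eq_0_iff_ennreal
              less_top[symmetric])
    then have AE: "AE t in M. t \<notin> E - (\<Union>j. B j)"
      using E(1) by (intro AE_not_in) (auto simp: null_sets_def)
    define j where "j t = (LEAST j. t \<in> B j)" for t
    have j: "j \<in> measurable M (count_space UNIV)" unfolding j_def by measurable
    have "(\<lambda>t. \<sigma> (j t) t n) \<in> measurable M (count_space UNIV)" for n
      by (rule measurable_compose_countable[OF \<sigma> j])
    moreover have *: "t \<in> A (map (\<sigma> (j t) t) [0..<Suc n])" if "t \<in> (\<Union>j. B j)" for t n
      using that unfolding j_def by (intro in_A) (auto intro: LeastI)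
    have "AE t in M. (\<exists>\<tau>. \<forall>n. t \<in> A (map \<tau> [0..<Suc n])) \<longrightarrow> (\<forall>n. t \<in> A (map (\<sigma> (j t) t) [0..<Suc n]))"
      using AE
    proof eventually_elim
      case (elim t)
      then have "t \<in> P \<longrightarrow> t \<in> (\<Union>j. B j)" using E(2) by blast
      then show ?case using * unfolding P_def mem_Collect_eq by iprover
    qed
    ultimately show ?thesis by (intro exI[of _ "\<lambda>t. \<sigma> (j t) t"]) blast
  qed
qed

text \<open>A selection theorem of Aumann type, with no closedness of the sections. The branch is
  chosen measurably by \<open>souslin_branch_selection\<close>, and compactness of the second
  factors turns the branch into a point.\<close>

theorem measurable_selection:
  fixes M :: "'t measure" and S :: "('t \<times> 'b::euclidean_space) set"
  assumes "finite_measure M" and S: "S \<in> sets (M \<Otimes>\<^sub>M borel)"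
  shows "\<exists>f \<in> borel_measurable M. AE t in M. (\<exists>z. (t, z) \<in> S) \<longrightarrow> (t, f t) \<in> S"
proof -
  obtain R where R: "\<And>s. R s \<in> (compact_rectangles M :: ('t \<times> 'b) set set)"
    and SR: "\<And>z. z \<in> S \<longleftrightarrow> (\<exists>\<sigma>::nat \<Rightarrow> nat. \<forall>n. z \<in> R (map \<sigma> [0..<Suc n]))"
    by (rule souslinE[OF souslin_pair_measure[OF S]]) (rule that)
  have "\<forall>s. \<exists>A K. R s = A \<times> K \<and> A \<in> sets M \<and> compact K" using R by blast
  then obtain A0 K0 where AK0: "\<And>s. R s = A0 s \<times> K0 s" "\<And>s. A0 s \<in> sets M" "\<And>s. compact (K0 s)"
    by metis
  obtain D :: "'b set" where D: "countable D" "\<And>X. open X \<Longrightarrow> X \<noteq> {} \<Longrightarrow> \<exists>d\<in>D. d \<in> X"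
    using countable_dense_exists[where 'a='b] by (auto simp: Bex_def)
  have "D \<noteq> {}" using D(2)[of UNIV] by auto
  define d where "d = from_nat_into D"
  have d: "\<exists>i. dist (d i) z \<le> e" if "e > 0" for z e
  proof -
    have "ball z e \<noteq> {}" using that by simp
    then obtain x where "x \<in> D" "x \<in> ball z e"
      using D(2)[OF open_ball, of z e] by auto
    moreover obtain i where "d i = x"
      using from_nat_into_surj[OF D(1) \<open>x \<in> D\<close>] unfolding d_def by (elim exE)
    ultimately show ?thesis by (auto simp: dist_commute intro!: exI[of _ i])
  qed
  \<comment> \<open>Odd levels are used to shrink the diameter of the second factor.\<close>
  define A where "A s = (let n = length s - 1 in
      if even n then A0 (map (\<lambda>j. s ! (2 * j)) [0..<Suc (n div 2)]) else space M)" for s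
  define K where "K s = (let n = length s - 1 in
      if even n then K0 (map (\<lambda>j. s ! (2 * j)) [0..<Suc (n div 2)])
      else cball (d (s ! n)) (inverse (real (Suc (n div 2)))))" for s
  have A[measurable]: "A s \<in> sets M" for s by (auto simp: A_def AK0 Let_def)
  have K: "compact (K s)" for s by (auto simp: K_def AK0 Let_def)
  have ev: "map (\<lambda>j. map \<sigma> [0..<Suc (2 * m)] ! (2 * j)) [0..<Suc m]
      = map (\<lambda>j. \<sigma> (2 * j)) [0..<Suc m]" for \<sigma> :: "nat \<Rightarrow> nat" and m
    by (intro map_cong refl) (auto simp del: upt_Suc)
  have A_even: "A (map \<sigma> [0..<Suc (2 * m)]) = A0 (map (\<lambda>j. \<sigma> (2 * j)) [0..<Suc m])"
    and K_even: "K (map \<sigma> [0..<Suc (2 * m)]) = K0 (map (\<lambda>j. \<sigma> (2 * j)) [0..<Suc m])" for \<sigma> m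
    unfolding A_def K_def Let_def using ev[of \<sigma> m] by (simp_all del: upt_Suc map_eq_conv)
  have A_odd: "A (map \<sigma> [0..<Suc (Suc (2 * m))]) = space M"
    and K_odd: "K (map \<sigma> [0..<Suc (Suc (2 * m))])
        = cball (d (\<sigma> (Suc (2 * m)))) (inverse (real (Suc m)))" for \<sigma> m
    unfolding A_def K_def Let_def by (simp_all del: upt_Suc)
  have in_S: "(t, z) \<in> S" if "\<And>n. t \<in> A (map \<sigma> [0..<Suc n])" "\<And>n. z \<in> K (map \<sigma> [0..<Suc n])" for t z \<sigma>
    unfolding SR using that[of "2 * _"] unfolding A_even K_even
    by (intro exI[of _ "\<lambda>j. \<sigma> (2 * j)"]) (auto simp: AK0 simp del: upt_Suc)
  have S_in: "\<exists>\<sigma>. \<forall>n. t \<in> A (map \<sigma> [0..<Suc n]) \<and> z \<in> K (map \<sigma> [0..<Suc n])" if tz: "(t, z) \<in> S" for t z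
  proof -
    obtain \<tau> where \<tau>: "\<And>n. (t, z) \<in> R (map \<tau> [0..<Suc n])" using tz unfolding SR by blast
    have "t \<in> space M" using \<tau>[of 0] AK0(1) sets.sets_into_space[OF AK0(2)] by auto
    have "\<forall>m. \<exists>i. dist (d i) z \<le> inverse (real (Suc m))" by (intro allI d) simp
    then obtain i where i: "\<And>m. dist (d (i m)) z \<le> inverse (real (Suc m))" by metis
    define \<sigma> where "\<sigma> n = (if even n then \<tau> (n div 2) else i (n div 2))" for n
    have "t \<in> A (map \<sigma> [0..<Suc n]) \<and> z \<in> K (map \<sigma> [0..<Suc n])" for n
    proof (cases "even n")
      case True
      then obtain m where n: "n = 2 * m" by blast
      show ?thesis using \<tau>[of m] unfolding n A_even K_even by (simp add: \<sigma>_def AK0 del: upt_Suc)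
    next
      case False
      then obtain m where n: "n = Suc (2 * m)" by (metis oddE Suc_eq_plus1)
      show ?thesis using i[of m] \<open>t \<in> space M\<close> unfolding n A_odd K_odd by (simp add: \<sigma>_def del: upt_Suc)
    qed
    then show ?thesis by blast
  qed
  define C where "C s = (\<Inter>n\<in>{..<length s}. K (take (Suc n) s))" for s
  \<comment> \<open>Nodes at which the compact parts met so far have empty intersection are deleted.
    By compactness every surviving infinite branch then carries a point, so conditions on
    \<open>t\<close> alone decide whether the section over \<open>t\<close> is nonempty.\<close>
  define A' where "A' s = (if C s = {} then {} else A s)" for s
  have A': "A' s \<in> sets M" for s by (simp add: A'_def)
  obtain \<sigma> where \<sigma>': "\<forall>n. (\<lambda>t. \<sigma> t n) \<in> measurable M (count_space (UNIV :: nat set))"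
    and AE: "AE t in M. (\<exists>\<tau>. \<forall>n. t \<in> A' (map \<tau> [0..<Suc n])) \<longrightarrow> (\<forall>n. t \<in> A' (map (\<sigma> t) [0..<Suc n]))"
    using souslin_branch_selection[where A = A', OF assms(1) A'] by (elim exE conjE) (rule that)
  note \<sigma> = \<sigma>'[rule_format]
  have C: "C (map \<tau> [0..<Suc n]) = (\<Inter>i\<in>{..n}. K (map \<tau> [0..<Suc i]))" for \<tau> n
  proof -
    have "take (Suc i) (map \<tau> [0..<Suc n]) = map \<tau> [0..<Suc i]" if "i \<le> n" for i
      using that take_upt[of 0 "Suc i" "Suc n"] by (simp add: take_map del: upt_Suc)
    then show ?thesis
      unfolding C_def by (intro INF_cong) (auto simp del: upt_Suc)
  qed
  \<comment> \<open>The choice depends on \<open>t\<close> only through a finite list of natural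
    numbers, so measurability follows from countability, whatever \<open>SOME\<close>
    returns.\<close>
  define f where "f n t = (SOME z. z \<in> C (map (\<sigma> t) [0..<Suc n]))" for n t
  have f[measurable]: "f n \<in> borel_measurable M" for n
    unfolding f_def by (rule measurable_compose[OF measurable_list_compose[OF \<sigma>]]) simp
  define F where "F t = lim (\<lambda>n. f n t)" for t
  have F: "F \<in> borel_measurable M" unfolding F_def by measurable
  have FS: "(t, F t) \<in> S" if t: "\<And>n. t \<in> A' (map (\<sigma> t) [0..<Suc n])" for t
  proof -
    have ne: "C (map (\<sigma> t) [0..<Suc n]) \<noteq> {}" and tA: "t \<in> A (map (\<sigma> t) [0..<Suc n])" for n
      using t[of n] unfolding A'_def by (auto split: if_splits simp del: upt_Suc)
    have "(\<Inter>n. C (map (\<sigma> t) [0..<Suc n])) \<noteq> {}"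
    proof (rule compact_nest)
      show "compact (C (map (\<sigma> t) [0..<Suc n]))" for n
        unfolding C using K by (intro compact_Inter) auto
      show "C (map (\<sigma> t) [0..<Suc n]) \<subseteq> C (map (\<sigma> t) [0..<Suc m])" if "m \<le> n" for m n
        unfolding C using that by (intro INF_superset_mono) auto
    qed (rule ne)
    then obtain z where z: "\<And>n. z \<in> C (map (\<sigma> t) [0..<Suc n])" by blast
    then have zK: "z \<in> K (map (\<sigma> t) [0..<Suc n])" for n unfolding C by blast
    have "(\<lambda>n. f n t) \<longlonglongrightarrow> z"
    proof (rule LIMSEQ_I)
      fix r :: real assume "r > 0"
      then obtain m where m: "inverse (real (Suc m)) < r / 2" using reals_Archimedean[of "r/2"] by auto
      have "norm (f n t - z) < r" if n: "n \<ge> Suc (2 * m)" for n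
      proof -
        have "f n t \<in> C (map (\<sigma> t) [0..<Suc n])" unfolding f_def using ne[of n]
            by (simp add: some_in_eq del: upt_Suc)
        then have "f n t \<in> K (map (\<sigma> t) [0..<Suc (Suc (2 * m))])" using n unfolding C by blast
        then have "dist (d (\<sigma> t (Suc (2 * m)))) (f n t) < r / 2" using m unfolding K_odd by auto
        moreover have "dist (d (\<sigma> t (Suc (2 * m)))) z < r / 2"
          using zK[of "Suc (2 * m)"] m unfolding K_odd by auto
        ultimately show ?thesis
          unfolding dist_norm[symmetric] by (metis dist_triangle_half_r)
      qed
      then show "\<exists>no. \<forall>n\<ge>no. norm (f n t - z) < r" by blast
    qed
    then have "F t = z" unfolding F_def by (rule limI)
    then show ?thesis using in_S[OF tA zK] by simp
  qed
  have SA: "\<exists>\<tau>. \<forall>n. t \<in> A' (map \<tau> [0..<Suc n])" if "(t, z) \<in> S" for t z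
  proof -
    obtain \<tau> where \<tau>: "\<forall>n. t \<in> A (map \<tau> [0..<Suc n]) \<and> z \<in> K (map \<tau> [0..<Suc n])"
      using S_in[OF \<open>(t, z) \<in> S\<close>] by (elim exE)
    then have "z \<in> C (map \<tau> [0..<Suc n])" for n unfolding C by blast
    then show ?thesis using \<tau> unfolding A'_def by (intro exI[of _ \<tau>]) (auto simp del: upt_Suc)
  qed
  have "AE t in M. (\<exists>z. (t, z) \<in> S) \<longrightarrow> (t, F t) \<in> S"
    using AE
  proof eventually_elim
    case (elim t)
    show ?case
    proof
      assume "\<exists>z. (t, z) \<in> S"
      then have "\<exists>\<tau>. \<forall>n. t \<in> A' (map \<tau> [0..<Suc n])" using SA by (elim exE)
      then show "(t, F t) \<in> S" by (intro FS elim[rule_format])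
    qed
  qed
  then show ?thesis using F by (intro bexI[of _ F])
qed

section \<open>Lyapunov's convexity theorem\<close>

lemma linear_relation_exists:
  fixes a :: "'i \<Rightarrow> 'b::euclidean_space"
  assumes "finite F" and "card F > DIM('b)"
  shows "\<exists>\<beta>. (\<exists>i\<in>F. \<beta> i \<noteq> 0) \<and> (\<Sum>i\<in>F. \<beta> i *\<^sub>R a i) = 0"
proof (cases "inj_on a F")
  case True
  then have "dependent (a ` F)"
    using assms by (intro dependent_biggerset) (auto simp: card_image)
  then obtain u where u: "\<exists>v\<in>a ` F. u v \<noteq> 0" "(\<Sum>v\<in>a ` F. u v *\<^sub>R v) = 0"
    using dependent_finite[of "a ` F"] assms(1) by auto
  then show ?thesis
    using True by (intro exI[of _ "u \<circ> a"]) (auto simp: sum.reindex)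
next
  case False
  then obtain i j where ij: "i \<in> F" "j \<in> F" "i \<noteq> j" "a i = a j" by (auto simp: inj_on_def)
  let ?\<beta> = "\<lambda>k. if k = i then 1 else if k = j then - 1 else (0::real)"
  have "(\<Sum>k\<in>F. ?\<beta> k *\<^sub>R a k) = (\<Sum>k\<in>{i, j}. ?\<beta> k *\<^sub>R a k)"
    using ij assms(1) by (intro sum.mono_neutral_right) auto
  also have "\<dots> = 0" using ij by simp
  finally show ?thesis using ij by (intro exI[of _ ?\<beta>]) auto
qed

text \<open>A vertex argument: while more than \<open>DIM('b)\<close> weights are fractional, their
  vectors satisfy a linear relation, along which the weights move without changing the sum until one
  more of them is 0 or 1. That weights 0 and 1 stay fixed is what makes the iteration in
  \<open>lyapunov\<close> stabilise.\<close>

lemma few_fractional_weights: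
  fixes a :: "'i \<Rightarrow> 'b::euclidean_space" and w :: "'i \<Rightarrow> real"
  assumes "finite I" and "\<forall>i\<in>I. 0 \<le> w i \<and> w i \<le> 1"
  shows "\<exists>w'. (\<forall>i\<in>I. 0 \<le> w' i \<and> w' i \<le> 1) \<and> (\<forall>i\<in>I. w i \<in> {0, 1} \<longrightarrow> w' i = w i) \<and>
    (\<Sum>i\<in>I. w' i *\<^sub>R a i) = (\<Sum>i\<in>I. w i *\<^sub>R a i) \<and>
    card {i\<in>I. 0 < w' i \<and> w' i < 1} \<le> DIM('b)"
  using assms(2)
proof (induction "card {i\<in>I. 0 < w i \<and> w i < 1}" arbitrary: w rule: less_induct)
  case less
  define F where "F = {i\<in>I. 0 < w i \<and> w i < 1}"
  have F: "finite F" "F \<subseteq> I" using assms(1) by (auto simp: F_def)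
  show ?case
  proof (cases "card F \<le> DIM('b)")
    case True
    then show ?thesis using less.prems by (intro exI[of _ w]) (auto simp: F_def)
  next
    case False
    then obtain \<beta> where \<beta>: "\<exists>i\<in>F. \<beta> i \<noteq> 0" "(\<Sum>i\<in>F. \<beta> i *\<^sub>R a i) = 0"
      using linear_relation_exists[OF F(1), of a] by auto
    define F' where "F' = {i\<in>F. \<beta> i \<noteq> 0}"
    \<comment> \<open>The step length at which weight \<open>i\<close>, moving in the direction
      \<open>\<beta>\<close>, reaches 0 or 1. The minimum \<open>s\<close> is the longest step that
      keeps all weights in [0, 1].\<close>
    define \<tau> where "\<tau> i = (if \<beta> i > 0 then (1 - w i) / \<beta> i else w i / - \<beta> i)" for i
    have F': "finite F'" "F' \<noteq> {}" "F' \<subseteq> F" using \<beta> F by (auto simp: F'_def)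
    define s where "s = Min (\<tau> ` F')"
    have "s \<in> \<tau> ` F'" unfolding s_def using F' by (intro Min_in) auto
    then obtain i0 where i0: "i0 \<in> F'" "s = \<tau> i0" by blast
    have s_le: "s \<le> \<tau> i" if "i \<in> F'" for i unfolding s_def using F' that by (intro Min_le) auto
    have wF: "0 < w i \<and> w i < 1" if "i \<in> F" for i using that by (simp add: F_def)
    have s0: "s \<ge> 0"
      unfolding i0(2) \<tau>_def using wF[of i0] i0(1) F' by (auto simp: F'_def divide_nonneg_neg)
    define v where "v i = (if i \<in> F then w i + s * \<beta> i else w i)" for i
    have vF: "0 \<le> v i \<and> v i \<le> 1" if i: "i \<in> F" for i
    proof (cases "\<beta> i = 0")
      case True then show ?thesis using wF[OF i] i by (simp add: v_def)
    next
      case False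
      then have le: "s \<le> \<tau> i" using i s_le by (simp add: F'_def)
      show ?thesis
      proof (cases "\<beta> i > 0")
        case True
        then have "s * \<beta> i \<le> 1 - w i" using le by (simp add: \<tau>_def field_simps)
        moreover have "0 \<le> s * \<beta> i" using True s0 by simp
        ultimately show ?thesis using wF[OF i] i by (simp add: v_def)
      next
        case neg: False
        then have b: "\<beta> i < 0" using False by simp
        have "s \<le> w i / - \<beta> i" using le neg by (simp add: \<tau>_def)
        then have "s * - \<beta> i \<le> w i" using b by (subst (asm) pos_le_divide_eq) auto
        moreover have "s * \<beta> i \<le> 0" using b s0 by (simp add: mult_nonneg_nonpos)
        ultimately show ?thesis using wF[OF i] i by (simp add: v_def)
      qed
    qed
    have v01: "\<forall>i\<in>I. 0 \<le> v i \<and> v i \<le> 1"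
      using vF less.prems by (auto simp: v_def)
    have vi0: "v i0 \<in> {0, 1}"
      using i0 F' by (auto simp: v_def \<tau>_def F'_def)
    have sub: "{i\<in>I. 0 < v i \<and> v i < 1} \<subset> F"
    proof
      show "{i \<in> I. 0 < v i \<and> v i < 1} \<subseteq> F" by (auto simp: v_def F_def split: if_splits)
      show "{i \<in> I. 0 < v i \<and> v i < 1} \<noteq> F" using i0(1) F' vi0 by force
    qed
    have "(\<Sum>i\<in>I. v i *\<^sub>R a i) = (\<Sum>i\<in>I. w i *\<^sub>R a i + (if i \<in> F then s *\<^sub>R (\<beta> i *\<^sub>R a i) else 0))"
      by (intro sum.cong) (auto simp: v_def algebra_simps)
    also have "\<dots> = (\<Sum>i\<in>I. w i *\<^sub>R a i) + (\<Sum>i\<in>F. s *\<^sub>R (\<beta> i *\<^sub>R a i))"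
      using F assms(1) by (simp add: sum.distrib sum.inter_restrict[symmetric] Int_absorb1)
    also have "\<dots> = (\<Sum>i\<in>I. w i *\<^sub>R a i)"
      using \<beta>(2) by (simp add: scaleR_right.sum[symmetric] del: scaleR_scaleR)
    finally have sum_v: "(\<Sum>i\<in>I. v i *\<^sub>R a i) = (\<Sum>i\<in>I. w i *\<^sub>R a i)" .
    have "card {i\<in>I. 0 < v i \<and> v i < 1} < card {i\<in>I. 0 < w i \<and> w i < 1}"
      using psubset_card_mono[OF F(1) sub] by (simp add: F_def)
    from less.hyps[OF this v01] obtain w' where w': "\<forall>i\<in>I. 0 \<le> w' i \<and> w' i \<le> 1"
      "\<forall>i\<in>I. v i \<in> {0, 1} \<longrightarrow> w' i = v i" "(\<Sum>i\<in>I. w' i *\<^sub>R a i) = (\<Sum>i\<in>I. v i *\<^sub>R a i)"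
      "card {i\<in>I. 0 < w' i \<and> w' i < 1} \<le> DIM('b)" by auto
    have "\<forall>i\<in>I. w i \<in> {0, 1} \<longrightarrow> w' i = w i"
    proof (intro ballI impI)
      fix i assume i: "i \<in> I" "w i \<in> {0, 1}"
      then have "v i = w i" by (auto simp: v_def F_def)
      then show "w' i = w i" using w'(2) i by auto
    qed
    then show ?thesis using w' sum_v by (intro exI[of _ w']) simp
  qed
qed

section \<open>Nonatomic measures: small sets and fine partitions\<close>

lemma nonatomic_halving:
  assumes "finite_measure N" "nonatomic N" "A \<in> sets N" "measure N A > 0"
  shows "\<exists>B\<in>sets N. B \<subseteq> A \<and> 0 < measure N B \<and> measure N B \<le> measure N A / 2 ^ n"
proof (induction n)
  case 0 then show ?case using assms by auto
next
  case (Suc n)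
  interpret finite_measure N by fact
  obtain B where B: "B \<in> sets N" "B \<subseteq> A" "0 < measure N B" "measure N B \<le> measure N A / 2 ^ n"
    using Suc by blast
  have "\<not> is_atom N B" using assms(2) by (simp add: nonatomic_def)
  then obtain C where C: "C \<in> sets N" "C \<subseteq> B" "emeasure N C \<noteq> 0" "emeasure N (B - C) \<noteq> 0"
    using B by (auto simp: is_atom_def emeasure_eq_measure)
  have pos: "measure N C > 0" "measure N (B - C) > 0"
    using C(3,4) by (auto simp: emeasure_eq_measure zero_less_measure_iff)
  have Diff: "measure N (B - C) = measure N B - measure N C"
    using B C by (intro finite_measure_Diff) auto
  show ?case
  proof (cases "measure N C \<le> measure N B / 2")
    case True
    then have "measure N C \<le> measure N A / 2 ^ Suc n" using B(4) by simp
    then show ?thesis using pos B C by (intro bexI[of _ C]) auto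
  next
    case False
    then have "measure N (B - C) \<le> measure N A / 2 ^ Suc n" using B(4) Diff by simp
    then show ?thesis using pos B C by (intro bexI[of _ "B - C"]) auto
  qed
qed

lemma nonatomic_small_subset:
  assumes "finite_measure N" "nonatomic N" "A \<in> sets N" "measure N A > 0" "e > 0"
  shows "\<exists>B\<in>sets N. B \<subseteq> A \<and> 0 < measure N B \<and> measure N B \<le> e"
proof -
  have "(\<lambda>n. measure N A / 2 ^ n) \<longlonglongrightarrow> 0"
    using LIMSEQ_divide_realpow_zero[of 2 "measure N A"] by simp
  from order_tendstoD(2)[OF this \<open>e > 0\<close>] obtain n where "measure N A / 2 ^ n < e"
    by (auto simp: eventually_sequentially)
  moreover obtain B where "B \<in> sets N" "B \<subseteq> A" "0 < measure N B" "measure N B \<le> measure N A / 2 ^ n"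
    using nonatomic_halving[OF assms(1-4), of n] by (elim bexE conjE) (rule that)
  ultimately show ?thesis by (intro bexI[of _ B] conjI) auto
qed

text \<open>The measures of the sets \<open>H n\<close> approach the supremum over the family, so a
  member disjoint from all of them with positive measure could be added to exceed that
  supremum.\<close>

lemma measurable_exhaustion:
  assumes "finite_measure M" and ne: "\<G> \<noteq> {}" and sub: "\<G> \<subseteq> sets M"
    and Un: "\<And>G H. G \<in> \<G> \<Longrightarrow> H \<in> \<G> \<Longrightarrow> G \<union> H \<in> \<G>"
  shows "\<exists>H::nat \<Rightarrow> 'a set. (\<forall>n. H n \<in> \<G>) \<and> incseq H \<and> (\<forall>B\<in>\<G>. B \<inter> (\<Union>n. H n) = {} \<longrightarrow> measure M B = 0)"
proof -
  interpret finite_measure M by fact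
  define s where "s = (SUP G\<in>\<G>. measure M G)"
  have bdd: "bdd_above (measure M ` \<G>)"
    by (rule bdd_aboveI2[of _ _ "measure M (space M)"]) (auto intro: bounded_measure)
  have le_s: "measure M G \<le> s" if "G \<in> \<G>" for G
    unfolding s_def using that bdd by (intro cSUP_upper) auto
  have "\<forall>n. \<exists>G. G \<in> \<G> \<and> s - inverse (real (Suc n)) < measure M G"
  proof
    fix n
    have "s - inverse (real (Suc n)) < s" by simp
    then show "\<exists>G. G \<in> \<G> \<and> s - inverse (real (Suc n)) < measure M G"
      unfolding s_def using ne bdd by (subst (asm) less_cSUP_iff) auto
  qed
  then obtain G where G: "\<And>n. G n \<in> \<G>" "\<And>n. s - inverse (real (Suc n)) < measure M (G n)" by metis
  define H where "H n = (\<Union>i\<le>n. G i)" for n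
  have H: "H n \<in> \<G>" for n
  proof (induction n)
    case 0 then show ?case using G by (simp add: H_def)
  next
    case (Suc n)
    have "H (Suc n) = H n \<union> G (Suc n)" by (auto simp: H_def le_Suc_eq)
    then show ?case using Un[OF Suc G(1)] by simp
  qed
  have H_sets[measurable]: "H n \<in> sets M" for n using H sub by blast
  have inc: "incseq H" unfolding H_def by (rule incseq_SucI) (auto intro: le_SucI)
  then have lim: "(\<lambda>n. measure M (H n)) \<longlonglongrightarrow> measure M (\<Union>n. H n)"
    by (intro finite_Lim_measure_incseq) auto
  have GU: "measure M (G n) \<le> measure M (\<Union>n. H n)" for n
  proof (rule finite_measure_mono)
    show "G n \<subseteq> (\<Union>n. H n)" unfolding H_def by auto
  qed measurable
  have s_le: "s \<le> measure M (\<Union>n. H n)"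
  proof (rule LIMSEQ_le_const2)
    have "(\<lambda>n. s - inverse (real (Suc n))) \<longlonglongrightarrow> s - 0"
      by (intro tendsto_diff tendsto_const LIMSEQ_inverse_real_of_nat)
    then show "(\<lambda>n. s - inverse (real (Suc n))) \<longlonglongrightarrow> s" by simp
    show "\<exists>k. \<forall>n\<ge>k. s - inverse (real (Suc n)) \<le> measure M (\<Union>n. H n)"
      using G(2) GU by (meson less_imp_le order_trans)
  qed
  have "measure M B = 0" if B: "B \<in> \<G>" "B \<inter> (\<Union>n. H n) = {}" for B
  proof -
    have le: "measure M (H n) + measure M B \<le> s" for n
    proof -
      have "measure M (H n \<union> B) = measure M (H n) + measure M B"
        using B sub by (intro finite_measure_Union) auto
      then show ?thesis using le_s[OF Un[OF H B(1)], of n] by simp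
    qed
    have "(\<lambda>n. measure M (H n) + measure M B) \<longlonglongrightarrow> measure M (\<Union>n. H n) + measure M B"
      by (intro tendsto_add lim tendsto_const)
    then have "measure M (\<Union>n. H n) + measure M B \<le> s"
      using le by (intro LIMSEQ_le_const2) auto
    then show ?thesis using s_le measure_nonneg[of M B] by linarith
  qed
  then show ?thesis using H inc by (intro exI[of _ H]) simp
qed

text \<open>Exhaustion by sets that have a finite partition into small pieces. What lies outside the
  union is null by \<open>nonatomic_small_subset\<close>, so after finitely many steps the rest has
  measure at most \<open>e\<close> and is itself one more piece.\<close>

lemma nonatomic_small_partition:
  assumes "finite_measure N" "nonatomic N" "e > 0"
  shows "\<exists>P. finite P \<and> P \<subseteq> sets N \<and> disjoint P \<and> \<Union>P = space N \<and> (\<forall>A\<in>P. measure N A \<le> e)"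
proof -
  interpret finite_measure N by fact
  define good where
      "good G \<longleftrightarrow> (\<exists>P. finite P \<and> P \<subseteq> sets N \<and> disjoint P \<and> \<Union>P = G \<and> (\<forall>A\<in>P. measure N A \<le> e))" for G
  have good_sets: "G \<in> sets N" if "good G" for G
    using that unfolding good_def by (metis sets.finite_Union)
  have good_small: "good A" if "A \<in> sets N" "measure N A \<le> e" for A
    unfolding good_def using that by (intro exI[of _ "{A}"]) auto
  have good_Un: "good (G \<union> H)" if GH: "good G" "good H" for G H
  proof -
    obtain P where P: "finite P" "P \<subseteq> sets N" "disjoint P" "\<Union>P = G" "\<forall>A\<in>P. measure N A \<le> e"
      using GH(1) by (auto simp: good_def)
    obtain Q where Q: "finite Q" "Q \<subseteq> sets N" "disjoint Q" "\<Union>Q = H" "\<forall>A\<in>Q. measure N A \<le> e"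
      using GH(2) by (auto simp: good_def)
    let ?R = "P \<union> (\<lambda>A. A - G) ` Q"
    have "measure N (A - G) \<le> e" if "A \<in> Q" for A
    proof -
      have "measure N (A - G) \<le> measure N A" using that Q(2) by (intro finite_measure_mono) auto
      then show ?thesis using Q(5) that by force
    qed
    moreover have "disjoint ?R"
    proof (rule disjoint_union)
      show "disjoint ((\<lambda>A. A - G) ` Q)"
        using Q(3) unfolding disjoint_def by (auto dest: bspec)
      show "\<Union>P \<inter> \<Union>((\<lambda>A. A - G) ` Q) = {}" using P(4) by auto
    qed (rule P(3))
    moreover have "?R \<subseteq> sets N" using P(2) Q(2) good_sets[OF GH(1)] by auto
    moreover have "\<Union>?R = G \<union> H" using P(4) Q(4) by auto
    ultimately show ?thesis unfolding good_def using P Q by (intro exI[of _ ?R]) auto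
  qed
  have "good {}" unfolding good_def by (intro exI[of _ "{}"]) auto
  then have "\<exists>H::nat \<Rightarrow> 'a set. (\<forall>n. H n \<in> {G. good G}) \<and> incseq H \<and>
      (\<forall>B\<in>{G. good G}. B \<inter> (\<Union>n. H n) = {} \<longrightarrow> measure N B = 0)"
    using good_sets good_Un by (intro measurable_exhaustion assms(1)) auto
  then obtain H :: "nat \<Rightarrow> 'a set" where H: "\<And>n. good (H n)" and inc: "incseq H"
    and rest: "\<And>B. good B \<Longrightarrow> B \<inter> (\<Union>n. H n) = {} \<Longrightarrow> measure N B = 0" by auto
  note H_sets[measurable] = good_sets[OF H]
  have lim: "(\<lambda>n. measure N (H n)) \<longlonglongrightarrow> measure N (\<Union>n. H n)"
    using inc by (intro finite_Lim_measure_incseq) auto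
  let ?R = "space N - (\<Union>n. H n)"
  have R0: "measure N ?R = 0"
  proof (rule ccontr)
    assume "measure N ?R \<noteq> 0"
    then have "measure N ?R > 0" by (simp add: zero_less_measure_iff)
    moreover have "?R \<in> sets N" by measurable
    ultimately obtain B where B: "B \<in> sets N" "B \<subseteq> ?R" "0 < measure N B" "measure N B \<le> e"
      using nonatomic_small_subset[OF assms(1,2) _ _ assms(3)] by blast
    then show False using rest[OF good_small[OF B(1,4)]] by auto
  qed
  have "measure N (\<Union>n. H n) > measure N (space N) - e"
  proof -
    have "measure N ?R = measure N (space N) - measure N (\<Union>n. H n)"
      by (intro finite_measure_compl) measurable
    then show ?thesis using R0 assms(3) by simp
  qed
  from order_tendstoD(1)[OF lim this] obtain n where n: "measure N (H n) > measure N (space N) - e"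
    by (auto simp: eventually_sequentially)
  have "measure N (space N - H n) = measure N (space N) - measure N (H n)"
    by (intro finite_measure_compl) measurable
  then have "good (space N - H n)" using n by (intro good_small) auto
  from good_Un[OF H this, of n] have "good (space N)"
    using sets.sets_into_space[OF H_sets, of n] by (simp add: Un_absorb1)
  then show ?thesis unfolding good_def .
qed

text \<open>
  On a fine partition on which \<open>w\<close> is constant, linear algebra moves all but \<open>DIM('b)\<close> of the weights
  to 0 or 1.  Iterating with \<open>e\<close> tending to 0 gives Lyapunov's theorem.
\<close>

lemma lyapunov_step:
  fixes f :: "'t \<Rightarrow> 'b::euclidean_space" and w :: "'t \<Rightarrow> real"
  assumes "finite_measure N" "nonatomic N" and f: "integrable N f"
    and w: "simple_function N w" and w01: "\<And>t. t \<in> space N \<Longrightarrow> 0 \<le> w t \<and> w t \<le> 1" and "e > 0"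
  shows "\<exists>w'. simple_function N w' \<and> (\<forall>t\<in>space N. 0 \<le> w' t \<and> w' t \<le> 1) \<and>
     (\<forall>t\<in>space N. w t \<in> {0, 1} \<longrightarrow> w' t = w t) \<and>
     (\<integral>t. w' t *\<^sub>R f t \<partial>N) = (\<integral>t. w t *\<^sub>R f t \<partial>N) \<and>
     measure N {t\<in>space N. 0 < w' t \<and> w' t < 1} \<le> e"
proof -
  interpret finite_measure N by fact
  let ?n = "real DIM('b)"
  \<comment> \<open>At most \<open>DIM('b)\<close> cells will keep a fractional weight, so cells of
    measure \<open>e / DIM('b)\<close> leave a fractional set of measure at most
    \<open>e\<close>.\<close>
  have "e / ?n > 0" using \<open>e > 0\<close> by simp
  from nonatomic_small_partition[OF assms(1,2) this] obtain P where
    P: "finite P" "P \<subseteq> sets N" "disjoint P" "\<Union>P = space N" "\<And>A. A \<in> P \<Longrightarrow> measure N A \<le> e / ?n"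
    by auto
  \<comment> \<open>Indices of the common refinement of \<open>P\<close> and the level sets of
    \<open>w\<close>; the first component is the value of \<open>w\<close> on the cell.\<close>
  define I where "I = (w ` space N) \<times> P"
  define B where "B i = (w -` {fst i} \<inter> space N) \<inter> snd i" for i
  have finI: "finite I" unfolding I_def using P(1) w by (auto simp: simple_function_def)
  have B[measurable]: "B i \<in> sets N" if "i \<in> I" for i
    using that P(2) simple_functionD(2)[OF w, of "{fst i}"] unfolding I_def B_def by (auto simp: vimage_def)
  have uniq: "\<exists>i\<in>I. t \<in> B i \<and> fst i = w t \<and> (\<forall>j\<in>I. t \<in> B j \<longrightarrow> j = i)" if t: "t \<in> space N" for t
  proof -
    obtain A where A: "A \<in> P" "t \<in> A" using t P(4) by auto
    have *: "\<forall>j\<in>I. t \<in> B j \<longrightarrow> j = (w t, A)"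
      using A P(3) unfolding I_def B_def disjoint_def by (auto simp: prod_eq_iff)
    have "(w t, A) \<in> I" "t \<in> B (w t, A)" using A t by (simp_all add: I_def B_def)
    then show ?thesis by (intro bexI[of _ "(w t, A)"] conjI *) (simp_all only: fst_conv)
  qed
  have step: "(\<Sum>i\<in>I. c i * indicator (B i) t) = c i" if "i \<in> I" "t \<in> B i" for c :: "_ \<Rightarrow> real" and i t
  proof -
    have t: "t \<in> space N" using that by (auto simp: B_def)
    have "(\<Sum>j\<in>I. c j * indicator (B j) t) = (\<Sum>j\<in>{i}. c j * indicator (B j) t)"
      using uniq[OF t] that finI by (intro sum.mono_neutral_right) (auto simp: indicator_def)
    then show ?thesis using that by simp
  qed
  have int_step:
      "(\<integral>t. (\<Sum>i\<in>I. c i * indicator (B i) t) *\<^sub>R f t \<partial>N)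
          = (\<Sum>i\<in>I. c i *\<^sub>R (\<integral>t. indicator (B i) t *\<^sub>R f t \<partial>N))" for c :: "_ \<Rightarrow> real"
  proof -
    have "(\<integral>t. (\<Sum>i\<in>I. c i * indicator (B i) t) *\<^sub>R f t \<partial>N)
        = (\<integral>t. (\<Sum>i\<in>I. c i *\<^sub>R (indicator (B i) t *\<^sub>R f t)) \<partial>N)"
      by (simp add: scaleR_sum_left)
    also have "\<dots> = (\<Sum>i\<in>I. \<integral>t. c i *\<^sub>R (indicator (B i) t *\<^sub>R f t) \<partial>N)"
      using f by (intro Bochner_Integration.integral_sum integrable_scaleR_right
          integrable_mult_indicator B)
    also have "\<dots> = (\<Sum>i\<in>I. c i *\<^sub>R (\<integral>t. indicator (B i) t *\<^sub>R f t \<partial>N))"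
      by (simp del: scaleR_scaleR)
    finally show ?thesis .
  qed
  have fst01: "\<forall>i\<in>I. 0 \<le> fst i \<and> fst i \<le> 1" using w01 by (auto simp: I_def)
  from few_fractional_weights[where a = "\<lambda>i. \<integral>t. indicator (B i) t *\<^sub>R f t \<partial>N" and w = fst, OF finI fst01]
  obtain c where c: "\<forall>i\<in>I. 0 \<le> c i \<and> c i \<le> 1" "\<forall>i\<in>I. fst i \<in> {0, 1} \<longrightarrow> c i = fst i"
    "(\<Sum>i\<in>I. c i *\<^sub>R (\<integral>t. indicator (B i) t *\<^sub>R f t \<partial>N))
        = (\<Sum>i\<in>I. fst i *\<^sub>R (\<integral>t. indicator (B i) t *\<^sub>R f t \<partial>N))"
    "card {i\<in>I. 0 < c i \<and> c i < 1} \<le> DIM('b)" by (elim exE conjE) (rule that)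
  define w' where "w' t = (\<Sum>i\<in>I. c i * indicator (B i) t)" for t
  have w'B: "\<exists>i\<in>I. t \<in> B i \<and> fst i = w t \<and> w' t = c i" if t: "t \<in> space N" for t
  proof -
    obtain i where "i \<in> I" "t \<in> B i" "fst i = w t" using uniq[OF t] by (elim bexE conjE) (rule that)
    then show ?thesis using step[of i t c] by (intro bexI[of _ i]) (simp_all only: w'_def)
  qed
  let ?J = "{i\<in>I. 0 < c i \<and> c i < 1}"
  have "simple_function N w'"
    unfolding w'_def
        by (intro simple_function_sum simple_function_mult simple_function_const
            simple_function_indicator B)
  moreover have "\<forall>t\<in>space N. 0 \<le> w' t \<and> w' t \<le> 1" using w'B c(1) by metis
  moreover have "\<forall>t\<in>space N. w t \<in> {0, 1} \<longrightarrow> w' t = w t" using w'B c(2) by metis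
  moreover have "(\<integral>t. w' t *\<^sub>R f t \<partial>N) = (\<integral>t. w t *\<^sub>R f t \<partial>N)"
  proof -
    have "(\<integral>t. w t *\<^sub>R f t \<partial>N) = (\<integral>t. (\<Sum>i\<in>I. fst i * indicator (B i) t) *\<^sub>R f t \<partial>N)"
    proof (rule Bochner_Integration.integral_cong[OF refl])
      fix t assume "t \<in> space N"
      from uniq[OF this] obtain i where "i \<in> I" "t \<in> B i" "fst i = w t" by (elim bexE conjE) (rule that)
      then show "w t *\<^sub>R f t = (\<Sum>i\<in>I. fst i * indicator (B i) t) *\<^sub>R f t" using step[of i t fst] by simp
    qed
    then show ?thesis unfolding w'_def int_step c(3) by simp
  qed
  moreover have "measure N {t\<in>space N. 0 < w' t \<and> w' t < 1} \<le> e"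
  proof -
    have "{t\<in>space N. 0 < w' t \<and> w' t < 1} \<subseteq> (\<Union>i\<in>?J. B i)"
    proof
      fix t assume t: "t \<in> {t\<in>space N. 0 < w' t \<and> w' t < 1}"
      then obtain i where "i \<in> I" "t \<in> B i" "w' t = c i" using w'B[of t] by auto
      then show "t \<in> (\<Union>i\<in>?J. B i)" using t by (intro UN_I[of i]) simp_all
    qed
    then have "measure N {t\<in>space N. 0 < w' t \<and> w' t < 1} \<le> measure N (\<Union>i\<in>?J. B i)"
      using finI by (intro finite_measure_mono sets.finite_UN) auto
    also have "\<dots> \<le> (\<Sum>i\<in>?J. measure N (B i))"
      using finI by (intro finite_measure_subadditive_finite) auto
    also have "\<dots> \<le> (\<Sum>i\<in>?J. e / ?n)"
    proof (rule sum_mono)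
      fix i assume "i \<in> ?J"
      then have "snd i \<in> P" by (auto simp: I_def)
      then have "measure N (B i) \<le> measure N (snd i)" using P(2)
          by (intro finite_measure_mono) (auto simp: B_def)
      then show "measure N (B i) \<le> e / ?n" using P(5)[OF \<open>snd i \<in> P\<close>] by simp
    qed
    also have "\<dots> = real (card ?J) * (e / ?n)" by simp
    also have "\<dots> \<le> ?n * (e / ?n)" using c(4) \<open>e > 0\<close> by (intro mult_right_mono) auto
    also have "\<dots> = e" by simp
    finally show ?thesis .
  qed
  ultimately show ?thesis by (intro exI[of _ w'] conjI)
qed

text \<open>The iteration starts from the constant weight \<open>\<theta>\<close>. Weights 0 and 1
  are never touched again and the fractional sets shrink like powers of 1/2, so almost every weight
  is eventually constant, 0 or 1. Dominated convergence passes the integral on to the indicator of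
  \<open>A\<close>.\<close>

theorem lyapunov:
  fixes f :: "'t \<Rightarrow> 'b::euclidean_space"
  assumes "finite_measure N" "nonatomic N" and f: "integrable N f" and "0 \<le> \<theta>" "\<theta> \<le> (1::real)"
  shows "\<exists>A\<in>sets N. (\<integral>t. indicator A t *\<^sub>R f t \<partial>N) = \<theta> *\<^sub>R (\<integral>t. f t \<partial>N)"
proof -
  interpret finite_measure N by fact
  define ok where "ok w \<longleftrightarrow> simple_function N w \<and> (\<forall>t\<in>space N. 0 \<le> w t \<and> w t \<le> 1)" for w :: "'t \<Rightarrow> real"
  define R where "R n w w' \<longleftrightarrow> (\<forall>t\<in>space N. w t \<in> {0, 1} \<longrightarrow> w' t = w t) \<and>
     (\<integral>t. w' t *\<^sub>R f t \<partial>N) = (\<integral>t. w t *\<^sub>R f t \<partial>N) \<and>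
     measure N {t\<in>space N. 0 < w' t \<and> w' t < 1} \<le> (1/2) ^ n" for n :: nat and w w' :: "'t \<Rightarrow> real"
  have "\<exists>W. \<forall>n. ok (W n) \<and> R n (W n) (W (Suc n)) \<and> (n = 0 \<longrightarrow> W n = (\<lambda>_. \<theta>))"
  proof -
    have "\<exists>W. \<forall>n. (ok (W n) \<and> (n = 0 \<longrightarrow> W n = (\<lambda>_. \<theta>))) \<and> R n (W n) (W (Suc n))"
    proof (rule dependent_nat_choice)
      show "\<exists>w. ok w \<and> (0 = (0::nat) \<longrightarrow> w = (\<lambda>_. \<theta>))"
        using assms by (intro exI[of _ "\<lambda>_. \<theta>"]) (simp add: ok_def)
      fix w and n :: nat assume "ok w \<and> (n = 0 \<longrightarrow> w = (\<lambda>_. \<theta>))"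
      then have "simple_function N w" "\<And>t. t \<in> space N \<Longrightarrow> 0 \<le> w t \<and> w t \<le> 1" by (auto simp: ok_def)
      from lyapunov_step[OF assms(1-3) this, of "(1/2) ^ n"]
      show "\<exists>w'. (ok w' \<and> (Suc n = 0 \<longrightarrow> w' = (\<lambda>_. \<theta>))) \<and> R n w w'"
        unfolding ok_def R_def by auto
    qed
    then show ?thesis by blast
  qed
  then obtain W where W: "\<And>n. ok (W n)" "\<And>n. R n (W n) (W (Suc n))" "W 0 = (\<lambda>_. \<theta>)" by blast
  have W_meas[measurable]: "W n \<in> borel_measurable N" for n
    using W(1)[of n] by (auto simp: ok_def intro: borel_measurable_simple_function)
  define U where "U n = {t\<in>space N. 0 < W n t \<and> W n t < 1}" for n
  have U[measurable]: "U n \<in> sets N" for n unfolding U_def by measurable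
  have W01: "t \<in> space N \<Longrightarrow> 0 \<le> W n t \<and> W n t \<le> 1" for n t using W(1) by (simp add: ok_def)
  have keep: "W (Suc n) t = W n t" if "t \<in> space N" "W n t \<in> {0, 1}" for n t
    using W(2)[of n] that unfolding R_def by blast
  have keep': "W (n + k) t = W n t" if "t \<in> space N" "W n t \<in> {0, 1}" for n k t
    using that by (induction k) (auto simp: keep)
  define A where "A = {t\<in>space N. \<exists>n. W n t = 1}"
  have A[measurable]: "A \<in> sets N" unfolding A_def by measurable
  have "AE t in N. t \<notin> (\<Inter>n. U n)"
  proof (rule AE_not_in)
    have "measure N (\<Inter>n. U n) \<le> (1/2) ^ n" for n
    proof -
      have "measure N (\<Inter>n. U n) \<le> measure N (U (Suc n))" by (intro finite_measure_mono) auto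
      also have "\<dots> \<le> (1/2) ^ n" using W(2)[of n] by (simp add: R_def U_def)
      finally show ?thesis .
    qed
    moreover have "(\<lambda>n. (1/2 :: real) ^ n) \<longlonglongrightarrow> 0" by (rule LIMSEQ_realpow_zero) auto
    ultimately have "measure N (\<Inter>n. U n) \<le> 0" by (intro LIMSEQ_le_const) auto
    then have "measure N (\<Inter>n. U n) = 0" by (simp add: measure_le_0_iff)
    then show "(\<Inter>n. U n) \<in> null_sets N" by (auto simp: null_sets_def emeasure_eq_measure)
  qed
  then have lim: "AE t in N. (\<lambda>n. W n t *\<^sub>R f t) \<longlonglongrightarrow> indicator A t *\<^sub>R f t"
  proof (rule AE_mp, intro AE_I2 impI)
    fix t assume t: "t \<in> space N" "t \<notin> (\<Inter>n. U n)"
    then obtain n where "\<not> (0 < W n t \<and> W n t < 1)" by (auto simp: U_def)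
    then have n: "W n t \<in> {0, 1}" using W01[OF t(1), of n] by auto
    have const: "W k t = W n t" if "k \<ge> n" for k
      using keep'[OF t(1) n, of "k - n"] that by simp
    have "indicator A t = W n t"
    proof (cases "t \<in> A")
      case True
      then obtain m where m: "W m t = 1" by (auto simp: A_def)
      then have "W (m + n) t = 1" using keep'[OF t(1), of m n] by simp
      then show ?thesis using const[of "m + n"] True by simp
    next
      case False then show ?thesis using n t by (auto simp: A_def)
    qed
    then have "W k t *\<^sub>R f t = indicator A t *\<^sub>R f t" if "k \<ge> n" for k
      by (simp only: const[OF that])
    then show "(\<lambda>n. W n t *\<^sub>R f t) \<longlonglongrightarrow> indicator A t *\<^sub>R f t"
      by (intro tendsto_eventually eventually_sequentiallyI[of n])
  qed
  have "(\<lambda>n. \<integral>t. W n t *\<^sub>R f t \<partial>N) \<longlonglongrightarrow> (\<integral>t. indicator A t *\<^sub>R f t \<partial>N)"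
  proof (rule integral_dominated_convergence[where w = "\<lambda>t. norm (f t)"])
    show "AE t in N. norm (W n t *\<^sub>R f t) \<le> norm (f t)" for n
      using W01 by (intro AE_I2) (auto intro!: mult_left_le_one_le)
  qed (use f lim in auto)
  moreover have "(\<integral>t. W n t *\<^sub>R f t \<partial>N) = \<theta> *\<^sub>R (\<integral>t. f t \<partial>N)" for n
    by (induction n) (use W(2,3) in \<open>auto simp: R_def\<close>)
  ultimately have "(\<lambda>n::nat. \<theta> *\<^sub>R (\<integral>t. f t \<partial>N)) \<longlonglongrightarrow> (\<integral>t. indicator A t *\<^sub>R f t \<partial>N)"
    by simp
  then have "(\<integral>t. indicator A t *\<^sub>R f t \<partial>N) = \<theta> *\<^sub>R (\<integral>t. f t \<partial>N)"
    by (rule LIMSEQ_unique) (rule tendsto_const)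
  then show ?thesis using A by (rule bexI[of _ A])
qed

section \<open>Fatou's lemma in several dimensions\<close>

definition cluster_point :: "(nat \<Rightarrow> 'a::metric_space) \<Rightarrow> 'a \<Rightarrow> bool" where
  "cluster_point X v \<longleftrightarrow> (\<exists>r. strict_mono r \<and> (\<lambda>k. X (r k)) \<longlonglongrightarrow> v)"

text \<open>Only countable quantifiers occur on the right, which makes the graph of the cluster
  points measurable in \<open>maximal_cluster_selection\<close>.\<close>

lemma cluster_point_iff:
  "cluster_point X v \<longleftrightarrow> (\<forall>m::nat. \<forall>n. \<exists>j\<ge>n. dist (X j) v < inverse (real (Suc m)))"
proof
  assume "cluster_point X v"
  then obtain r where r: "strict_mono r" "(\<lambda>k. X (r k)) \<longlonglongrightarrow> v" by (auto simp: cluster_point_def)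
  show "\<forall>m::nat. \<forall>n. \<exists>j\<ge>n. dist (X j) v < inverse (real (Suc m))"
  proof (intro allI)
    fix m n :: nat
    have "eventually (\<lambda>k. dist (X (r k)) v < inverse (real (Suc m))) sequentially"
      using r(2) by (rule tendstoD) simp
    then obtain K where "\<forall>k\<ge>K. dist (X (r k)) v < inverse (real (Suc m))"
      by (auto simp: eventually_sequentially)
    moreover have "r (max K n) \<ge> n" using seq_suble[OF r(1), of "max K n"] by simp
    ultimately show "\<exists>j\<ge>n. dist (X j) v < inverse (real (Suc m))" by (intro exI[of _ "r (max K n)"]) simp
  qed
next
  assume *: "\<forall>m::nat. \<forall>n. \<exists>j\<ge>n. dist (X j) v < inverse (real (Suc m))"
  have "\<exists>r. \<forall>k. dist (X (r k)) v < inverse (real (Suc k)) \<and> r k < r (Suc k)"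
  proof (rule dependent_nat_choice)
    show "\<exists>j. dist (X j) v < inverse (real (Suc 0))" using * by blast
    fix j k :: nat
    show "\<exists>j'. dist (X j') v < inverse (real (Suc (Suc k))) \<and> j < j'"
      using *[rule_format, of "Suc j" "Suc k"] by (auto simp: Suc_le_eq)
  qed
  then obtain r where r: "\<forall>k. dist (X (r k)) v < inverse (real (Suc k)) \<and> r k < r (Suc k)" by blast
  have "(\<lambda>k. X (r k)) \<longlonglongrightarrow> v"
  proof (subst tendsto_dist_iff, rule tendsto_sandwich[OF _ _ tendsto_const LIMSEQ_inverse_real_of_nat])
    show "eventually (\<lambda>k. dist (X (r k)) v \<le> inverse (real (Suc k))) sequentially"
      using r by (intro always_eventually) (auto intro: less_imp_le)
  qed auto
  then show "cluster_point X v" unfolding cluster_point_def using r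
    by (intro exI[of _ r]) (auto simp: strict_mono_Suc_iff)
qed

lemma cluster_point_subseq:
  assumes "strict_mono r" "cluster_point (\<lambda>k. X (r k)) v"
  shows "cluster_point X v"
proof -
  obtain s where "strict_mono s" "(\<lambda>k. X (r (s k))) \<longlonglongrightarrow> v" using assms(2) by (auto simp: cluster_point_def)
  then show ?thesis unfolding cluster_point_def
    using assms(1) by (intro exI[of _ "r \<circ> s"]) (auto simp: strict_mono_o)
qed

lemma cluster_point_limit:
  assumes "X \<longlonglongrightarrow> v"
  shows "cluster_point X v"
  unfolding cluster_point_def using assms by (intro exI[of _ id]) (auto simp: strict_mono_def)

text \<open>A subsequence realising the upper limit of \<open>q \<bullet> X j\<close> is refined to
  a convergent one, so \<open>q \<bullet> v\<close> equals that upper limit.\<close>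

lemma maximal_cluster_point:
  fixes X :: "nat \<Rightarrow> 'b::euclidean_space"
  assumes b: "\<And>j. norm (X j) \<le> b"
  shows "\<exists>v. cluster_point X v \<and> (\<forall>e>0. eventually (\<lambda>j. q \<bullet> X j \<le> q \<bullet> v + e) sequentially)"
proof -
  define u where "u j = ereal (q \<bullet> X j)" for j
  obtain r where r: "strict_mono r" "(u \<circ> r) \<longlonglongrightarrow> limsup u" using limsup_subseq_lim by blast
  have "bounded (range (\<lambda>k. X (r k)))" using b by (auto simp: bounded_iff)
  from bounded_imp_convergent_subsequence[OF this]
  obtain v s where s: "strict_mono s" "(\<lambda>k. X (r (s k))) \<longlonglongrightarrow> v" by (auto simp: o_def)
  have "(\<lambda>k. u (r (s k))) \<longlonglongrightarrow> limsup u" using LIMSEQ_subseq_LIMSEQ[OF r(2) s(1)] by (simp add: o_def)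
  moreover have "(\<lambda>k. u (r (s k))) \<longlonglongrightarrow> ereal (q \<bullet> v)"
    unfolding u_def using s(2) by (intro tendsto_intros)
  ultimately have L: "limsup u = ereal (q \<bullet> v)" by (rule LIMSEQ_unique)
  have "cluster_point X v"
      using cluster_point_subseq[OF strict_mono_o[OF r(1) s(1)], of X v]
          cluster_point_limit[OF s(2)]
    by (simp add: o_def)
  moreover have "eventually (\<lambda>j. q \<bullet> X j \<le> q \<bullet> v + e) sequentially" if "e > 0" for e
  proof -
    have "limsup u < ereal (q \<bullet> v + e)" using that by (simp add: L)
    from Limsup_lessD[OF this] show ?thesis by (rule eventually_mono) (simp add: u_def)
  qed
  ultimately show ?thesis by blast
qed

text \<open>With \<open>q = 0\<close> this is just a measurable selection of cluster points; a
  nonzero \<open>q\<close> makes the selection extremal in that direction.\<close>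

lemma maximal_cluster_selection:
  fixes f :: "nat \<Rightarrow> 't \<Rightarrow> 'b::euclidean_space"
  assumes "finite_measure M" and f[measurable]: "\<And>j. f j \<in> borel_measurable M"
    and bd: "\<And>j. AE t in M. norm (f j t) \<le> h t"
  shows "\<exists>d\<in>borel_measurable M. AE t in M. cluster_point (\<lambda>j. f j t) (d t) \<and>
     (\<forall>e>0. eventually (\<lambda>j. q \<bullet> f j t \<le> q \<bullet> d t + e) sequentially)"
proof -
  define S where
      "S = {z \<in> space (M \<Otimes>\<^sub>M borel). (\<forall>m::nat. \<forall>n. \<exists>j\<ge>n. dist (f j (fst z)) (snd z)
          < inverse (real (Suc m)))
     \<and> (\<forall>m::nat. \<exists>n::nat. \<forall>j\<ge>n. q \<bullet> f j (fst z) \<le> q \<bullet> snd z + inverse (real (Suc m)))}"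
  have "S \<in> sets (M \<Otimes>\<^sub>M borel)" unfolding S_def by measurable
  from measurable_selection[OF assms(1) this] obtain d where d: "d \<in> borel_measurable M"
    and AEd: "AE t in M. (\<exists>z. (t, z) \<in> S) \<longrightarrow> (t, d t) \<in> S" by blast
  have S_iff: "(t, v) \<in> S \<longleftrightarrow> t \<in> space M \<and> cluster_point (\<lambda>j. f j t) v \<and>
     (\<forall>m::nat. \<exists>n::nat. \<forall>j\<ge>n. q \<bullet> f j t \<le> q \<bullet> v + inverse (real (Suc m)))" for t v
    unfolding S_def cluster_point_iff by (simp add: space_pair_measure)
  have ev: "(\<forall>e>0. eventually (\<lambda>j. q \<bullet> f j t \<le> q \<bullet> v + e) sequentially) \<longleftrightarrow>
     (\<forall>m::nat. \<exists>n::nat. \<forall>j\<ge>n. q \<bullet> f j t \<le> q \<bullet> v + inverse (real (Suc m)))" for t v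
  proof
    assume *: "\<forall>m::nat. \<exists>n::nat. \<forall>j\<ge>n. q \<bullet> f j t \<le> q \<bullet> v + inverse (real (Suc m))"
    show "\<forall>e>0. eventually (\<lambda>j. q \<bullet> f j t \<le> q \<bullet> v + e) sequentially"
    proof (intro allI impI)
      fix e :: real assume "e > 0"
      then obtain m where m: "inverse (real (Suc m)) < e" using reals_Archimedean by blast
      obtain n where "\<forall>j\<ge>n. q \<bullet> f j t \<le> q \<bullet> v + inverse (real (Suc m))" using *[rule_format, of m]
          by (elim exE)
      then have "q \<bullet> f j t \<le> q \<bullet> v + e" if "j \<ge> n" for j using m that by fastforce
      then show "eventually (\<lambda>j. q \<bullet> f j t \<le> q \<bullet> v + e) sequentially" by (rule eventually_sequentiallyI)
    qed
  qed (simp add: eventually_sequentially)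
  have "AE t in M. \<forall>j. norm (f j t) \<le> h t" using bd by (simp add: AE_all_countable)
  then have "AE t in M. cluster_point (\<lambda>j. f j t) (d t) \<and>
      (\<forall>e>0. eventually (\<lambda>j. q \<bullet> f j t \<le> q \<bullet> d t + e) sequentially)"
    using AEd AE_space
  proof eventually_elim
    case (elim t)
    have "\<exists>v. cluster_point (\<lambda>j. f j t) v \<and> (\<forall>e>0. eventually (\<lambda>j. q \<bullet> f j t \<le> q \<bullet> v + e) sequentially)"
      by (rule maximal_cluster_point[of "\<lambda>j. f j t"]) (use elim(1) in auto)
    then have "\<exists>z. (t, z) \<in> S" unfolding S_iff ev using elim(3) by simp
    with elim(2) have "(t, d t) \<in> S" by (rule mp)
    then show ?case unfolding S_iff ev by simp
  qed
  then show ?thesis using d by (intro bexI[of _ d])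
qed

text \<open>The positive parts tend to 0 in the mean by domination. As |u| is twice the positive
  part minus u, the L1 norms tend to \<open>- l\<close>, and the sign of \<open>l\<close> forces
  this limit to be 0.\<close>

lemma L1_convergence_from_above:
  fixes u :: "nat \<Rightarrow> 't \<Rightarrow> real"
  assumes u[measurable]: "\<And>j. u j \<in> borel_measurable M" and h: "integrable M h"
    and bd: "\<And>j. AE t in M. \<bar>u j t\<bar> \<le> h t"
    and up: "AE t in M. \<forall>e>0. eventually (\<lambda>j. u j t \<le> e) sequentially"
    and lim: "(\<lambda>j. \<integral>t. u j t \<partial>M) \<longlonglongrightarrow> l" and "0 \<le> l"
  shows "(\<lambda>j. \<integral>t. norm (u j t) \<partial>M) \<longlonglongrightarrow> 0"
proof -
  have int_u: "integrable M (u j)" for j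
    by (rule Bochner_Integration.integrable_bound[OF h]) (use bd[of j] in auto)
  define p where "p j t = max 0 (u j t)" for j t
  have int_p: "integrable M (p j)" for j unfolding p_def using int_u by auto
  have "(\<lambda>j. \<integral>t. p j t \<partial>M) \<longlonglongrightarrow> (\<integral>t. 0 \<partial>M)"
  proof (rule integral_dominated_convergence[where w = h])
    show "AE t in M. (\<lambda>j. p j t) \<longlonglongrightarrow> 0"
      using up
    proof eventually_elim
      case (elim t)
      show ?case
      proof (rule order_tendstoI)
        fix a :: real assume "a < 0" then show "eventually (\<lambda>j. a < p j t) sequentially"
          by (intro always_eventually) (auto simp: p_def)
      next
        fix a :: real assume "0 < a"
        then have "eventually (\<lambda>j. u j t \<le> a / 2) sequentially" by (intro elim[rule_format]) simp
        then show "eventually (\<lambda>j. p j t < a) sequentially"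
          by (rule eventually_mono) (use \<open>0 < a\<close> in \<open>auto simp: p_def\<close>)
      qed
    qed
    show "AE t in M. norm (p j t) \<le> h t" for j using bd[of j] by eventually_elim (auto simp: p_def)
  qed (use h in \<open>auto simp: p_def\<close>)
  then have "(\<lambda>j. 2 * (\<integral>t. p j t \<partial>M) - (\<integral>t. u j t \<partial>M)) \<longlonglongrightarrow> 2 * 0 - l"
    using lim by (intro tendsto_intros) simp_all
  moreover have eq: "(\<integral>t. norm (u j t) \<partial>M) = 2 * (\<integral>t. p j t \<partial>M) - (\<integral>t. u j t \<partial>M)" for j
  proof -
    have "(\<integral>t. norm (u j t) \<partial>M) = (\<integral>t. 2 * p j t - u j t \<partial>M)"
      by (intro Bochner_Integration.integral_cong) (auto simp: p_def)
    then show ?thesis using int_u int_p by simp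
  qed
  ultimately have lim': "(\<lambda>j. \<integral>t. norm (u j t) \<partial>M) \<longlonglongrightarrow> - l" by simp
  then have "0 \<le> - l" by (rule LIMSEQ_le_const) auto
  then show ?thesis using lim' \<open>0 \<le> l\<close> by simp
qed

text \<open>
  Pass to a subsequence along which as many directions as possible converge almost everywhere.  If
  \<open>x\<close> were not the integral of a selection of cluster points, a hyperplane separating \<open>x\<close> from
  the (by Lyapunov) convex set of these integrals would yield one more convergent direction.
\<close>

lemma fatou_nonatomic:
  fixes f :: "nat \<Rightarrow> 't \<Rightarrow> 'b::euclidean_space"
  assumes fin: "finite_measure N" and na: "nonatomic N"
    and f[measurable]: "\<And>j. f j \<in> borel_measurable N" and h: "integrable N h"
    and bd: "\<And>j. AE t in N. norm (f j t) \<le> h t"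
    and lim: "(\<lambda>j. \<integral>t. f j t \<partial>N) \<longlonglongrightarrow> x"
  shows "\<exists>v. integrable N v \<and> (\<integral>t. v t \<partial>N) = x \<and> (AE t in N. cluster_point (\<lambda>j. f j t) (v t))"
proof -
  interpret finite_measure N by fact
  \<comment> \<open>The directions in which the subsequence \<open>r\<close> converges almost
    everywhere. Refining the subsequence can only enlarge this subspace, so a maximal dimension is
    the measure of progress.\<close>
  define Q where "Q r = {q. AE t in N. convergent (\<lambda>j. q \<bullet> f (r j) t)}" for r :: "nat \<Rightarrow> nat"
  have Q_sub: "subspace (Q r)" for r
    unfolding subspace_def
  proof (intro conjI ballI allI)
    show "0 \<in> Q r" by (simp add: Q_def convergent_const)
    fix p q assume "p \<in> Q r" "q \<in> Q r"
    then have "AE t in N. convergent (\<lambda>j. p \<bullet> f (r j) t)" "AE t in N. convergent (\<lambda>j. q \<bullet> f (r j) t)"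
      by (auto simp: Q_def)
    then show "p + q \<in> Q r" unfolding Q_def mem_Collect_eq
      by eventually_elim (simp add: inner_add_left convergent_add)
  next
    fix c and p assume "p \<in> Q r"
    then have "AE t in N. convergent (\<lambda>j. p \<bullet> f (r j) t)" by (auto simp: Q_def)
    then show "c *\<^sub>R p \<in> Q r" unfolding Q_def mem_Collect_eq
      by eventually_elim (auto simp: convergent_def intro!: tendsto_intros)
  qed
  have "strict_mono (id :: nat \<Rightarrow> nat)" by (simp add: strict_mono_def)
  moreover have "\<forall>r. strict_mono r \<longrightarrow> dim (Q r) < Suc DIM('b)"
    using dim_subset_UNIV by (auto simp: less_Suc_eq_le)
  ultimately have "\<exists>r. strict_mono r \<and> (\<forall>s. strict_mono s \<longrightarrow> dim (Q s) \<le> dim (Q r))"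
    by (rule Lattices_Big.ex_has_greatest_nat)
  then obtain r where r: "strict_mono r" and max: "\<And>s. strict_mono s \<Longrightarrow> dim (Q s) \<le> dim (Q r)" by blast
  define g where "g j = f (r j)" for j
  have g[measurable]: "g j \<in> borel_measurable N" for j by (simp add: g_def)
  have bdg: "AE t in N. norm (g j t) \<le> h t" for j using bd by (simp add: g_def)
  have bdg_all: "AE t in N. \<forall>j. norm (g j t) \<le> h t" using bdg by (simp add: AE_all_countable)
  have limg: "(\<lambda>j. \<integral>t. g j t \<partial>N) \<longlonglongrightarrow> x"
    using LIMSEQ_subseq_LIMSEQ[OF lim r] by (simp add: g_def o_def)
  have int_g: "integrable N (g j)" for j
    by (rule Bochner_Integration.integrable_bound[OF h]) (use bdg[of j] in \<open>auto elim!: eventually_mono\<close>)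
  define V where "V = {v. v \<in> borel_measurable N \<and> (AE t in N. cluster_point (\<lambda>j. g j t) (v t))}"
  have int_V: "integrable N v" if "v \<in> V" for v
  proof (rule Bochner_Integration.integrable_bound[OF h])
    show "v \<in> borel_measurable N" using that by (simp add: V_def)
    have "AE t in N. cluster_point (\<lambda>j. g j t) (v t)" using that by (simp add: V_def)
    then show "AE t in N. norm (v t) \<le> norm (h t)"
      using bdg_all
    proof eventually_elim
      case (elim t)
      then obtain s where "(\<lambda>k. g (s k) t) \<longlonglongrightarrow> v t" by (auto simp: cluster_point_def)
      then have "norm (v t) \<le> h t"
        using elim(2) by (intro LIMSEQ_le_const2[OF tendsto_norm]) auto
      then show ?case by simp
    qed
  qed
  define C where "C = (\<lambda>v. \<integral>t. v t \<partial>N) ` V"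
  have "x \<in> C"
  proof (rule ccontr)
    assume x: "x \<notin> C"
    \<comment> \<open>Lyapunov's theorem for \<open>v1 - v2\<close> gives a set on which to follow
      \<open>v1\<close>, with \<open>v2\<close> elsewhere; the spliced function is again a selection
      of cluster points.\<close>
    have "convex C"
    proof (rule convexI)
      fix c1 c2 and u1 u2 :: real
      assume c: "c1 \<in> C" "c2 \<in> C" and u: "0 \<le> u1" "0 \<le> u2" "u1 + u2 = 1"
      obtain v1 v2 where v: "v1 \<in> V" "v2 \<in> V" "c1 = (\<integral>t. v1 t \<partial>N)" "c2 = (\<integral>t. v2 t \<partial>N)"
        using c by (auto simp: C_def)
      note iv = int_V[OF v(1)] int_V[OF v(2)]
      have "integrable N (\<lambda>t. v1 t - v2 t)" using iv by simp
      from lyapunov[OF fin na this u(1)] u obtain A where A: "A \<in> sets N"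
        "(\<integral>t. indicator A t *\<^sub>R (v1 t - v2 t) \<partial>N) = u1 *\<^sub>R (\<integral>t. v1 t - v2 t \<partial>N)" by auto
      define w where "w t = (if t \<in> A then v1 t else v2 t)" for t
      have "w \<in> V"
      proof -
        have "v1 \<in> borel_measurable N" "v2 \<in> borel_measurable N" using v by (auto simp: V_def)
        then have "w \<in> borel_measurable N" unfolding w_def using A(1) by measurable
        moreover have "AE t in N. cluster_point (\<lambda>j. g j t) (v1 t)"
            "AE t in N. cluster_point (\<lambda>j. g j t) (v2 t)"
          using v by (auto simp: V_def)
        then have "AE t in N. cluster_point (\<lambda>j. g j t) (w t)" by eventually_elim (simp add: w_def)
        ultimately show ?thesis by (simp add: V_def)
      qed
      moreover have "(\<integral>t. w t \<partial>N) = u1 *\<^sub>R c1 + u2 *\<^sub>R c2"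
      proof -
        have "(\<integral>t. w t \<partial>N) = (\<integral>t. indicator A t *\<^sub>R (v1 t - v2 t) + v2 t \<partial>N)"
          by (intro Bochner_Integration.integral_cong) (auto simp: w_def)
        also have "\<dots> = (\<integral>t. indicator A t *\<^sub>R (v1 t - v2 t) \<partial>N) + (\<integral>t. v2 t \<partial>N)"
          using iv A(1) by (intro Bochner_Integration.integral_add integrable_mult_indicator) auto
        also have "\<dots> = u1 *\<^sub>R (c1 - c2) + c2" using iv v by (simp add: A(2))
        also have "\<dots> = u1 *\<^sub>R c1 + (1 - u1) *\<^sub>R c2" by (simp add: algebra_simps)
        also have "1 - u1 = u2" using u by simp
        finally show ?thesis .
      qed
      ultimately show "u1 *\<^sub>R c1 + u2 *\<^sub>R c2 \<in> C" unfolding C_def by (metis image_eqI)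
    qed
    let ?S = "(\<lambda>c. - x + c) ` C"
    \<comment> \<open>The direction 0 gives some measurable selection, hence \<open>C\<close> is
      nonempty.\<close>
    obtain d0 where "d0 \<in> borel_measurable N" "AE t in N. cluster_point (\<lambda>j. g j t) (d0 t) \<and>
     (\<forall>e>0. eventually (\<lambda>j. 0 \<bullet> g j t \<le> 0 \<bullet> d0 t + e) sequentially)"
      using maximal_cluster_selection[where q = 0 and f = g and h = h, OF fin g bdg]
          by (elim bexE) (rule that)
    then have "d0 \<in> V" unfolding V_def by (auto elim: eventually_mono)
    then have "?S \<noteq> {}" by (auto simp: C_def)
    moreover have "convex ?S" using \<open>convex C\<close> by simp
    moreover have "0 \<notin> ?S" using x by auto
    \<comment> \<open>The normal is taken in the span of \<open>?S\<close>: together with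
      \<open>conv_dir\<close> this keeps \<open>- a\<close> out of \<open>Q r\<close>.\<close>
    ultimately obtain a where a: "a \<in> span ?S" "a \<noteq> 0" "\<And>y. y \<in> ?S \<Longrightarrow> 0 \<le> a \<bullet> y"
      using separating_hyperplane_set_0_inspan[of ?S] by (metis (no_types, lifting))
    \<comment> \<open>For \<open>p\<close> in \<open>Q r\<close> the products of \<open>p\<close>
      with all cluster points agree with the limit of \<open>p \<bullet> g j t\<close>, so
      \<open>p\<close> is constant on \<open>C\<close>, with the value
      \<open>p \<bullet> x\<close>.\<close>
    have conv_dir: "p \<bullet> y = 0" if p: "p \<in> Q r" and y: "y \<in> ?S" for p y
    proof -
      obtain v where v: "v \<in> V" "y = - x + (\<integral>t. v t \<partial>N)" using y by (auto simp: C_def)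
      have "AE t in N. cluster_point (\<lambda>j. g j t) (v t)" using v by (simp add: V_def)
      moreover have "AE t in N. convergent (\<lambda>j. p \<bullet> g j t)" using p by (simp add: Q_def g_def)
      ultimately have "AE t in N. (\<lambda>j. p \<bullet> g j t) \<longlonglongrightarrow> p \<bullet> v t"
      proof eventually_elim
        case (elim t)
        then obtain s l where s: "strict_mono s" "(\<lambda>k. g (s k) t) \<longlonglongrightarrow> v t" "(\<lambda>j. p \<bullet> g j t) \<longlonglongrightarrow> l"
          by (auto simp: cluster_point_def convergent_def)
        have "(\<lambda>k. p \<bullet> g (s k) t) \<longlonglongrightarrow> p \<bullet> v t" using s(2) by (intro tendsto_intros)
        moreover have "(\<lambda>k. p \<bullet> g (s k) t) \<longlonglongrightarrow> l" using LIMSEQ_subseq_LIMSEQ[OF s(3,1)] by (simp add: o_def)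
        ultimately have "l = p \<bullet> v t" using LIMSEQ_unique by blast
        then show ?case using s(3) by simp
      qed
      then have "(\<lambda>j. \<integral>t. p \<bullet> g j t \<partial>N) \<longlonglongrightarrow> (\<integral>t. p \<bullet> v t \<partial>N)"
      proof (rule integral_dominated_convergence[where w = "\<lambda>t. norm p * h t", rotated 3])
        show "AE t in N. norm (p \<bullet> g j t) \<le> norm p * h t" for j
          using bdg[of j]
        proof eventually_elim
          case (elim t)
          have "\<bar>p \<bullet> g j t\<bar> \<le> norm p * norm (g j t)" by (rule Cauchy_Schwarz_ineq2)
          also have "\<dots> \<le> norm p * h t" using elim by (intro mult_left_mono) auto
          finally show ?case by simp
        qed
      qed (use h int_V[OF v(1)] in auto)
      then have "(\<lambda>j. p \<bullet> (\<integral>t. g j t \<partial>N)) \<longlonglongrightarrow> p \<bullet> (\<integral>t. v t \<partial>N)"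
        using int_g int_V[OF v(1)] by simp
      moreover have "(\<lambda>j. p \<bullet> (\<integral>t. g j t \<partial>N)) \<longlonglongrightarrow> p \<bullet> x" using limg by (intro tendsto_intros)
      ultimately have "p \<bullet> x = p \<bullet> (\<integral>t. v t \<partial>N)" by (rule LIMSEQ_unique[rotated])
      then show ?thesis by (simp add: v inner_add_right inner_diff_right)
    qed
    have a_notin: "- a \<notin> Q r"
    proof
      assume "- a \<in> Q r"
      then have "orthogonal (- a) y" if "y \<in> ?S" for y
        unfolding orthogonal_def using that by (rule conv_dir)
      from orthogonal_to_span[OF a(1) this] have "a \<bullet> a = 0" by (simp add: orthogonal_def)
      then show False using a(2) by simp
    qed
    \<comment> \<open>\<open>d\<close> realises the pointwise upper limit in the direction
      \<open>- a\<close>, while by separation its integral in that direction does not exceed the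
      limit of the integrals. This leaves no gap, and the convergence is in L1.\<close>
    obtain d where d: "d \<in> borel_measurable N" and AEd: "AE t in N. cluster_point (\<lambda>j. g j t) (d t) \<and>
     (\<forall>e>0. eventually (\<lambda>j. - a \<bullet> g j t \<le> - a \<bullet> d t + e) sequentially)"
      using maximal_cluster_selection[where q = "- a" and f = g and h = h, OF fin g bdg]
          by (elim bexE) (rule that)
    have dV: "d \<in> V" unfolding V_def using d AEd by (auto elim: eventually_mono)
    note int_d = int_V[OF dV]
    define u where "u j t = - a \<bullet> g j t - - a \<bullet> d t" for j t
    have "(\<lambda>j. \<integral>t. norm (u j t) \<partial>N) \<longlonglongrightarrow> 0"
    proof (rule L1_convergence_from_above[where h = "\<lambda>t. norm a * h t + norm a * norm (d t)"])
      show "AE t in N. \<bar>u j t\<bar> \<le> norm a * h t + norm a * norm (d t)" for j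
        using bdg[of j]
      proof eventually_elim
        case (elim t)
        have "\<bar>u j t\<bar> \<le> \<bar>a \<bullet> g j t\<bar> + \<bar>a \<bullet> d t\<bar>" by (simp add: u_def)
        also have "\<dots> \<le> norm a * norm (g j t) + norm a * norm (d t)"
          by (intro add_mono Cauchy_Schwarz_ineq2)
        also have "norm a * norm (g j t) \<le> norm a * h t" using elim by (intro mult_left_mono) auto
        finally show ?case by simp
      qed
      show "AE t in N. \<forall>e>0. eventually (\<lambda>j. u j t \<le> e) sequentially"
        using AEd by eventually_elim (auto simp: u_def algebra_simps)
      have "(\<lambda>j. - a \<bullet> (\<integral>t. g j t \<partial>N) - - a \<bullet> (\<integral>t. d t \<partial>N)) \<longlonglongrightarrow> - a \<bullet> x - - a \<bullet> (\<integral>t. d t \<partial>N)"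
        using limg by (intro tendsto_intros)
      moreover have "(\<integral>t. u j t \<partial>N) = - a \<bullet> (\<integral>t. g j t \<partial>N) - - a \<bullet> (\<integral>t. d t \<partial>N)" for j
        unfolding u_def using int_g int_d by simp
      ultimately show "(\<lambda>j. \<integral>t. u j t \<partial>N) \<longlonglongrightarrow> - a \<bullet> x - - a \<bullet> (\<integral>t. d t \<partial>N)" by simp
      have "0 \<le> a \<bullet> (- x + (\<integral>t. d t \<partial>N))" using dV by (intro a(3)) (auto simp: C_def)
      then show "0 \<le> - a \<bullet> x - - a \<bullet> (\<integral>t. d t \<partial>N)" by (simp add: inner_add_right inner_diff_right)
    qed (use h int_d d in \<open>auto simp: u_def\<close>)
    moreover have "integrable N (u j)" for j
      unfolding u_def using int_g int_d by (intro Bochner_Integration.integrable_diff) auto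
    ultimately have "\<exists>s. strict_mono s \<and> (AE t in N. (\<lambda>j. u (s j) t) \<longlonglongrightarrow> 0)"
      by (intro tendsto_L1_AE_subseq)
    then obtain s where s: "strict_mono s" "AE t in N. (\<lambda>j. u (s j) t) \<longlonglongrightarrow> 0"
      by (elim exE conjE) (rule that)
    have "Q r \<subseteq> Q (r \<circ> s)"
    proof
      fix q assume "q \<in> Q r"
      then have "AE t in N. convergent (\<lambda>j. q \<bullet> f (r j) t)" by (simp add: Q_def)
      then have "AE t in N. convergent (\<lambda>j. q \<bullet> f ((r \<circ> s) j) t)"
        by eventually_elim (use convergent_subseq_convergent[OF _ s(1)] in \<open>auto simp: o_def\<close>)
      then show "q \<in> Q (r \<circ> s)" by (simp add: Q_def)
    qed
    moreover have "- a \<in> Q (r \<circ> s)"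
    proof -
      have "AE t in N. convergent (\<lambda>j. - a \<bullet> f ((r \<circ> s) j) t)"
        using s(2)
      proof eventually_elim
        case (elim t)
        then have "(\<lambda>j. u (s j) t + - a \<bullet> d t) \<longlonglongrightarrow> 0 + - a \<bullet> d t" by (intro tendsto_intros)
        then show ?case by (auto simp: u_def g_def convergent_def)
      qed
      then show ?thesis by (simp add: Q_def)
    qed
    ultimately have "Q r \<subset> Q (r \<circ> s)" using a_notin by blast
    then have "span (Q r) \<subset> span (Q (r \<circ> s))" using Q_sub by (simp add: span_eq_iff[THEN iffD2])
    then have "dim (Q r) < dim (Q (r \<circ> s))" by (rule dim_psubset)
    moreover have "dim (Q (r \<circ> s)) \<le> dim (Q r)" by (intro max strict_mono_o r s)
    ultimately show False by simp
  qed
  then obtain v where v: "v \<in> V" "x = (\<integral>t. v t \<partial>N)" by (auto simp: C_def)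
  have "AE t in N. cluster_point (\<lambda>j. g j t) (v t)" using v by (simp add: V_def)
  then have "AE t in N. cluster_point (\<lambda>j. f j t) (v t)"
    by eventually_elim (auto simp: g_def intro: cluster_point_subseq[OF r])
  then show ?thesis using int_V[OF v(1)] v(2) by blast
qed

section \<open>Sequences on purely atomic measures\<close>

text \<open>Within an atom the preimage of a basic open set is null or has null complement. For a
  countable basis all these alternatives hold simultaneously almost everywhere, and they determine
  the value because points are separated.\<close>

lemma constant_on_atom:
  fixes f :: "'t \<Rightarrow> 'b::{second_countable_topology, t2_space}"
  assumes f[measurable]: "f \<in> borel_measurable M" and A: "is_atom M A"
  shows "\<exists>c. AE t in M. t \<in> A \<longrightarrow> f t = c"
proof -
  have A_sets[measurable]: "A \<in> sets M" and A_pos: "emeasure M A > 0"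
    and A_atom: "\<And>B. B \<in> sets M \<Longrightarrow> B \<subseteq> A \<Longrightarrow> emeasure M B = 0 \<or> emeasure M (A - B) = 0"
    using A by (auto simp: is_atom_def)
  obtain \<B> :: "'b set set" where \<B>: "countable \<B>" "topological_basis \<B>"
    using ex_countable_basis by blast
  have U_meas[measurable]: "U \<in> sets borel" if "U \<in> \<B>" for U
    using topological_basis_open[OF \<B>(2) that] by simp
  define G where "G U = (AE t in M. t \<in> A \<longrightarrow> f t \<in> U)" for U
  have dich: "AE t in M. t \<in> A \<longrightarrow> (f t \<in> U \<longleftrightarrow> G U)" if "U \<in> \<B>" for U
  proof -
    have B: "{t\<in>A. f t \<in> U} = f -` U \<inter> space M \<inter> A" using sets.sets_into_space[OF A_sets] by auto
    have Bs: "{t\<in>A. f t \<in> U} \<in> sets M"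
      unfolding B using U_meas[OF that] by measurable
    have sub: "{t\<in>A. f t \<in> U} \<subseteq> A" by auto
    from A_atom[OF Bs sub] show ?thesis
    proof
      assume "emeasure M (A - {t\<in>A. f t \<in> U}) = 0"
      then have "AE t in M. t \<notin> A - {t\<in>A. f t \<in> U}" using Bs by (intro AE_not_in) (auto simp: null_sets_def)
      then have *: "AE t in M. t \<in> A \<longrightarrow> f t \<in> U" by eventually_elim auto
      then have "G U" by (simp add: G_def)
      with * show ?thesis by simp
    next
      assume 0: "emeasure M {t\<in>A. f t \<in> U} = 0"
      then have *: "AE t in M. t \<notin> {t\<in>A. f t \<in> U}" using Bs by (intro AE_not_in) (auto simp: null_sets_def)
      have "\<not> G U"
      proof
        assume "G U"
        then have "AE t in M. t \<in> A \<longrightarrow> f t \<in> U" by (simp add: G_def)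
        with * have "AE t in M. t \<notin> A" by eventually_elim auto
        then have "emeasure M A = 0"
            using AE_iff_measurable[OF A_sets, of "\<lambda>t. t \<notin> A"] sets.sets_into_space[OF A_sets]
                by auto
        then show False using A_pos by simp
      qed
      with * show ?thesis by (auto elim: eventually_mono)
    qed
  qed
  have all: "AE t in M. \<forall>U\<in>\<B>. t \<in> A \<longrightarrow> (f t \<in> U \<longleftrightarrow> G U)"
  proof -
    have "AE t in M. \<forall>U\<in>\<B>. (t \<in> A \<longrightarrow> (f t \<in> U \<longleftrightarrow> G U))"
      unfolding AE_ball_countable[OF \<B>(1)] using dich by (intro ballI)
    then show ?thesis by eventually_elim blast
  qed
  have "\<exists>t0\<in>A. \<forall>U\<in>\<B>. f t0 \<in> U \<longleftrightarrow> G U"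
  proof (rule ccontr)
    assume "\<not> ?thesis"
    then have *: "\<forall>t\<in>A. \<not> (\<forall>U\<in>\<B>. f t \<in> U \<longleftrightarrow> G U)" by blast
    have "AE t in M. t \<notin> A" using all
    proof eventually_elim
      case (elim t) then show ?case using *[rule_format, of t] by blast
    qed
    then have "emeasure M A = 0" using AE_iff_measurable[OF A_sets, of
        "\<lambda>t. t \<notin> A"] sets.sets_into_space[OF A_sets] by auto
    then show False using A_pos by simp
  qed
  then obtain t0 where t0: "\<forall>U\<in>\<B>. f t0 \<in> U \<longleftrightarrow> G U" by blast
  have "AE t in M. t \<in> A \<longrightarrow> f t = f t0"
    using all
  proof eventually_elim
    case (elim t)
    show ?case
    proof (intro impI, rule ccontr)
      assume t: "t \<in> A" "f t \<noteq> f t0"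
      from t(2) obtain W where W: "open W" "f t \<in> W" "f t0 \<notin> W" using t1_space by blast
      then obtain U where "U \<in> \<B>" "f t \<in> U" "U \<subseteq> W" using topological_basisE[OF \<B>(2)] by metis
      then show False using W elim t0 t(1) by blast
    qed
  qed
  then show ?thesis by blast
qed

text \<open>Exhaustion by countable unions of atoms: a nonnull remainder would contain a further
  atom. The empty set pads the sequence when there are only finitely many atoms, or none.\<close>

lemma purely_atomic_countable_cover:
  assumes "finite_measure M" and pa: "purely_atomic M"
  shows "\<exists>A::nat \<Rightarrow> 't set. (\<forall>i. A i = {} \<or> is_atom M (A i)) \<and> (AE t in M. t \<in> (\<Union>i. A i))"
proof -
  interpret finite_measure M by fact
  define is_at where "is_at A \<longleftrightarrow> A = {} \<or> is_atom M A" for A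
  have is_at_sets[measurable]: "A \<in> sets M" if "is_at A" for A using that
      by (auto simp: is_at_def is_atom_def)
  define good where "good G \<longleftrightarrow> (\<exists>A::nat \<Rightarrow> 't set. (\<forall>i. is_at (A i)) \<and> G = (\<Union>i. A i))" for G
  have good_sets: "G \<in> sets M" if G: "good G" for G
  proof -
    obtain A :: "nat \<Rightarrow> 't set" where "\<forall>i. is_at (A i)" "G = (\<Union>i. A i)" using G by (auto simp: good_def)
    then show ?thesis by (auto intro!: sets.countable_UN is_at_sets)
  qed
  have good_UN: "good (\<Union>n. G n)" if G: "\<And>n::nat. good (G n)" for G
  proof -
    have "\<forall>n. \<exists>A::nat \<Rightarrow> 't set. (\<forall>i. is_at (A i)) \<and> G n = (\<Union>i. A i)" using G by (simp add: good_def)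
    from choice[OF this] obtain A :: "nat \<Rightarrow> nat \<Rightarrow> 't set"
      where A: "\<forall>n. (\<forall>i. is_at (A n i)) \<and> G n = (\<Union>i. A n i)" by blast
    define B where "B k = (case prod_decode k of (n, i) \<Rightarrow> A n i)" for k
    have "(\<Union>n. G n) = (\<Union>k. B k)"
    proof (intro set_eqI iffI)
      fix t assume "t \<in> (\<Union>n. G n)"
      then obtain n i where "t \<in> A n i" using A by auto
      then have "t \<in> B (prod_encode (n, i))" by (simp add: B_def)
      then show "t \<in> (\<Union>k. B k)" by blast
    next
      fix t assume "t \<in> (\<Union>k. B k)"
      then obtain k where "t \<in> B k" by blast
      then have "t \<in> A (fst (prod_decode k)) (snd (prod_decode k))" by (simp add: B_def split: prod.splits)
      then show "t \<in> (\<Union>n. G n)" using A by blast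
    qed
    moreover have "\<forall>k. is_at (B k)" using A by (auto simp: B_def split: prod.splits)
    ultimately show ?thesis unfolding good_def by (intro exI[of _ B]) simp
  qed
  have good_is_at: "good A" if "is_at A" for A
    unfolding good_def using that by (intro exI[of _ "\<lambda>_. A"]) auto
  have good_Un: "good (G \<union> H)" if "good G" "good H" for G H
  proof -
    have "good (\<Union>n::nat. if n = 0 then G else H)" by (rule good_UN) (use that in auto)
    also have "(\<Union>n::nat. if n = 0 then G else H) = G \<union> H" by (auto split: if_splits)
    finally show ?thesis .
  qed
  have "good {}" by (rule good_is_at) (simp add: is_at_def)
  then have "\<exists>G::nat \<Rightarrow> 't set. (\<forall>n. G n \<in> {G. good G}) \<and> incseq G \<and>
      (\<forall>B\<in>{G. good G}. B \<inter> (\<Union>n. G n) = {} \<longrightarrow> measure M B = 0)"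
    using good_sets good_Un by (intro measurable_exhaustion assms(1)) auto
  then obtain G :: "nat \<Rightarrow> 't set" where G: "\<And>n. good (G n)"
    and rest: "\<And>B. good B \<Longrightarrow> B \<inter> (\<Union>n. G n) = {} \<Longrightarrow> measure M B = 0" by auto
  let ?U = "\<Union>n. G n"
  have U: "good ?U" by (rule good_UN[OF G])
  have "emeasure M (space M - ?U) = 0"
  proof (rule ccontr)
    assume "emeasure M (space M - ?U) \<noteq> 0"
    moreover have "space M - ?U \<in> sets M" using good_sets[OF U] by auto
    ultimately obtain B where B: "B \<subseteq> space M - ?U" "is_atom M B"
      using pa unfolding purely_atomic_def by (metis zero_less_iff_neq_zero)
    have "good B" using B by (intro good_is_at) (simp add: is_at_def)
    then have "measure M B = 0" using B(1) by (intro rest) auto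
    then show False using B(2) by (simp add: is_atom_def emeasure_eq_measure)
  qed
  then have "AE t in M. t \<notin> space M - ?U" using good_sets[OF U]
      by (intro AE_not_in) (auto simp: null_sets_def)
  then have AE: "AE t in M. t \<in> ?U" using AE_space by eventually_elim auto
  obtain A :: "nat \<Rightarrow> 't set" where A: "\<forall>i. is_at (A i)" "?U = (\<Union>i. A i)"
    using U by (auto simp: good_def)
  show ?thesis
  proof (intro exI conjI)
    show "\<forall>i. A i = {} \<or> is_atom M (A i)" using A(1) by (simp add: is_at_def)
    show "AE t in M. t \<in> (\<Union>i. A i)" using AE unfolding A(2) .
  qed
qed

text \<open>On the atom \<open>A i\<close> each \<open>f j\<close> is almost everywhere a constant
  \<open>c i j\<close>, bounded in \<open>j\<close>, so a diagonal sequence serves all the countably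
  many atoms.\<close>

lemma purely_atomic_convergent_subseq:
  fixes f :: "nat \<Rightarrow> 't \<Rightarrow> 'b::euclidean_space"
  assumes fin: "finite_measure M" and pa: "purely_atomic M"
    and f[measurable]: "\<And>j. f j \<in> borel_measurable M"
    and bd: "\<And>j. AE t in M. norm (f j t) \<le> h t"
  shows "\<exists>r. strict_mono r \<and> (AE t in M. convergent (\<lambda>j. f (r j) t))"
proof -
  obtain A :: "nat \<Rightarrow> 't set" where A: "\<And>i. A i = {} \<or> is_atom M (A i)" and cover: "AE t in M. t \<in> (\<Union>i. A i)"
    using purely_atomic_countable_cover[OF fin pa] by blast
  have "\<exists>c. AE t in M. t \<in> A i \<longrightarrow> f j t = c" for i j
    using A[of i] constant_on_atom[OF f] by (cases "A i = {}") auto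
  then have "\<forall>i. \<forall>j. \<exists>c. AE t in M. t \<in> A i \<longrightarrow> f j t = c" by blast
  then obtain c where c: "\<And>i j. AE t in M. t \<in> A i \<longrightarrow> f j t = c i j" by metis
  have c_all: "AE t in M. \<forall>i j. (t \<in> A i \<longrightarrow> f j t = c i j)"
    unfolding AE_all_countable using c by (intro allI)
  have bd_all: "AE t in M. \<forall>j. norm (f j t) \<le> h t" using bd by (simp add: AE_all_countable)
  have c_bd: "\<exists>b. \<forall>j. norm (c i j) \<le> b" if "A i \<noteq> {}" for i
  proof (rule ccontr)
    assume no: "\<not> ?thesis"
    have atom: "is_atom M (A i)" using A[of i] that by simp
    then have A_sets: "A i \<in> sets M" and pos: "emeasure M (A i) > 0" by (auto simp: is_atom_def)
    have "AE t in M. t \<notin> A i"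
      using c_all bd_all
    proof eventually_elim
      case (elim t)
      show ?case
      proof
        assume "t \<in> A i"
        then have "\<forall>j. norm (c i j) \<le> h t" using elim by metis
        then show False using no by blast
      qed
    qed
    then have "emeasure M (A i) = 0"
      using AE_iff_measurable[OF A_sets, of "\<lambda>t. t \<notin> A i"] sets.sets_into_space[OF A_sets] by auto
    then show False using pos by simp
  qed
  interpret subseqs "\<lambda>i s. A i \<noteq> {} \<longrightarrow> convergent (\<lambda>j. c i (s j))"
  proof
    fix i and s :: "nat \<Rightarrow> nat"
    show "\<exists>r'. strict_mono r' \<and> (A i \<noteq> {} \<longrightarrow> convergent (\<lambda>j. c i ((s \<circ> r') j)))"
    proof (cases "A i = {}")
      case True then show ?thesis by (intro exI[of _ id]) (auto simp: strict_mono_def)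
    next
      case False
      then obtain b where "\<forall>j. norm (c i j) \<le> b" using c_bd by blast
      then have "bounded (range (\<lambda>j. c i (s j)))" by (auto simp: bounded_iff)
      from bounded_imp_convergent_subsequence[OF this]
      show ?thesis by (auto simp: o_def convergent_def)
    qed
  qed
  define r where "r = diagseq"
  have r: "strict_mono r" unfolding r_def by (rule subseq_diagseq)
  have "convergent (\<lambda>j. c i (r j))" if "A i \<noteq> {}" for i
  proof -
    \<comment> \<open>The diagonal sequence is governed by property \<open>i\<close> only from index
      \<open>Suc i\<close> on, so an initial segment has to be discarded afterwards.\<close>
    have "A i \<noteq> {} \<longrightarrow> convergent (\<lambda>j. c i ((diagseq \<circ> ((+) (Suc i))) j))"
      by (rule diagseq_holds) (use convergent_subseq_convergent in \<open>auto simp: o_def\<close>)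
    then have "convergent (\<lambda>j. c i (r (j + Suc i)))" using that by (simp add: r_def o_def add.commute)
    then show ?thesis using convergent_ignore_initial_segment[of "\<lambda>j. c i (r j)" "Suc i"] by simp
  qed
  note conv = this
  have "AE t in M. convergent (\<lambda>j. f (r j) t)"
    using c_all cover
  proof eventually_elim
    case (elim t)
    then obtain i where i: "t \<in> A i" by blast
    then have "convergent (\<lambda>j. c i (r j))" by (intro conv) blast
    then show ?case using elim(1) i by simp
  qed
  then show ?thesis using r by blast
qed

section \<open>Combining the atomic and the nonatomic part\<close>

lemma AE_restricted:
  assumes "A \<in> sets M"
  shows "(AE t in density M (indicator A). P t) \<longleftrightarrow> (AE t in M. t \<in> A \<longrightarrow> P t)"
  using assms by (subst AE_density) (auto simp: indicator_def intro!: AE_cong)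

lemma
  fixes f :: "'t \<Rightarrow> 'b::{banach, second_countable_topology}"
  assumes [measurable]: "A \<in> sets M" "f \<in> borel_measurable M"
  shows integral_restricted: "(\<integral>t. f t \<partial>density M (indicator A)) = (\<integral>t. indicator A t *\<^sub>R f t \<partial>M)"
    and integrable_restricted:
        "integrable (density M (indicator A)) f \<longleftrightarrow> integrable M (\<lambda>t. indicator A t *\<^sub>R f t)"
proof -
  have "density M (indicator A) = density M (\<lambda>t. ennreal (indicator A t))"
    by (intro density_cong) (auto simp: indicator_def)
  then show "(\<integral>t. f t \<partial>density M (indicator A)) = (\<integral>t. indicator A t *\<^sub>R f t \<partial>M)"
    and "integrable (density M (indicator A)) f \<longleftrightarrow> integrable M (\<lambda>t. indicator A t *\<^sub>R f t)"
    by (simp_all add: integral_density integrable_density)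
qed

text \<open>Lyapunov's theorem fails on atoms, but there a subsequence converges pointwise. It is
  extracted first: along it the integrals over \<open>T_pa\<close> converge, hence so do those over
  \<open>T_na\<close>, and \<open>fatou_nonatomic\<close> applies to the same subsequence.\<close>

theorem fatou_several_dimensions:
  fixes f :: "nat \<Rightarrow> 't \<Rightarrow> 'b::euclidean_space"
  assumes fin: "finite_measure M" and dec: "atomic_decomposition M T_pa T_na"
    and f[measurable]: "\<And>j. f j \<in> borel_measurable M" and h: "integrable M h"
    and bd: "\<And>j. AE t in M. norm (f j t) \<le> h t"
    and lim: "(\<lambda>j. \<integral>t. f j t \<partial>M) \<longlonglongrightarrow> x"
  shows "\<exists>v. integrable M v \<and> (\<integral>t. v t \<partial>M) = x \<and> (AE t in M. cluster_point (\<lambda>j. f j t) (v t))"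
proof -
  have T[measurable]: "T_pa \<in> sets M" "T_na \<in> sets M" and disj: "T_pa \<inter> T_na = {}" "T_pa \<union> T_na = space M"
    and pa: "purely_atomic (density M (indicator T_pa))" and na: "nonatomic (density M (indicator T_na))"
    using dec by (auto simp: atomic_decomposition_def)
  interpret finite_measure M by fact
  let ?P = "density M (indicator T_pa)" and ?N = "density M (indicator T_na)"
  have bdP: "AE t in ?P. norm (f j t) \<le> h t" and bdN: "AE t in ?N. norm (f j t) \<le> h t" for j
    using bd[of j] by (auto simp: AE_restricted elim: eventually_mono)
  obtain r where r: "strict_mono r" and convP: "AE t in ?P. convergent (\<lambda>j. f (r j) t)"
    using purely_atomic_convergent_subseq[where f = f and h = h,
        OF finite_measure_restricted[OF T(1)] pa _ bdP] by auto
  define l where "l t = lim (\<lambda>j. f (r j) t)" for t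
  have l[measurable]: "l \<in> borel_measurable M" unfolding l_def by measurable
  have lP: "AE t in M. t \<in> T_pa \<longrightarrow> (\<lambda>j. f (r j) t) \<longlonglongrightarrow> l t"
    using convP unfolding AE_restricted[OF T(1)]
        by (auto simp: l_def convergent_LIMSEQ_iff elim: eventually_mono)
  have int_f: "integrable M (f j)" for j
    by (rule Bochner_Integration.integrable_bound[OF h]) (use bd[of j] in \<open>auto elim!: eventually_mono\<close>)
  have limP: "(\<lambda>j. \<integral>t. indicator T_pa t *\<^sub>R f (r j) t \<partial>M) \<longlonglongrightarrow> (\<integral>t. indicator T_pa t *\<^sub>R l t \<partial>M)"
    and int_l: "integrable M (\<lambda>t. indicator T_pa t *\<^sub>R l t)"
  proof -
    have 1: "AE t in M. (\<lambda>j. indicator T_pa t *\<^sub>R f (r j) t) \<longlonglongrightarrow> indicator T_pa t *\<^sub>R l t"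
      using lP by eventually_elim (auto simp: indicator_def)
    have 2: "AE t in M. norm (indicator T_pa t *\<^sub>R f (r j) t) \<le> norm (h t)" for j
      using bd[of "r j"] by eventually_elim (auto simp: indicator_def)
    have 3: "integrable M (\<lambda>t. norm (h t))" using h by simp
    show "(\<lambda>j. \<integral>t. indicator T_pa t *\<^sub>R f (r j) t \<partial>M) \<longlonglongrightarrow> (\<integral>t. indicator T_pa t *\<^sub>R l t \<partial>M)"
      by (rule integral_dominated_convergence[OF _ _ 3 1 2]) measurable
    show "integrable M (\<lambda>t. indicator T_pa t *\<^sub>R l t)"
      by (rule integrable_dominated_convergence[OF _ _ 3 1 2]) measurable
  qed
  have split: "(\<integral>t. u t \<partial>M) = (\<integral>t. indicator T_pa t *\<^sub>R u t \<partial>M) + (\<integral>t. indicator T_na t *\<^sub>R u t \<partial>M)"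
    if u: "integrable M u" for u :: "'t \<Rightarrow> 'b"
  proof -
    have "(\<integral>t. u t \<partial>M) = (\<integral>t. indicator T_pa t *\<^sub>R u t + indicator T_na t *\<^sub>R u t \<partial>M)"
      by (rule Bochner_Integration.integral_cong) (use disj in \<open>auto simp: indicator_def\<close>)
    then show ?thesis using u by (simp add: integrable_mult_indicator)
  qed
  have "(\<lambda>j. (\<integral>t. f (r j) t \<partial>M) - (\<integral>t. indicator T_pa t *\<^sub>R f (r j) t \<partial>M)) \<longlonglongrightarrow> x
      - (\<integral>t. indicator T_pa t *\<^sub>R l t \<partial>M)"
    using LIMSEQ_subseq_LIMSEQ[OF lim r] limP by (intro tendsto_diff) (simp_all add: o_def)
  then have limN: "(\<lambda>j. \<integral>t. f (r j) t \<partial>?N) \<longlonglongrightarrow> x - (\<integral>t. indicator T_pa t *\<^sub>R l t \<partial>M)"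
    using split[OF int_f] by (simp add: integral_restricted)
  have hN: "integrable ?N h"
    using integrable_mult_indicator[OF T(2) h]
    by (subst integrable_restricted[OF T(2) borel_measurable_integrable[OF h]])
  obtain w where w: "integrable ?N w" "(\<integral>t. w t \<partial>?N) = x - (\<integral>t. indicator T_pa t *\<^sub>R l t \<partial>M)"
    "AE t in ?N. cluster_point (\<lambda>j. f (r j) t) (w t)"
    using fatou_nonatomic[where f = "\<lambda>j. f (r j)",
        OF finite_measure_restricted[OF T(2)] na _ hN bdN limN] by auto
  have w_meas[measurable]: "w \<in> borel_measurable M" using borel_measurable_integrable[OF w(1)] by simp
  define v where "v t = indicator T_pa t *\<^sub>R l t + indicator T_na t *\<^sub>R w t" for t
  have int_w: "integrable M (\<lambda>t. indicator T_na t *\<^sub>R w t)"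
    using w(1) integrable_restricted[OF T(2) w_meas] by simp
  have "integrable M v" unfolding v_def using int_l int_w by simp
  moreover have "(\<integral>t. v t \<partial>M) = x"
    unfolding v_def using int_l int_w w(2) by (simp add: integral_restricted)
  moreover have "AE t in M. cluster_point (\<lambda>j. f j t) (v t)"
    using lP w(3)[unfolded AE_restricted[OF T(2)]] AE_space
  proof eventually_elim
    case (elim t)
    have "cluster_point (\<lambda>j. f (r j) t) (v t)"
    proof (cases "t \<in> T_pa")
      case True
      then have "v t = l t" using disj by (auto simp: v_def indicator_def)
      then show ?thesis using elim(1) True by (auto intro: cluster_point_limit)
    next
      case False
      then have "t \<in> T_na" using disj elim(3) by auto
      moreover then have "v t = w t" using False by (auto simp: v_def indicator_def)
      ultimately show ?thesis using elim(2) by simp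
    qed
    then show ?case by (rule cluster_point_subseq[OF r])
  qed
  ultimately show ?thesis by blast
qed

section \<open>Measurable minimisers and regular normals\<close>

lemma measurable_argmin:
  fixes S :: "('t \<times> 'c::euclidean_space) set" and F :: "'t \<Rightarrow> 'c \<Rightarrow> real"
  assumes fin: "finite_measure M" and S[measurable]: "S \<in> sets (M \<Otimes>\<^sub>M borel)"
    and F[measurable]: "(\<lambda>z. F (fst z) (snd z)) \<in> borel_measurable (M \<Otimes>\<^sub>M borel)"
    and cpt: "AE t in M. compact {z. (t, z) \<in> S} \<and> {z. (t, z) \<in> S} \<noteq> {}"
    and cont: "\<And>t. t \<in> space M \<Longrightarrow> continuous_on UNIV (F t)"
  shows "\<exists>f\<in>borel_measurable M. AE t in M. (t, f t) \<in> S \<and> (\<forall>z. (t, z) \<in> S \<longrightarrow> F t (f t) \<le> F t z)"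
proof -
  define L where "L q = {z \<in> S. F (fst z) (snd z) < of_rat q}" for q :: rat
  have S_sp: "S \<subseteq> space (M \<Otimes>\<^sub>M borel)" using sets.sets_into_space[OF S] .
  have L: "L q \<in> sets (M \<Otimes>\<^sub>M borel)" for q
  proof -
    have "L q = {z \<in> space (M \<Otimes>\<^sub>M borel). z \<in> S \<and> F (fst z) (snd z) < of_rat q}"
      unfolding L_def using S_sp by auto
    then show ?thesis by simp
  qed
  have "\<forall>q. \<exists>g. g \<in> borel_measurable M \<and> (AE t in M. (\<exists>z. (t, z) \<in> L q) \<longrightarrow> (t, g t) \<in> L q)"
    using measurable_selection[OF fin L] by (auto simp: Bex_def)
  from choice[OF this] obtain g where g:
      "\<forall>q. g q \<in> borel_measurable M \<and> (AE t in M. (\<exists>z. (t, z) \<in> L q) \<longrightarrow> (t, g q t) \<in> L q)"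
    by blast
  have g_meas[measurable]: "g q \<in> borel_measurable M" for q using g by simp
  have g_sel: "AE t in M. (\<exists>z. (t, z) \<in> L q) \<longrightarrow> (t, g q t) \<in> L q" for q using g by simp
  have [measurable]: "L q \<in> sets (M \<Otimes>\<^sub>M borel)" for q by (rule L)
  define E where "E q = {t \<in> space M. (t, g q t) \<in> L q}" for q
  have [measurable]: "E q \<in> sets M" for q unfolding E_def by measurable
  define S' where "S' = {z \<in> space (M \<Otimes>\<^sub>M borel). z \<in> S \<and> (\<forall>q. fst z \<in> E q \<longrightarrow> F (fst z) (snd z) \<le> of_rat q)}"
  have "S' \<in> sets (M \<Otimes>\<^sub>M borel)" unfolding S'_def by measurable
  from measurable_selection[OF fin this] obtain f where f: "f \<in> borel_measurable M"
    and f_sel: "AE t in M. (\<exists>z. (t, z) \<in> S') \<longrightarrow> (t, f t) \<in> S'" by (elim bexE) (rule that)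
  have S'_iff: "(t, z) \<in> S' \<longleftrightarrow> (t, z) \<in> S \<and> (\<forall>q. t \<in> E q \<longrightarrow> F t z \<le> of_rat q)" for t z
    using S_sp unfolding S'_def by auto
  have "AE t in M. \<forall>q. (\<exists>z. (t, z) \<in> L q) \<longrightarrow> (t, g q t) \<in> L q"
    unfolding AE_all_countable by (intro allI g_sel)
  then have "AE t in M. (t, f t) \<in> S \<and> (\<forall>z. (t, z) \<in> S \<longrightarrow> F t (f t) \<le> F t z)"
    using f_sel cpt AE_space
  proof eventually_elim
    case (elim t)
    have E: "t \<in> E q \<longleftrightarrow> (\<exists>z. (t, z) \<in> L q)" for q
      using elim(1)[rule_format, of q] elim(4) unfolding E_def by blast
    have L_iff: "(t, z) \<in> L q \<longleftrightarrow> (t, z) \<in> S \<and> F t z < of_rat q" for z q by (simp add: L_def)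
    have "continuous_on {z. (t, z) \<in> S} (F t)" using cont[OF elim(4)] continuous_on_subset by blast
    then obtain z0 where z0: "(t, z0) \<in> S" "\<And>z. (t, z) \<in> S \<Longrightarrow> F t z0 \<le> F t z"
      using continuous_attains_inf[of "{z. (t, z) \<in> S}" "F t"] elim(3) by auto
    have "F t z0 \<le> of_rat q" if q: "t \<in> E q" for q
    proof -
      obtain z where "(t, z) \<in> S" "F t z < of_rat q" using q unfolding E L_iff by blast
      then show ?thesis using z0(2)[of z] by simp
    qed
    then have "(t, z0) \<in> S'" unfolding S'_iff using z0(1) by simp
    then have fS: "(t, f t) \<in> S'" using elim(2) by blast
    show ?case
    proof (intro conjI allI impI)
      show "(t, f t) \<in> S" using fS unfolding S'_iff by simp
      fix z assume z: "(t, z) \<in> S"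
      show "F t (f t) \<le> F t z"
      proof (rule ccontr)
        assume "\<not> ?thesis"
        then obtain q where q: "F t z < of_rat q" "of_rat q < F t (f t)"
            using of_rat_dense[of "F t z" "F t (f t)"] by auto
        have "t \<in> E q" unfolding E L_iff using z q(1) by blast
        then show False using fS q(2) unfolding S'_iff by force
      qed
    qed
  qed
  then show ?thesis using f by (intro bexI[of _ f])
qed

section \<open>Regular normals and first-order conditions\<close>

lemma regular_normal_cone_iff:
  "w \<in> regular_normal_cone z \<Omega> \<longleftrightarrow> z \<in> \<Omega> \<and>
     (\<forall>e>0. \<exists>d>0. \<forall>u\<in>\<Omega>. norm (u - z) < d \<longrightarrow> w \<bullet> (u - z) \<le> e * norm (u - z))"
proof -
  have "Limsup (at z within \<Omega>) (\<lambda>u. ereal (w \<bullet> (u - z) / norm (u - z))) \<le> 0 \<longleftrightarrow>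
     (\<forall>e>0. \<exists>d>0. \<forall>u\<in>\<Omega>. norm (u - z) < d \<longrightarrow> w \<bullet> (u - z) \<le> e * norm (u - z))" (is "?L \<longleftrightarrow> ?R")
  proof
    assume ?L
    show ?R
    proof (intro allI impI)
      fix e :: real assume "e > 0"
      then have "eventually (\<lambda>u. ereal (w \<bullet> (u - z) / norm (u - z)) < ereal e) (at z within \<Omega>)"
        by (intro \<open>?L\<close>[unfolded Limsup_le_iff, rule_format]) simp
      then obtain d where d: "d > 0" "\<And>u. u \<in> \<Omega> \<Longrightarrow> u \<noteq> z \<Longrightarrow> dist u z < d \<Longrightarrow> w \<bullet> (u - z) / norm (u - z) < e"
        unfolding eventually_at by auto
      have "w \<bullet> (u - z) \<le> e * norm (u - z)" if "u \<in> \<Omega>" "norm (u - z) < d" for u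
      proof (cases "u = z")
        case False
        then show ?thesis using d(2)[of u] that by (simp add: dist_norm divide_less_eq)
      qed simp
      then show "\<exists>d>0. \<forall>u\<in>\<Omega>. norm (u - z) < d \<longrightarrow> w \<bullet> (u - z) \<le> e * norm (u - z)" using d(1) by blast
    qed
  next
    assume R: ?R
    show ?L unfolding Limsup_le_iff
    proof (intro allI impI)
      fix y :: ereal assume "y > 0"
      then obtain e where e: "0 < e" "ereal e < y" by (metis ereal_dense2 ereal_less(2))
      from R e(1) obtain d where d: "d > 0"
          "\<forall>u\<in>\<Omega>. norm (u - z) < d \<longrightarrow> w \<bullet> (u - z) \<le> e * norm (u - z)" by blast
      have "ereal (w \<bullet> (u - z) / norm (u - z)) < y" if "u \<in> \<Omega>" "u \<noteq> z" "dist u z < d" for u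
      proof -
        have "w \<bullet> (u - z) / norm (u - z) \<le> e" using d(2) that by (simp add: dist_norm divide_le_eq)
        then show ?thesis using e(2) by (meson ereal_less_eq(3) le_less_trans)
      qed
      then show "eventually (\<lambda>u. ereal (w \<bullet> (u - z) / norm (u - z)) < y) (at z within \<Omega>)"
        unfolding eventually_at using d(1) by blast
    qed
  qed
  then show ?thesis by (simp add: regular_normal_cone_def)
qed

text \<open>The hypothesis describes a proximal normal: close to \<open>z\<close> the quadratic term
  lies below any linear one.\<close>

lemma regular_normal_coneI:
  assumes "z \<in> \<Omega>" "d > 0" and le: "\<And>u. u \<in> \<Omega> \<Longrightarrow> norm (u - z) < d \<Longrightarrow> w \<bullet> (u - z) \<le> L * (norm (u - z))\<^sup>2"
  shows "w \<in> regular_normal_cone z \<Omega>"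
  unfolding regular_normal_cone_iff
proof (intro conjI allI impI)
  fix e :: real assume "e > 0"
  let ?d = "min d (e / (\<bar>L\<bar> + 1))"
  have "w \<bullet> (u - z) \<le> e * norm (u - z)" if u: "u \<in> \<Omega>" "norm (u - z) < ?d" for u
  proof -
    have "\<bar>L\<bar> * norm (u - z) \<le> (\<bar>L\<bar> + 1) * (e / (\<bar>L\<bar> + 1))"
      using u(2) by (intro mult_mono) auto
    then have "\<bar>L\<bar> * norm (u - z) \<le> e" by simp
    then have "\<bar>L\<bar> * norm (u - z) * norm (u - z) \<le> e * norm (u - z)" by (intro mult_right_mono) auto
    moreover have "L * (norm (u - z))\<^sup>2 \<le> \<bar>L\<bar> * (norm (u - z))\<^sup>2" by (intro mult_right_mono) auto
    ultimately show ?thesis using le[OF u(1)] u(2) by (simp add: power2_eq_square mult.assoc)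
  qed
  then show "\<exists>d>0. \<forall>u\<in>\<Omega>. norm (u - z) < d \<longrightarrow> w \<bullet> (u - z) \<le> e * norm (u - z)"
    using \<open>d > 0\<close> \<open>e > 0\<close> by (intro exI[of _ ?d]) auto
qed fact

lemma regular_subset_limiting: "regular_normal_cone z \<Omega> \<subseteq> limiting_normal_cone z \<Omega>"
  unfolding limiting_normal_cone_def by (auto intro!: exI[of _ "\<lambda>_. z"] exI[of _ "\<lambda>_. _"])

text \<open>
  The quadratic term makes the inequality hold for all \<open>s\<close>, although normality is a local
  property of the graph.
\<close>

lemma regular_normal_global_bound:
  fixes E :: "'a::euclidean_space \<Rightarrow> 'b::euclidean_space set"
  assumes N: "(xs, - ys) \<in> regular_normal_cone (xb, yb) (gph E)" and "e > 0" "\<rho> > 0"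
  shows "\<exists>\<delta> K. 0 < \<delta> \<and> \<delta> \<le> \<rho> \<and> 0 \<le> K \<and> (\<forall>c\<in>cball xb \<delta>. \<forall>s\<in>E c.
     xs \<bullet> (c - xb) - ys \<bullet> (s - yb) \<le> e * (norm (c - xb) + norm (s - yb)) + K * (norm (s - yb))\<^sup>2)"
proof -
  obtain d where d: "d > 0"
    "\<forall>u\<in>gph E. norm (u - (xb, yb)) < d \<longrightarrow> (xs, - ys) \<bullet> (u - (xb, yb)) \<le> e * norm (u - (xb, yb))"
    using N \<open>e > 0\<close> unfolding regular_normal_cone_iff by blast
  \<comment> \<open>As d/3 + d/2 < d, pairs with |s - yb| < b are near enough for normality to
    apply. For all other pairs \<open>K\<close> absorbs the crude Cauchy-Schwarz bounds, by 1 <= r^2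
    / b^2 and r <= r^2 / b.\<close>
  define \<delta> where "\<delta> = min \<rho> (d / 3)"
  define b where "b = d / 2"
  define K where "K = norm xs * \<delta> / b\<^sup>2 + norm ys / b"
  have pos: "\<delta> > 0" "b > 0" using d(1) \<open>\<rho> > 0\<close> by (auto simp: \<delta>_def b_def)
  have K0: "K \<ge> 0" using pos by (simp add: K_def)
  have "xs \<bullet> (c - xb) - ys \<bullet> (s - yb) \<le> e * (norm (c - xb) + norm (s - yb)) + K * (norm (s - yb))\<^sup>2"
    if c: "c \<in> cball xb \<delta>" and s: "s \<in> E c" for c s
  proof (cases "norm (s - yb) < b")
    case True
    have c': "norm (c - xb) \<le> \<delta>" using c by (simp add: dist_norm norm_minus_commute)
    have le: "norm ((c, s) - (xb, yb)) \<le> norm (c - xb) + norm (s - yb)"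
      using norm_Pair_le[of "c - xb" "s - yb"] by simp
    also have "\<dots> < d" using c' True d(1) by (auto simp: \<delta>_def b_def)
    finally have "(xs, - ys) \<bullet> ((c, s) - (xb, yb)) \<le> e * norm ((c, s) - (xb, yb))"
      using d(2) s by (auto simp: gph_def)
    also have "\<dots> \<le> e * (norm (c - xb) + norm (s - yb))" using le \<open>e > 0\<close> by (intro mult_left_mono) auto
    finally have "xs \<bullet> (c - xb) - ys \<bullet> (s - yb) \<le> e * (norm (c - xb) + norm (s - yb))" by simp
    moreover have "0 \<le> K * (norm (s - yb))\<^sup>2" using K0 by simp
    ultimately show ?thesis by linarith
  next
    case False
    define r where "r = norm (s - yb)"
    have r: "b \<le> r" using False by (simp add: r_def)
    have c': "norm (c - xb) \<le> \<delta>" using c by (simp add: dist_norm norm_minus_commute)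
    have "xs \<bullet> (c - xb) \<le> norm xs * norm (c - xb)" by (rule norm_cauchy_schwarz)
    also have "\<dots> \<le> norm xs * \<delta>" using c' by (intro mult_left_mono) auto
    also have "\<dots> = norm xs * \<delta> / b\<^sup>2 * b\<^sup>2" using pos by simp
    also have "\<dots> \<le> norm xs * \<delta> / b\<^sup>2 * r\<^sup>2" using pos r by (intro mult_left_mono power_mono) auto
    finally have 1: "xs \<bullet> (c - xb) \<le> norm xs * \<delta> / b\<^sup>2 * r\<^sup>2" .
    have "- (ys \<bullet> (s - yb)) \<le> \<bar>ys \<bullet> (s - yb)\<bar>" by simp
    also have "\<dots> \<le> norm ys * r" unfolding r_def by (rule Cauchy_Schwarz_ineq2)
    also have "\<dots> = norm ys / b * (b * r)" using pos by simp
    also have "\<dots> \<le> norm ys / b * r\<^sup>2"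
      using pos r unfolding power2_eq_square by (intro mult_left_mono mult_right_mono) auto
    finally have 2: "- (ys \<bullet> (s - yb)) \<le> norm ys / b * r\<^sup>2" .
    have "xs \<bullet> (c - xb) - ys \<bullet> (s - yb) \<le> K * r\<^sup>2"
      using 1 2 by (simp add: K_def algebra_simps)
    moreover have "0 \<le> e * (norm (c - xb) + norm (s - yb))" using \<open>e > 0\<close> by simp
    ultimately show ?thesis by (simp add: r_def)
  qed
  then show ?thesis using pos K0 by (intro exI[of _ \<delta>] exI[of _ K]) (auto simp: \<delta>_def)
qed

text \<open>A quadratic upper estimate of the smoothed norm with its gradient a / A at
  \<open>a\<close>. It comes from 2 A (B - A) <= B^2 - A^2, and the constant of the remainder from A
  >= \<open>\<tau>\<close>.\<close>

lemma sqrt_sum_square_diff_le: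
  fixes a b :: "'a::real_inner"
  assumes "\<tau> > 0"
  shows "sqrt ((norm b)\<^sup>2 + \<tau>\<^sup>2) - sqrt ((norm a)\<^sup>2 + \<tau>\<^sup>2)
    \<le> (1 / sqrt ((norm a)\<^sup>2 + \<tau>\<^sup>2)) * (a \<bullet> (b - a)) + (1 / (2 * \<tau>)) * (norm (b - a))\<^sup>2"
proof -
  define A where "A = sqrt ((norm a)\<^sup>2 + \<tau>\<^sup>2)"
  define B where "B = sqrt ((norm b)\<^sup>2 + \<tau>\<^sup>2)"
  have \<tau>A: "\<tau> \<le> A" unfolding A_def using assms by (intro real_le_rsqrt) auto
  have A2: "A\<^sup>2 = (norm a)\<^sup>2 + \<tau>\<^sup>2" and B2: "B\<^sup>2 = (norm b)\<^sup>2 + \<tau>\<^sup>2" by (simp_all add: A_def B_def)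
  have A0: "A > 0" using \<tau>A assms by simp
  have "(norm b)\<^sup>2 = (norm a)\<^sup>2 + 2 * (a \<bullet> (b - a)) + (norm (b - a))\<^sup>2"
    unfolding power2_norm_eq_inner by (simp add: inner_diff_left inner_diff_right inner_commute)
  then have eq: "B\<^sup>2 - A\<^sup>2 = 2 * (a \<bullet> (b - a)) + (norm (b - a))\<^sup>2" by (simp add: A2 B2)
  have "2 * A * (B - A) \<le> B\<^sup>2 - A\<^sup>2"
    using zero_le_power2[of "B - A"] by (simp add: power2_eq_square algebra_simps)
  then have "B - A \<le> (2 * (a \<bullet> (b - a)) + (norm (b - a))\<^sup>2) / (2 * A)"
    unfolding eq using A0 by (simp add: pos_le_divide_eq mult.commute)
  also have "\<dots> = (1 / A) * (a \<bullet> (b - a)) + (1 / (2 * A)) * (norm (b - a))\<^sup>2"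
    using A0 by (simp add: field_simps)
  also have "(1 / (2 * A)) * (norm (b - a))\<^sup>2 \<le> (1 / (2 * \<tau>)) * (norm (b - a))\<^sup>2"
    using \<tau>A assms by (intro mult_right_mono) (auto simp: frac_le)
  finally show ?thesis by (simp add: A_def B_def)
qed

text \<open>By monotone convergence the pointwise sum of the functions \<open>u j\<close> has a
  finite integral, hence it is finite almost everywhere.\<close>

lemma
  fixes u :: "nat \<Rightarrow> 't \<Rightarrow> real"
  assumes int: "\<And>j. integrable M (u j)" and nonneg: "\<And>j. AE t in M. 0 \<le> u j t"
    and sum: "summable (\<lambda>j. \<integral>t. u j t \<partial>M)"
  shows AE_summable_of_summable_integral: "AE t in M. summable (\<lambda>j. u j t)"
    and integrable_suminf_of_summable_integral: "integrable M (\<lambda>t. \<Sum>j. u j t)"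
proof -
  have [measurable]: "u j \<in> borel_measurable M" for j using int by simp
  have nn: "AE t in M. \<forall>j. 0 \<le> u j t" using nonneg by (simp add: AE_all_countable)
  have int0: "0 \<le> (\<integral>t. u j t \<partial>M)" for j using nonneg by (intro integral_nonneg_AE)
  have "(\<integral>\<^sup>+t. (\<Sum>j. ennreal (u j t)) \<partial>M) = (\<Sum>j. \<integral>\<^sup>+t. ennreal (u j t) \<partial>M)"
    by (intro nn_integral_suminf) simp
  also have "\<dots> = (\<Sum>j. ennreal (\<integral>t. u j t \<partial>M))"
    using int nonneg by (simp add: nn_integral_eq_integral)
  also have "\<dots> < \<infinity>" using sum int0 by (simp add: suminf_ennreal2)
  finally have "(\<integral>\<^sup>+t. (\<Sum>j. ennreal (u j t)) \<partial>M) \<noteq> \<infinity>" by simp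
  then have "AE t in M. (\<Sum>j. ennreal (u j t)) \<noteq> \<infinity>" by (intro nn_integral_PInf_AE) simp_all
  then show AE: "AE t in M. summable (\<lambda>j. u j t)"
    using nn by eventually_elim (auto intro!: summable_suminf_not_top)
  show "integrable M (\<lambda>t. \<Sum>j. u j t)"
  proof (rule integrable_suminf[OF int])
    show "AE t in M. summable (\<lambda>j. norm (u j t))" using AE nn by eventually_elim simp
    have "(\<integral>t. norm (u j t) \<partial>M) = (\<integral>t. u j t \<partial>M)" for j
      using nonneg[of j] by (intro integral_cong_AE) (auto elim: eventually_mono)
    then show "summable (\<lambda>j. \<integral>t. norm (u j t) \<partial>M)" using sum by simp
  qed
qed

text \<open>Testing with ever smaller positive multiples of \<open>g\<close> makes the quadratic
  term negligible. This serves as the optimality condition for a smooth function plus a term of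
  slope \<open>a\<close>.\<close>

lemma norm_le_of_linear_growth:
  fixes g :: "'a::real_inner"
  assumes "d > 0" "a \<ge> 0" and le: "\<And>h. norm h < d \<Longrightarrow> g \<bullet> h \<le> a * norm h + L * (norm h)\<^sup>2"
  shows "norm g \<le> a"
proof (cases "g = 0")
  case False
  define s where "s n = min (d / (2 * norm g)) (inverse (real (Suc n)))" for n
  have s_pos: "s n > 0" for n using False \<open>d > 0\<close> by (simp add: s_def)
  have s_lim: "s \<longlonglongrightarrow> 0"
  proof (rule tendsto_sandwich[OF _ _ tendsto_const LIMSEQ_inverse_real_of_nat])
    show "eventually (\<lambda>n. 0 \<le> s n) sequentially" using s_pos
        by (intro always_eventually) (auto intro: less_imp_le)
    show "eventually (\<lambda>n. s n \<le> inverse (real (Suc n))) sequentially"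
        by (intro always_eventually) (simp add: s_def)
  qed
  have "norm g \<le> a + L * norm g * s n" for n
  proof -
    have sg: "norm (s n *\<^sub>R g) = s n * norm g" using s_pos[of n] by simp
    have "s n * norm g \<le> d / (2 * norm g) * norm g" by (intro mult_right_mono) (auto simp: s_def)
    also have "\<dots> < d" using False \<open>d > 0\<close> by simp
    finally have "norm (s n *\<^sub>R g) < d" by (simp only: sg)
    from le[OF this] have "s n * (norm g)\<^sup>2 \<le> a * (s n * norm g) + L * (s n * norm g)\<^sup>2"
      unfolding sg by (simp add: power2_norm_eq_inner)
    then have "(s n * norm g) * norm g \<le> (s n * norm g) * (a + L * norm g * s n)"
      by (simp add: power2_eq_square algebra_simps)
    then show ?thesis using s_pos[of n] False by simp
  qed
  moreover have "(\<lambda>n. a + L * norm g * s n) \<longlonglongrightarrow> a + L * norm g * 0" by (intro tendsto_intros s_lim)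
  ultimately show ?thesis by (intro LIMSEQ_le_const[where X = "\<lambda>n. a + L * norm g * s n"]) auto
qed (use \<open>a \<ge> 0\<close> in simp)

lemma norm_square_diff:
  fixes a b c :: "'a::real_inner"
  shows "(norm (b - c))\<^sup>2 - (norm (a - c))\<^sup>2 = 2 * ((a - c) \<bullet> (b - a)) + (norm (b - a))\<^sup>2"
  unfolding power2_norm_eq_inner by (simp add: inner_diff_left inner_diff_right inner_commute)

text \<open>Fermat's rule on the graph of \<open>\<Psi>\<close>: at a minimum the negative gradient
  of the smooth cost is a proximal normal, with the second-order remainders collected in
  \<open>?L\<close>. Competitors are confined to the ball of radius \<open>\<rho>\<close>, so
  \<open>x\<close> has to lie strictly inside.\<close>

lemma penalised_fermat:
  fixes \<Psi> :: "'a::euclidean_space \<Rightarrow> 'b::euclidean_space set"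
  assumes y: "y \<in> \<Psi> x" and x: "norm (x - xbar) < \<rho>"
    and k: "0 \<le> k" and K: "0 \<le> K" and e: "0 \<le> e" and \<tau>: "0 < \<tau>"
    and min: "\<And>u v. u \<in> cball xbar \<rho> \<Longrightarrow> v \<in> \<Psi> u \<Longrightarrow>
      ys \<bullet> (y - y0) + 2 * e * sqrt ((norm (y - y0))\<^sup>2 + \<tau>\<^sup>2) + K * (norm (y - y0))\<^sup>2 + k * (norm (x - c))\<^sup>2
      \<le> ys \<bullet> (v - y0) + 2 * e * sqrt ((norm (v - y0))\<^sup>2 + \<tau>\<^sup>2) + K * (norm (v - y0))\<^sup>2 + k * (norm
          (u - c))\<^sup>2"
  shows "(- 2 * k) *\<^sub>R (x - c) \<in> regular_coderivative \<Psi> x y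
    (ys + ((2 * e / sqrt ((norm (y - y0))\<^sup>2 + \<tau>\<^sup>2)) *\<^sub>R (y - y0) + (2 * K) *\<^sub>R (y - y0)))"
proof -
  let ?A = "sqrt ((norm (y - y0))\<^sup>2 + \<tau>\<^sup>2)"
  let ?err = "(2 * e / ?A) *\<^sub>R (y - y0) + (2 * K) *\<^sub>R (y - y0)"
  let ?p = "(- 2 * k) *\<^sub>R (x - c)"
  let ?L = "k + (e / \<tau> + K)"
  have "(?p, - (ys + ?err)) \<in> regular_normal_cone (x, y) (gph \<Psi>)"
  proof (rule regular_normal_coneI)
    show "(x, y) \<in> gph \<Psi>" using y by (simp add: gph_def)
    show "0 < \<rho> - norm (x - xbar)" using x by simp
    fix z assume z: "z \<in> gph \<Psi>" "norm (z - (x, y)) < \<rho> - norm (x - xbar)"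
    obtain u v where uv: "z = (u, v)" by (cases z)
    have v: "v \<in> \<Psi> u" using z(1) by (simp add: uv gph_def)
    have "norm (u - x) \<le> norm (z - (x, y))" unfolding uv using norm_fst_le[of "u - x" "v - y"] by simp
    then have "norm (u - xbar) \<le> \<rho>" using z(2) norm_triangle_ineq[of "u - x" "x - xbar"] by simp
    then have u: "u \<in> cball xbar \<rho>" by (simp add: dist_norm norm_minus_commute)
    define W where "W = (y - y0) \<bullet> (v - y)"
    have 1: "k * (norm (u - c))\<^sup>2 - k * (norm (x - c))\<^sup>2 = - (?p \<bullet> (u - x)) + k * (norm (u - x))\<^sup>2"
      unfolding right_diff_distrib[symmetric] norm_square_diff by (simp add: algebra_simps)
    have 2: "K * (norm (v - y0))\<^sup>2 - K * (norm (y - y0))\<^sup>2 = 2 * K * W + K * (norm (v - y))\<^sup>2"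
      unfolding right_diff_distrib[symmetric] norm_square_diff W_def by (simp add: algebra_simps)
    have "sqrt ((norm (v - y0))\<^sup>2 + \<tau>\<^sup>2) - ?A \<le> (1 / ?A) * W + (1 / (2 * \<tau>)) * (norm (v - y))\<^sup>2"
      using sqrt_sum_square_diff_le[OF \<tau>, of "v - y0" "y - y0"] by (simp add: W_def)
    then have "2 * e * (sqrt ((norm (v - y0))\<^sup>2 + \<tau>\<^sup>2) - ?A)
        \<le> 2 * e * ((1 / ?A) * W + (1 / (2 * \<tau>)) * (norm (v - y))\<^sup>2)"
      using e by (intro mult_left_mono) auto
    also have "\<dots> = (2 * e / ?A) * W + (e / \<tau>) * (norm (v - y))\<^sup>2" using \<tau> by (simp add: algebra_simps)
    finally have 3:
        "2 * e * sqrt ((norm (v - y0))\<^sup>2 + \<tau>\<^sup>2) - 2 * e * ?A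
            \<le> (2 * e / ?A) * W + (e / \<tau>) * (norm (v - y))\<^sup>2"
      by (simp add: right_diff_distrib)
    have 4: "ys \<bullet> (v - y0) - ys \<bullet> (y - y0) = ys \<bullet> (v - y)" by (simp add: inner_diff_right)
    have 5: "?err \<bullet> (v - y) = (2 * e / ?A) * W + 2 * K * W" by (simp add: W_def inner_add_left)
    have "?p \<bullet> (u - x) - (ys + ?err) \<bullet> (v - y) \<le> k * (norm (u - x))\<^sup>2 + (e / \<tau> + K) * (norm (v - y))\<^sup>2"
      using min[OF u v] 1 2 3 4 5 by (simp only: inner_add_left[of ys] distrib_right)
    also have "\<dots> \<le> ?L * (norm (u - x))\<^sup>2 + ?L * (norm (v - y))\<^sup>2"
      using k K e \<tau> by (intro add_mono[OF mult_right_mono mult_right_mono]) auto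
    also have "\<dots> = ?L * (norm (z - (x, y)))\<^sup>2" by (simp add: uv norm_Pair distrib_left)
    finally show "(?p, - (ys + ?err)) \<bullet> (z - (x, y)) \<le> ?L * (norm (z - (x, y)))\<^sup>2"
      by (simp only: uv diff_Pair inner_Pair inner_minus_left add_uminus_conv_diff)
  qed
  then show ?thesis by (simp add: regular_coderivative_def)
qed

section \<open>The penalised problem\<close>

lemma Linf_norm_le:
  assumes f: "f \<in> borel_measurable M" and bd: "AE t in M. norm (f t) \<le> B"
  shows "Linf_norm M f \<le> ereal B"
  unfolding Linf_norm_def using assms by (intro esssup_I) auto

lemma Linf_bounded:
  assumes "f \<in> borel_measurable M" "AE t in M. norm (f t) \<le> B"
  shows "f \<in> Linf M"
  using assms Linf_norm_le[OF assms] by (auto simp: Linf_def)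

text \<open>The bound is normalised to be at least 1 everywhere, so that it can act as a weight and
  as a divisor; the final theorem passes to \<open>max 1 (\<kappa> t)\<close>.\<close>

locale bounded_integrand = finite_measure M
  for M :: "'t measure" +
  fixes T_pa T_na :: "'t set" and \<Phi> :: "'t \<Rightarrow> 'a::euclidean_space \<Rightarrow> 'b::euclidean_space set"
    and xbar :: 'a and yb :: "'t \<Rightarrow> 'b" and \<rho> :: real and \<kappa> :: "'t \<Rightarrow> real"
  assumes dec: "atomic_decomposition M T_pa T_na"
    and normal: "normal_integrand M \<Phi>"
    and \<rho>_pos: "\<rho> > 0"
    and \<kappa>_int: "integrable M \<kappa>" and \<kappa>_ge1: "\<And>t. 1 \<le> \<kappa> t"
    and bounded: "AE t in M. \<forall>x\<in>cball xbar \<rho>. \<Phi> t x \<subseteq> cball 0 (\<kappa> t)"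
    and yb_int: "integrable M yb" and yb_sel: "AE t in M. yb t \<in> \<Phi> t xbar"
begin

lemma \<kappa>_meas[measurable]: "\<kappa> \<in> borel_measurable M" using \<kappa>_int by simp
lemma yb_meas[measurable]: "yb \<in> borel_measurable M" using yb_int by simp

lemma \<kappa>_pos: "\<kappa> t > 0" using \<kappa>_ge1[of t] by linarith

lemma xbar_mem: "xbar \<in> cball xbar \<rho>" using \<rho>_pos by simp

lemma closed_gph: "t \<in> space M \<Longrightarrow> closed (gph (\<Phi> t))"
  using normal by (simp add: normal_integrand_def)

lemma yb_bound: "AE t in M. norm (yb t) \<le> \<kappa> t"
  using bounded yb_sel
proof eventually_elim
  case (elim t)
  then have "yb t \<in> cball 0 (\<kappa> t)" using xbar_mem by blast
  then show ?case by simp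
qed

definition admissible :: "('t \<Rightarrow> 'a) \<Rightarrow> ('t \<Rightarrow> 'b) \<Rightarrow> bool" where
  "admissible x y \<longleftrightarrow> x \<in> borel_measurable M \<and> y \<in> borel_measurable M \<and>
     (AE t in M. x t \<in> cball xbar \<rho> \<and> y t \<in> \<Phi> t (x t))"

lemma admissible_bound:
  assumes "admissible x y"
  shows "AE t in M. norm (y t) \<le> \<kappa> t"
proof -
  have "AE t in M. x t \<in> cball xbar \<rho> \<and> y t \<in> \<Phi> t (x t)" using assms by (simp add: admissible_def)
  then show ?thesis using bounded
  proof eventually_elim
    case (elim t)
    then have "y t \<in> cball 0 (\<kappa> t)" by blast
    then show ?case by simp
  qed
qed

lemma admissible_meas:
  assumes "admissible x y"
  shows "x \<in> borel_measurable M" "y \<in> borel_measurable M"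
  using assms by (auto simp: admissible_def)

lemma admissible_integrable:
  assumes "admissible x y"
  shows "integrable M y"
proof (rule Bochner_Integration.integrable_bound[OF \<kappa>_int])
  show "AE t in M. norm (y t) \<le> norm (\<kappa> t)" using admissible_bound[OF assms] by eventually_elim simp
qed (use admissible_meas[OF assms] in simp)

lemma admissible_base: "admissible (\<lambda>_. xbar) yb"
  unfolding admissible_def using yb_sel \<rho>_pos by simp

lemma penalty_integrable:
  assumes a: "admissible x y" and c: "c \<in> cball xbar \<rho>"
  shows "integrable M (\<lambda>t. \<kappa> t * (norm (x t - c))\<^sup>2)"
proof (rule Bochner_Integration.integrable_bound)
  show "integrable M (\<lambda>t. (2 * \<rho>)\<^sup>2 * \<kappa> t)" using \<kappa>_int by simp
  note [measurable] = admissible_meas[OF a]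
  show "(\<lambda>t. \<kappa> t * (norm (x t - c))\<^sup>2) \<in> borel_measurable M" by measurable
  have "AE t in M. x t \<in> cball xbar \<rho> \<and> y t \<in> \<Phi> t (x t)" using a by (simp add: admissible_def)
  then show "AE t in M. norm (\<kappa> t * (norm (x t - c))\<^sup>2) \<le> norm ((2 * \<rho>)\<^sup>2 * \<kappa> t)"
  proof eventually_elim
    case (elim t)
    have "dist (x t) c \<le> dist xbar (x t) + dist xbar c" by (rule dist_triangle3)
    then have "norm (x t - c) \<le> 2 * \<rho>" using elim c by (simp add: dist_norm)
    then have "(norm (x t - c))\<^sup>2 \<le> (2 * \<rho>)\<^sup>2" by (intro power_mono) auto
    then have "\<kappa> t * (norm (x t - c))\<^sup>2 \<le> \<kappa> t * (2 * \<rho>)\<^sup>2" using \<kappa>_pos[of t] by (intro mult_left_mono) auto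
    then show ?case using \<kappa>_pos[of t] by (simp add: abs_mult mult_ac)
  qed
qed

text \<open>Fatou's lemma gives a selection \<open>v\<close> of cluster points of the
  \<open>y k\<close>, and closedness of each graph puts \<open>v t\<close> into
  \<open>\<Phi> t c\<close>. The arguments \<open>x k\<close> vary with \<open>t\<close>, as they do
  for minimisers of a relaxed problem.\<close>

lemma expected_map_closed:
  assumes adm: "\<And>k. admissible (x k) (y k)"
    and lim_x: "AE t in M. (\<lambda>k. x k t) \<longlonglongrightarrow> c" and lim_y: "(\<lambda>k. \<integral>t. y k t \<partial>M) \<longlonglongrightarrow> s"
  shows "s \<in> expected_map M \<Phi> c"
proof -
  obtain v where v: "integrable M v" "(\<integral>t. v t \<partial>M) = s" "AE t in M. cluster_point (\<lambda>k. y k t) (v t)"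
    using fatou_several_dimensions[where f = y and h = \<kappa>,
        OF finite_measure_axioms dec admissible_meas(2)[OF adm] \<kappa>_int
        admissible_bound[OF adm] lim_y]
    by (elim exE conjE) (rule that)
  have "AE t in M. x k t \<in> cball xbar \<rho> \<and> y k t \<in> \<Phi> t (x k t)" for k using adm[of k]
      by (simp add: admissible_def)
  then have "AE t in M. \<forall>k. x k t \<in> cball xbar \<rho> \<and> y k t \<in> \<Phi> t (x k t)" by (simp add: AE_all_countable)
  then have "AE t in M. v t \<in> \<Phi> t c"
    using v(3) lim_x AE_space
  proof eventually_elim
    case (elim t)
    then obtain r where r: "strict_mono r" "(\<lambda>k. y (r k) t) \<longlonglongrightarrow> v t" by (auto simp: cluster_point_def)
    have "(\<lambda>k. (x (r k) t, y (r k) t)) \<longlonglongrightarrow> (c, v t)"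
      using LIMSEQ_subseq_LIMSEQ[OF elim(3) r(1)] r(2) by (intro tendsto_Pair) (simp_all add: o_def)
    moreover have "(x (r k) t, y (r k) t) \<in> gph (\<Phi> t)" for k using elim(1) by (simp add: gph_def)
    ultimately have "(c, v t) \<in> gph (\<Phi> t)"
      using closed_gph[OF elim(4)] closed_sequentially[of "gph (\<Phi> t)" "\<lambda>k. (x (r k) t, y (r k) t)"] by blast
    then show ?case by (simp add: gph_def)
  qed
  then show ?thesis using v unfolding expected_map_def aumann_integral_def L1_def by auto
qed

text \<open>
  The constraint \<open>x(t) = c\<close> is relaxed to a penalty \<open>k \<kappa>(t) |x(t) - c|\<^sup>2\<close>.  The relaxed problem is
  decomposable, so exact minimisers exist: pointwise in \<open>(x(t), y(t))\<close> by measurable selection, then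
  in \<open>c\<close> by compactness.
\<close>

lemma penalised_minimiser:
  fixes G :: "'t \<Rightarrow> 'b \<Rightarrow> real" and \<phi> :: "'a \<Rightarrow> real"
  assumes G_meas: "(\<lambda>z. G (fst z) (snd z)) \<in> borel_measurable (M \<Otimes>\<^sub>M borel)"
    and G_cont: "\<And>t. t \<in> space M \<Longrightarrow> continuous_on UNIV (G t)"
    and G_bd: "AE t in M. \<forall>v. norm v \<le> \<kappa> t \<longrightarrow> \<bar>G t v\<bar> \<le> B * \<kappa> t"
    and \<phi>: "continuous_on UNIV \<phi>" and \<delta>: "0 < \<delta>" "\<delta> \<le> \<rho>" and k: "0 \<le> (k::real)"
  shows "\<exists>c x y. c \<in> cball xbar \<delta> \<and> admissible x y \<and>
     (AE t in M. \<forall>u v. u \<in> cball xbar \<rho> \<longrightarrow> v \<in> \<Phi> t u \<longrightarrow>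
        G t (y t) + k * \<kappa> t * (norm (x t - c))\<^sup>2 \<le> G t v + k * \<kappa> t * (norm (u - c))\<^sup>2) \<and>
     (\<forall>c' x' y'. c' \<in> cball xbar \<delta> \<longrightarrow> admissible x' y' \<longrightarrow>
        \<phi> c + (\<integral>t. G t (y t) + k * \<kappa> t * (norm (x t - c))\<^sup>2 \<partial>M)
        \<le> \<phi> c' + (\<integral>t. G t (y' t) + k * \<kappa> t * (norm (x' t - c'))\<^sup>2 \<partial>M)) \<and>
     integrable M (\<lambda>t. G t (y t))"
proof -
  define cost where "cost c t z = G t (snd z) + k * \<kappa> t * (norm (fst z - c))\<^sup>2" for c t and z :: "'a \<times> 'b"
  have fst_meas[measurable]: "fst \<in> borel_measurable (borel :: ('a \<times> 'b) measure)"
    by (intro borel_measurable_continuous_onI continuous_intros)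
  have snd_meas[measurable]: "snd \<in> borel_measurable (borel :: ('a \<times> 'b) measure)"
    by (intro borel_measurable_continuous_onI continuous_intros)
  have cost_meas[measurable]: "(\<lambda>p. cost c (fst p) (snd p)) \<in> borel_measurable (M \<Otimes>\<^sub>M borel)" for c
  proof -
    have "(\<lambda>p. (fst p, snd (snd p))) \<in> measurable (M \<Otimes>\<^sub>M (borel :: ('a \<times> 'b) measure)) (M \<Otimes>\<^sub>M borel)"
      by measurable
    from measurable_compose[OF this G_meas]
    have [measurable]:
        "(\<lambda>p. G (fst p) (snd (snd p))) \<in> borel_measurable (M \<Otimes>\<^sub>M (borel :: ('a \<times> 'b) measure))"
            by simp
    show ?thesis unfolding cost_def by measurable
  qed
  have cost_cont: "continuous_on UNIV (cost c t)" if "t \<in> space M" for c t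
    unfolding cost_def
    by (intro continuous_intros continuous_on_compose2[OF G_cont[OF that]]) auto
  \<comment> \<open>Confining the argument to the ball makes the sections of this graph
    compact.\<close>
  define S where
      "S = {p \<in> space (M \<Otimes>\<^sub>M borel). p \<in> {(t, z). t \<in> space M \<and> z \<in> gph (\<Phi> t)} \<and>
          norm (fst (snd p) - xbar) \<le> \<rho>}"
  have S_meas: "S \<in> sets (M \<Otimes>\<^sub>M borel)"
  proof -
    have [measurable]: "{(t, z). t \<in> space M \<and> z \<in> gph (\<Phi> t)} \<in> sets (M \<Otimes>\<^sub>M borel)"
      using normal by (simp add: normal_integrand_def)
    show ?thesis unfolding S_def by measurable
  qed
  have S_iff: "(t, z) \<in> S \<longleftrightarrow> t \<in> space M \<and> fst z \<in> cball xbar \<rho> \<and> snd z \<in> \<Phi> t (fst z)" for t z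
    unfolding S_def by (auto simp: space_pair_measure gph_def dist_norm norm_minus_commute)
  have S_sect: "AE t in M. compact {z. (t, z) \<in> S} \<and> {z. (t, z) \<in> S} \<noteq> {}"
    using bounded yb_sel AE_space
  proof eventually_elim
    case (elim t)
    have eq: "{z. (t, z) \<in> S} = gph (\<Phi> t) \<inter> (cball xbar \<rho> \<times> cball 0 (\<kappa> t))"
      using elim(1,3) unfolding S_iff by (fastforce simp: gph_def)
    have "compact {z. (t, z) \<in> S}" unfolding eq
      by (intro closed_Int_compact closed_gph elim(3) compact_Times compact_cball)
    moreover have "(t, (xbar, yb t)) \<in> S" unfolding S_iff using elim(2,3) \<rho>_pos by simp
    ultimately show ?case by blast
  qed
  have "\<forall>c. \<exists>f. f \<in> borel_measurable M \<and> (AE t in M. (t, f t) \<in> S \<and> (\<forall>z. (t, z) \<in> S \<longrightarrow>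
      cost c t (f t) \<le> cost c t z))"
    using measurable_argmin[OF finite_measure_axioms S_meas cost_meas S_sect cost_cont]
        by (auto simp: Bex_def)
  from choice[OF this] obtain Z where
    Z: "\<forall>c. Z c \<in> borel_measurable M \<and> (AE t in M. (t, Z c t) \<in> S \<and> (\<forall>z. (t, z) \<in> S \<longrightarrow>
        cost c t (Z c t) \<le> cost c t z))"
    by blast
  have Z_meas[measurable]: "Z c \<in> borel_measurable M" for c using Z by simp
  have Z_min: "AE t in M. (t, Z c t) \<in> S \<and> (\<forall>z. (t, z) \<in> S \<longrightarrow> cost c t (Z c t) \<le> cost c t z)" for c
      using Z by simp
  have adm_Z: "admissible (\<lambda>t. fst (Z c t)) (\<lambda>t. snd (Z c t))" for c
    unfolding admissible_def
  proof (intro conjI)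
    show "AE t in M. fst (Z c t) \<in> cball xbar \<rho> \<and> snd (Z c t) \<in> \<Phi> t (fst (Z c t))"
      using Z_min[of c] by eventually_elim (simp add: S_iff)
  qed measurable
  have int_G: "integrable M (\<lambda>t. G t (y t))" if a: "admissible x y" for x y
  proof (rule Bochner_Integration.integrable_bound)
    show "integrable M (\<lambda>t. B * \<kappa> t)" using \<kappa>_int by simp
    note [measurable] = admissible_meas[OF a]
    have "(\<lambda>t. (t, y t)) \<in> measurable M (M \<Otimes>\<^sub>M borel)" by measurable
    from measurable_compose[OF this G_meas] show "(\<lambda>t. G t (y t)) \<in> borel_measurable M" by simp
    show "AE t in M. norm (G t (y t)) \<le> norm (B * \<kappa> t)"
      using G_bd admissible_bound[OF a]
    proof eventually_elim
      case (elim t)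
      then have "\<bar>G t (y t)\<bar> \<le> B * \<kappa> t" by simp
      then show ?case by simp
    qed
  qed
  have int_pen: "integrable M (\<lambda>t. k * \<kappa> t * (norm (x t - c))\<^sup>2)"
    if a: "admissible x y" and c: "c \<in> cball xbar \<rho>" for x y c
    using integrable_mult_right[OF penalty_integrable[OF a c], of k] by (simp add: mult.assoc)
  have int_cost: "integrable M (\<lambda>t. cost c t (x t, y t))" if "admissible x y" "c \<in> cball xbar \<rho>" for x y c
    unfolding cost_def using int_G[OF that(1)] int_pen[OF that] by simp
  have int_costZ: "integrable M (\<lambda>t. cost c t (Z c' t))" if "c \<in> cball xbar \<rho>" for c c'
    using int_cost[OF adm_Z that, of c'] by simp
  \<comment> \<open>The optimal value of the inner problem at \<open>c\<close>. It turns out to be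
    Lipschitz, so its sum with \<open>\<phi>\<close> attains a minimum on the compact ball.\<close>
  define J where "J c = (\<integral>t. cost c t (Z c t) \<partial>M)" for c
  have J_le: "J c \<le> (\<integral>t. cost c t (x t, y t) \<partial>M)" if a: "admissible x y" and c: "c \<in> cball xbar \<rho>" for x y c
    unfolding J_def
  proof (rule integral_mono_AE)
    have "AE t in M. x t \<in> cball xbar \<rho> \<and> y t \<in> \<Phi> t (x t)" using a by (simp add: admissible_def)
    then show "AE t in M. cost c t (Z c t) \<le> cost c t (x t, y t)"
      using Z_min[of c] AE_space by eventually_elim (simp add: S_iff)
  qed (use int_costZ int_cost a c in auto)
  \<comment> \<open>Any two distances from a point \<open>u\<close> of the ball to \<open>c\<close>
    and \<open>c'\<close> add up to at most \<open>4 * \<rho>\<close>, so |u - c'|^2 - |u - c|^2 is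
    at most \<open>4 * \<rho>\<close> times the distance of \<open>c\<close> and
    \<open>c'\<close>.\<close>
  define C where "C = 4 * \<rho> * k * (\<integral>t. \<kappa> t \<partial>M)"
  have "0 \<le> (\<integral>t. \<kappa> t \<partial>M)" using \<kappa>_pos by (intro integral_nonneg_AE) (auto intro: less_imp_le)
  then have C0: "C \<ge> 0" unfolding C_def using \<rho>_pos k by (intro mult_nonneg_nonneg) auto
  have J_lip: "J c' \<le> J c + C * dist c c'" if c: "c \<in> cball xbar \<rho>" and c': "c' \<in> cball xbar \<rho>" for c c'
  proof -
    have "J c' \<le> (\<integral>t. cost c' t (Z c t) \<partial>M)" using J_le[OF adm_Z c', of c] by simp
    also have "\<dots> \<le> (\<integral>t. cost c t (Z c t) + (4 * \<rho> * k * dist c c') * \<kappa> t \<partial>M)"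
    proof (rule integral_mono_AE)
      show "AE t in M. cost c' t (Z c t) \<le> cost c t (Z c t) + (4 * \<rho> * k * dist c c') * \<kappa> t"
        using Z_min[of c]
      proof eventually_elim
        case (elim t)
        define u where "u = fst (Z c t)"
        have u: "dist xbar u \<le> \<rho>" using elim unfolding S_iff u_def by simp
        define p q where "p = norm (u - c')" and "q = norm (u - c)"
        have pq: "p \<le> q + dist c c'" unfolding p_def q_def dist_norm[symmetric] by (rule dist_triangle)
        have p: "p \<le> 2 * \<rho>" using dist_triangle3[of u c' xbar] u c' by (simp add: p_def dist_norm)
        have q: "q \<le> 2 * \<rho>" using dist_triangle3[of u c xbar] u c by (simp add: q_def dist_norm)
        have "p\<^sup>2 - q\<^sup>2 \<le> 4 * \<rho> * dist c c'"
        proof (cases "p \<le> q")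
          case True
          then have "p\<^sup>2 \<le> q\<^sup>2" by (intro power_mono) (auto simp: p_def)
          moreover have "0 \<le> 4 * \<rho> * dist c c'" using \<rho>_pos by simp
          ultimately show ?thesis by linarith
        next
          case False
          have "p\<^sup>2 - q\<^sup>2 = (p + q) * (p - q)" by (simp add: power2_eq_square algebra_simps)
          also have "\<dots> \<le> (4 * \<rho>) * dist c c'"
            using pq p q False \<rho>_pos by (intro mult_mono) (auto simp: p_def q_def)
          finally show ?thesis .
        qed
        then have "k * \<kappa> t * (p\<^sup>2 - q\<^sup>2) \<le> k * \<kappa> t * (4 * \<rho> * dist c c')" using k \<kappa>_pos[of t]
            by (intro mult_left_mono) auto
        then show ?case by (simp add: cost_def u_def[symmetric] p_def q_def algebra_simps)
      qed
    qed (use int_costZ c c' \<kappa>_int in auto)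
    also have "\<dots> = J c + C * dist c c'"
      using int_costZ[OF c] \<kappa>_int by (simp add: J_def C_def)
    finally show ?thesis .
  qed
  have \<delta>\<rho>: "cball xbar \<delta> \<subseteq> cball xbar \<rho>" using \<delta> by auto
  have "continuous_on (cball xbar \<rho>) J"
  proof (rule lipschitz_on_continuous_on[of C])
    show "C-lipschitz_on (cball xbar \<rho>) J"
    proof (rule lipschitz_onI)
      fix c c' assume c: "c \<in> cball xbar \<rho>" "c' \<in> cball xbar \<rho>"
      then show "dist (J c) (J c') \<le> C * dist c c'"
        using J_lip[OF c] J_lip[OF c(2,1)] by (simp add: dist_real_def dist_commute abs_le_iff)
    qed (rule C0)
  qed
  then have "continuous_on (cball xbar \<delta>) (\<lambda>c. \<phi> c + J c)"
    using \<delta>\<rho> \<phi> by (intro continuous_intros) (auto intro: continuous_on_subset)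
  from continuous_attains_inf[OF compact_cball _ this] \<delta>
  obtain c where c: "c \<in> cball xbar \<delta>" and c_min: "\<And>c'. c' \<in> cball xbar \<delta> \<Longrightarrow> \<phi> c + J c \<le> \<phi> c' + J c'"
    by auto
  show ?thesis
  proof (rule exI[of _ c], rule exI[of _ "\<lambda>t. fst (Z c t)"],
      rule exI[of _ "\<lambda>t. snd (Z c t)"], intro conjI allI impI)
    show "AE t in M. \<forall>u v. u \<in> cball xbar \<rho> \<longrightarrow> v \<in> \<Phi> t u \<longrightarrow>
        G t (snd (Z c t)) + k * \<kappa> t * (norm (fst (Z c t) - c))\<^sup>2 \<le> G t v + k * \<kappa> t * (norm (u - c))\<^sup>2"
      using Z_min[of c] AE_space
    proof eventually_elim
      case (elim t)
      show ?case
      proof (intro allI impI)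
        fix u v assume "u \<in> cball xbar \<rho>" "v \<in> \<Phi> t u"
        then have "(t, (u, v)) \<in> S" using elim(2) by (simp add: S_iff)
        then have "cost c t (Z c t) \<le> cost c t (u, v)" using elim(1) by blast
        then show "G t (snd (Z c t)) + k * \<kappa> t * (norm (fst (Z c t) - c))\<^sup>2
            \<le> G t v + k * \<kappa> t * (norm (u - c))\<^sup>2"
          by (simp add: cost_def)
      qed
    qed
    fix c' x' y' assume c': "c' \<in> cball xbar \<delta>" and a': "admissible x' y'"
    have "\<phi> c + J c \<le> \<phi> c' + J c'" by (rule c_min[OF c'])
    also have "J c' \<le> (\<integral>t. cost c' t (x' t, y' t) \<partial>M)" using c' \<delta>\<rho> by (intro J_le a') auto
    finally show "\<phi> c + (\<integral>t. G t (snd (Z c t)) + k * \<kappa> t * (norm (fst (Z c t) - c))\<^sup>2 \<partial>M)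
        \<le> \<phi> c' + (\<integral>t. G t (y' t) + k * \<kappa> t * (norm (x' t - c'))\<^sup>2 \<partial>M)"
      by (simp add: J_def cost_def)
  qed (use c adm_Z int_G[OF adm_Z] in auto)
qed

text \<open>Cauchy-Schwarz with weight \<open>\<kappa>\<close>: the integral of (|w| - s
  \<open>\<kappa>\<close>)^2 / \<open>\<kappa>\<close> is a nonnegative quadratic in s. It allows a
  penalty on the integral of a function to be replaced by an integrated penalty, which is
  decomposable.\<close>

lemma square_integral_le:
  assumes w: "w \<in> borel_measurable M" and bd: "AE t in M. norm (w t) \<le> 2 * \<kappa> t"
  shows "integrable M (\<lambda>t. norm (w t))" "integrable M (\<lambda>t. (norm (w t))\<^sup>2 / \<kappa> t)"
    and "(\<integral>t. norm (w t) \<partial>M)\<^sup>2 \<le> (\<integral>t. (norm (w t))\<^sup>2 / \<kappa> t \<partial>M) * (\<integral>t. \<kappa> t \<partial>M)"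
proof -
  note [measurable] = w
  show i1: "integrable M (\<lambda>t. norm (w t))"
    by (rule Bochner_Integration.integrable_bound[of M
        "\<lambda>t. 2 * \<kappa> t"]) (use \<kappa>_int bd in \<open>auto elim!: eventually_mono\<close>)
  show i2: "integrable M (\<lambda>t. (norm (w t))\<^sup>2 / \<kappa> t)"
  proof (rule Bochner_Integration.integrable_bound[of M "\<lambda>t. 4 * \<kappa> t"])
    show "AE t in M. norm ((norm (w t))\<^sup>2 / \<kappa> t) \<le> norm (4 * \<kappa> t)"
      using bd
    proof eventually_elim
      case (elim t)
      then have "(norm (w t))\<^sup>2 \<le> (2 * \<kappa> t)\<^sup>2" by (intro power_mono) auto
      then show ?case using \<kappa>_pos[of t] by (simp add: pos_divide_le_eq power2_eq_square)
    qed
  qed (use \<kappa>_int in auto)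
  let ?\<nu> = "\<integral>t. norm (w t) \<partial>M" and ?Q = "\<integral>t. (norm (w t))\<^sup>2 / \<kappa> t \<partial>M" and ?I = "\<integral>t. \<kappa> t \<partial>M"
  have ge: "0 \<le> ?Q - 2 * s * ?\<nu> + s\<^sup>2 * ?I" for s
  proof -
    have "0 \<le> (\<integral>t. (norm (w t))\<^sup>2 / \<kappa> t - 2 * s * norm (w t) + s\<^sup>2 * \<kappa> t \<partial>M)"
    proof (rule integral_nonneg_AE, intro AE_I2)
      fix t
      have "(norm (w t))\<^sup>2 / \<kappa> t - 2 * s * norm (w t) + s\<^sup>2 * \<kappa> t = (norm (w t) - s * \<kappa> t)\<^sup>2 / \<kappa> t"
        using \<kappa>_pos[of t] by (simp add: power2_eq_square field_simps)
      then show "0 \<le> (norm (w t))\<^sup>2 / \<kappa> t - 2 * s * norm (w t) + s\<^sup>2 * \<kappa> t" using \<kappa>_pos[of t] by simp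
    qed
    also have "\<dots> = ?Q - 2 * s * ?\<nu> + s\<^sup>2 * ?I" using i1 i2 \<kappa>_int by simp
    finally show ?thesis .
  qed
  show "?\<nu>\<^sup>2 \<le> ?Q * ?I"
  \<comment> \<open>For positive \<open>?I\<close> the quadratic is evaluated at its minimiser
    \<open>?\<nu> / ?I\<close>; otherwise both \<open>?I\<close> and \<open>?\<nu>\<close>
    vanish.\<close>
  proof (cases "?I > 0")
    case True
    have "?Q - 2 * (?\<nu> / ?I) * ?\<nu> + (?\<nu> / ?I)\<^sup>2 * ?I = ?Q - ?\<nu>\<^sup>2 / ?I"
      using True by (simp add: power2_eq_square field_simps)
    then have "?\<nu>\<^sup>2 / ?I \<le> ?Q" using ge[of "?\<nu> / ?I"] by simp
    then show ?thesis using True by (simp add: pos_divide_le_eq)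
  next
    case False
    have "?\<nu> \<le> (\<integral>t. 2 * \<kappa> t \<partial>M)" using i1 \<kappa>_int bd by (intro integral_mono_AE) auto
    then have 1: "?\<nu> \<le> 2 * ?I" by simp
    have 2: "0 \<le> ?I" using \<kappa>_pos by (intro integral_nonneg_AE) (auto intro: less_imp_le)
    have 3: "0 \<le> ?\<nu>" by (intro integral_nonneg_AE) auto
    have "?I = 0" "?\<nu> = 0" using 1 2 3 False by linarith+
    then show ?thesis by simp
  qed
qed

text \<open>
  The penalties are smooth so that the error in the optimality conditions is an explicit, hence
  measurable, function: the quasi-Lipschitz condition only applies to measurable \<open>y\<^sup>*\<close>.
\<close>

definition smoothed :: "'b \<Rightarrow> real \<Rightarrow> real \<Rightarrow> real \<Rightarrow> 't \<Rightarrow> 'b \<Rightarrow> real" where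
  "smoothed ys e K \<tau> t v = ys \<bullet> (v - yb t) + 2 * e * sqrt ((norm (v - yb t))\<^sup>2 + \<tau>\<^sup>2)
     + K / \<kappa> t * (norm (v - yb t))\<^sup>2"

lemma smoothed_meas: "(\<lambda>z. smoothed ys e K \<tau> (fst z) (snd z)) \<in> borel_measurable (M \<Otimes>\<^sub>M borel)"
  unfolding smoothed_def by measurable

lemma smoothed_cont: "continuous_on UNIV (smoothed ys e K \<tau> t)"
  unfolding smoothed_def by (intro continuous_intros)

lemma smoothed_bound:
  assumes "0 \<le> e" "0 \<le> K" "0 < \<tau>" "\<tau> \<le> 1"
  shows "AE t in M. \<forall>v. norm v \<le> \<kappa> t \<longrightarrow> \<bar>smoothed ys e K \<tau> t v\<bar> \<le> (2 * norm ys + 6 * e + 4 * K) * \<kappa> t"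
  using yb_bound
proof eventually_elim
  case (elim t)
  show ?case
  proof (intro allI impI)
    fix v :: 'b assume v: "norm v \<le> \<kappa> t"
    define r where "r = norm (v - yb t)"
    have r: "0 \<le> r" "r \<le> 2 * \<kappa> t" using norm_triangle_ineq4[of v "yb t"] v elim by (auto simp: r_def)
    have 1: "\<bar>ys \<bullet> (v - yb t)\<bar> \<le> norm ys * (2 * \<kappa> t)"
      using Cauchy_Schwarz_ineq2[of ys "v - yb t"] mult_left_mono[OF r(2), of "norm ys"]
          by (simp add: r_def)
    have "sqrt (r\<^sup>2 + \<tau>\<^sup>2) \<le> r + \<tau>" using r assms by (intro sqrt_sum_squares_le_sum) auto
    also have "\<dots> \<le> 3 * \<kappa> t" using r assms \<kappa>_ge1[of t] by simp
    finally have 2: "2 * e * sqrt (r\<^sup>2 + \<tau>\<^sup>2) \<le> 2 * e * (3 * \<kappa> t)" using assms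
        by (intro mult_left_mono) auto
    have "r\<^sup>2 \<le> (2 * \<kappa> t)\<^sup>2" using r by (intro power_mono) auto
    then have "K / \<kappa> t * r\<^sup>2 \<le> K / \<kappa> t * (2 * \<kappa> t)\<^sup>2" using assms \<kappa>_pos[of t] by (intro mult_left_mono) auto
    then have 3: "K / \<kappa> t * r\<^sup>2 \<le> 4 * K * \<kappa> t" using \<kappa>_pos[of t] by (simp add: power2_eq_square)
    have 4: "0 \<le> 2 * e * sqrt (r\<^sup>2 + \<tau>\<^sup>2)" "0 \<le> K / \<kappa> t * r\<^sup>2" using assms \<kappa>_pos[of t] by auto
    show "\<bar>smoothed ys e K \<tau> t v\<bar> \<le> (2 * norm ys + 6 * e + 4 * K) * \<kappa> t"
      unfolding smoothed_def r_def[symmetric] using 1 2 3 4 by (simp add: algebra_simps abs_le_iff)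
  qed
qed

text \<open>One index drives both limits: the smoothing parameter is 1 / (n + 1) and the weight of
  the penalty is n + 1.\<close>

definition relaxed :: "'b \<Rightarrow> real \<Rightarrow> real \<Rightarrow> nat \<Rightarrow> 'a \<Rightarrow> 't \<Rightarrow> 'a \<Rightarrow> 'b \<Rightarrow> real" where
  "relaxed ys e K n c t u v =
     smoothed ys e K (inverse (real (Suc n))) t v + real (Suc n) * \<kappa> t * (norm (u - c))\<^sup>2"

text \<open>The slope \<open>2 * e\<close>, both here and in \<open>smoothed\<close>, is twice what
  the normality inequality consumes. The surplus \<open>e\<close> is what forces \<open>c\<close>
  towards \<open>xbar\<close> and \<open>y\<close> towards \<open>yb\<close>.\<close>

definition penalised_min where
  "penalised_min xs ys e K \<delta> n c x y \<longleftrightarrow> c \<in> cball xbar \<delta> \<and> admissible x y \<and>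
     (AE t in M. \<forall>u v. u \<in> cball xbar \<rho> \<longrightarrow> v \<in> \<Phi> t u \<longrightarrow>
        relaxed ys e K n c t (x t) (y t) \<le> relaxed ys e K n c t u v) \<and>
     (\<forall>c' x' y'. c' \<in> cball xbar \<delta> \<longrightarrow> admissible x' y' \<longrightarrow>
        (2 * e * norm (c - xbar) - xs \<bullet> (c - xbar)) + (\<integral>t. relaxed ys e K n c t (x t) (y t) \<partial>M)
        \<le> (2 * e * norm (c' - xbar) - xs \<bullet> (c' - xbar)) + (\<integral>t. relaxed ys e K n c' t (x' t) (y' t) \<partial>M)) \<and>
     integrable M (\<lambda>t. smoothed ys e K (inverse (real (Suc n))) t (y t))"

lemma penalised_min_exists:
  assumes "0 \<le> e" "0 \<le> K" "0 < \<delta>" "\<delta> \<le> \<rho>"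
  shows "\<exists>c x y. penalised_min xs ys e K \<delta> n c x y"
  unfolding penalised_min_def relaxed_def
proof (rule penalised_minimiser[where B = "2 * norm ys + 6 * e + 4 * K"])
  show "AE t in M. \<forall>v. norm v \<le> \<kappa> t \<longrightarrow> \<bar>smoothed ys e K (inverse (real (Suc n))) t v\<bar>
      \<le> (2 * norm ys + 6 * e + 4 * K) * \<kappa> t"
    using assms by (intro smoothed_bound) (auto simp: inverse_le_1_iff)
  show "continuous_on UNIV (\<lambda>c. 2 * e * norm (c - xbar) - xs \<bullet> (c - xbar))" by (intro continuous_intros)
qed (use assms smoothed_meas smoothed_cont in auto)

lemma penalised_minD:
  assumes "penalised_min xs ys e K \<delta> n c x y"
  shows "c \<in> cball xbar \<delta>" "admissible x y"
    "AE t in M. \<forall>u v. u \<in> cball xbar \<rho> \<longrightarrow> v \<in> \<Phi> t u \<longrightarrow>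
        relaxed ys e K n c t (x t) (y t) \<le> relaxed ys e K n c t u v"
    "\<And>c' x' y'. c' \<in> cball xbar \<delta> \<Longrightarrow> admissible x' y' \<Longrightarrow>
        (2 * e * norm (c - xbar) - xs \<bullet> (c - xbar)) + (\<integral>t. relaxed ys e K n c t (x t) (y t) \<partial>M)
        \<le> (2 * e * norm (c' - xbar) - xs \<bullet> (c' - xbar)) + (\<integral>t. relaxed ys e K n c' t (x' t) (y' t) \<partial>M)"
    "integrable M (\<lambda>t. smoothed ys e K (inverse (real (Suc n))) t (y t))"
  using assms unfolding penalised_min_def by simp_all

section \<open>Estimates and optimality conditions for the penalised minimisers\<close>

lemma deviation_bound:
  assumes "admissible x y"
  shows "AE t in M. norm (y t - yb t) \<le> 2 * \<kappa> t"
  using admissible_bound[OF assms] yb_bound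
proof eventually_elim
  case (elim t)
  then show ?case using norm_triangle_ineq4[of "y t" "yb t"] by simp
qed

text \<open>Comparison with the constant \<open>xbar\<close> and \<open>yb\<close>, whose only cost
  is that of smoothing a zero norm. The parameter is \<open>K\<close> times the integral of
  \<open>\<kappa>\<close> because Cauchy-Schwarz then returns \<open>K\<close> times the squared
  norm of the difference of the integrals.\<close>

lemma penalised_min_estimate:
  assumes P: "penalised_min xs ys e (K * (\<integral>t. \<kappa> t \<partial>M)) \<delta> n c x y"
    and e: "0 \<le> e" and K: "0 \<le> K" and \<delta>: "0 < \<delta>" "\<delta> \<le> \<rho>"
  shows "(2 * e * norm (c - xbar) - xs \<bullet> (c - xbar)) + ys \<bullet> ((\<integral>t. y t \<partial>M) - (\<integral>t. yb t \<partial>M))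
      + e * norm ((\<integral>t. y t \<partial>M) - (\<integral>t. yb t \<partial>M)) + K * (norm ((\<integral>t. y t \<partial>M) - (\<integral>t. yb t \<partial>M)))\<^sup>2
      + e * (\<integral>t. norm (y t - yb t) \<partial>M) + real (Suc n) * (\<integral>t. \<kappa> t * (norm (x t - c))\<^sup>2 \<partial>M)
    \<le> 2 * e * inverse (real (Suc n)) * measure M (space M)"
proof -
  let ?\<tau> = "inverse (real (Suc n))" and ?I = "\<integral>t. \<kappa> t \<partial>M"
  note PD = penalised_minD[OF P, unfolded relaxed_def]
  note [measurable] = admissible_meas[OF PD(2)]
  have c: "c \<in> cball xbar \<rho>" using PD(1) \<delta> by auto
  note int_pen = penalty_integrable[OF PD(2) c]
  have int_y: "integrable M y" by (rule admissible_integrable[OF PD(2)])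
  have w_meas: "(\<lambda>t. y t - yb t) \<in> borel_measurable M" by measurable
  note sq = square_integral_le[OF w_meas deviation_bound[OF PD(2)]]
  have I0: "0 \<le> ?I" using \<kappa>_pos by (intro integral_nonneg_AE) (auto intro: less_imp_le)
  define \<nu> where "\<nu> = (\<integral>t. norm (y t - yb t) \<partial>M)"
  define Q where "Q = (\<integral>t. (norm (y t - yb t))\<^sup>2 / \<kappa> t \<partial>M)"
  define s where "s = (\<integral>t. y t \<partial>M) - (\<integral>t. yb t \<partial>M)"
  define D where "D = (\<integral>t. \<kappa> t * (norm (x t - c))\<^sup>2 \<partial>M)"
  have s: "s = (\<integral>t. y t - yb t \<partial>M)" unfolding s_def using int_y yb_int by simp
  have s\<nu>: "norm s \<le> \<nu>" unfolding s \<nu>_def by (rule integral_norm_bound)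
  have "ys \<bullet> s + 2 * e * \<nu> + K * ?I * Q + real (Suc n) * D
     = (\<integral>t. ys \<bullet> (y t - yb t) + 2 * e * norm (y t - yb t) + K * ?I * ((norm (y t - yb t))\<^sup>2 / \<kappa> t)
        + real (Suc n) * (\<kappa> t * (norm (x t - c))\<^sup>2) \<partial>M)"
  proof -
    have lin: "(\<integral>t. a t + r1 * b t + r2 * q t + r3 * d t \<partial>M)
        = (\<integral>t. a t \<partial>M) + r1 * (\<integral>t. b t \<partial>M) + r2 * (\<integral>t. q t \<partial>M) + r3 * (\<integral>t. d t \<partial>M)"
      if "integrable M a" "integrable M b" "integrable M q" "integrable M d"
          for a b q d :: "'t \<Rightarrow> real" and r1 r2 r3 :: real
      using that by simp
    have int_w: "integrable M (\<lambda>t. y t - yb t)" using int_y yb_int by simp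
    have "ys \<bullet> s = (\<integral>t. ys \<bullet> (y t - yb t) \<partial>M)" unfolding s
        by (rule integral_inner_right[symmetric]) (rule int_w)
    then show ?thesis
      unfolding \<nu>_def Q_def D_def
      by (subst lin[OF integrable_inner_right[OF int_w] sq(1,2) int_pen]) simp
  qed
  also have "\<dots> \<le> (\<integral>t. smoothed ys e (K * ?I) ?\<tau> t (y t) + real (Suc n) * \<kappa> t * (norm (x t - c))\<^sup>2 \<partial>M)"
  proof (rule integral_mono_AE)
    show "integrable M (\<lambda>t. ys \<bullet> (y t - yb t) + 2 * e * norm (y t - yb t) + K * ?I * ((norm (y t
        - yb t))\<^sup>2 / \<kappa> t)
        + real (Suc n) * (\<kappa> t * (norm (x t - c))\<^sup>2))"
      using sq(1,2) int_pen int_y yb_int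
          by (intro Bochner_Integration.integrable_add integrable_mult_right integrable_inner_right
              Bochner_Integration.integrable_diff)
    have "integrable M (\<lambda>t. real (Suc n) * (\<kappa> t * (norm (x t - c))\<^sup>2))" using int_pen
        by (rule integrable_mult_right)
    then show "integrable M (\<lambda>t. smoothed ys e (K * ?I) ?\<tau> t (y t) + real (Suc n) * \<kappa> t * (norm (x t
        - c))\<^sup>2)"
      using PD(5) by (simp add: mult.assoc)
    show "AE t in M. ys \<bullet> (y t - yb t) + 2 * e * norm (y t - yb t) + K * ?I * ((norm (y t - yb t))\<^sup>2 / \<kappa> t)
        + real (Suc n) * (\<kappa> t * (norm (x t - c))\<^sup>2) \<le> smoothed ys e (K * ?I) ?\<tau> t (y t) + real (Suc
            n) * \<kappa> t * (norm (x t - c))\<^sup>2"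
    proof (rule AE_I2)
      fix t
      have "norm (y t - yb t) \<le> sqrt ((norm (y t - yb t))\<^sup>2 + ?\<tau>\<^sup>2)" by (rule real_le_rsqrt) simp
      then have "2 * e * norm (y t - yb t) \<le> 2 * e * sqrt ((norm (y t - yb t))\<^sup>2 + ?\<tau>\<^sup>2)"
        using e by (intro mult_left_mono) auto
      then show "ys \<bullet> (y t - yb t) + 2 * e * norm (y t - yb t) + K * ?I * ((norm (y t - yb t))\<^sup>2 / \<kappa> t)
        + real (Suc n) * (\<kappa> t * (norm (x t - c))\<^sup>2) \<le> smoothed ys e (K * ?I) ?\<tau> t (y t) + real (Suc
            n) * \<kappa> t * (norm (x t - c))\<^sup>2"
        unfolding smoothed_def by (simp add: mult.assoc)
    qed
  qed
  finally have 1: "ys \<bullet> s + 2 * e * \<nu> + K * ?I * Q + real (Suc n) * D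
    \<le> (\<integral>t. smoothed ys e (K * ?I) ?\<tau> t (y t) + real (Suc n) * \<kappa> t * (norm (x t - c))\<^sup>2 \<partial>M)" .
  have "xbar \<in> cball xbar \<delta>" using \<delta> by simp
  from PD(4)[OF this admissible_base]
  have 2: "(2 * e * norm (c - xbar) - xs \<bullet> (c - xbar)) + (\<integral>t. smoothed ys e (K * ?I) ?\<tau> t (y t)
      + real (Suc n) * \<kappa> t * (norm (x t - c))\<^sup>2 \<partial>M)
    \<le> 2 * e * ?\<tau> * measure M (space M)"
    by (simp add: smoothed_def mult_ac)
  have "K * (norm s)\<^sup>2 \<le> K * \<nu>\<^sup>2" using s\<nu> K by (intro mult_left_mono power_mono) auto
  also have "\<dots> \<le> K * (Q * ?I)" using sq(3) K by (intro mult_left_mono) (auto simp: \<nu>_def Q_def)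
  finally have 3: "K * (norm s)\<^sup>2 \<le> K * ?I * Q" by (simp add: mult_ac)
  \<comment> \<open>Half of \<open>2 * e * \<nu>\<close> pays for the norm of \<open>s\<close>; the
    other half stays in the estimate.\<close>
  have 4: "e * norm s \<le> e * \<nu>" using s\<nu> e by (intro mult_left_mono)
  show ?thesis using 1 2 3 4 unfolding \<nu>_def[symmetric] s_def[symmetric] D_def[symmetric] by linarith
qed

text \<open>Pointwise comparison with \<open>(xbar, yb t)\<close>: the linear term can gain at most
  \<open>2 * norm ys * \<kappa> t\<close>. The penalty carries the same factor
  \<open>\<kappa> t\<close>, which cancels and leaves a bound uniform in \<open>t\<close>.\<close>

lemma penalised_min_uniform:
  assumes P: "penalised_min xs ys e K \<delta> n c x y" and e: "0 \<le> e" and K: "0 \<le> K"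
  shows "AE t in M. (norm (x t - c))\<^sup>2 \<le> (norm (xbar - c))\<^sup>2 + 2 * norm ys * inverse (real (Suc n))"
  using penalised_minD(3)[OF P, unfolded relaxed_def] deviation_bound[OF penalised_minD(2)[OF P]] yb_sel
proof eventually_elim
  case (elim t)
  let ?\<tau> = "inverse (real (Suc n))"
  have min: "smoothed ys e K ?\<tau> t (y t) + real (Suc n) * \<kappa> t * (norm (x t - c))\<^sup>2
        \<le> smoothed ys e K ?\<tau> t (yb t) + real (Suc n) * \<kappa> t * (norm (xbar - c))\<^sup>2"
    using elim(1,3) xbar_mem by blast
  have base: "smoothed ys e K ?\<tau> t (yb t) = 2 * e * ?\<tau>" by (simp add: smoothed_def)
  have "?\<tau> \<le> sqrt ((norm (y t - yb t))\<^sup>2 + ?\<tau>\<^sup>2)" by (rule real_le_rsqrt) simp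
  then have "2 * e * ?\<tau> \<le> 2 * e * sqrt ((norm (y t - yb t))\<^sup>2 + ?\<tau>\<^sup>2)" using e
      by (intro mult_left_mono) auto
  moreover have "0 \<le> K / \<kappa> t * (norm (y t - yb t))\<^sup>2" using K \<kappa>_pos[of t] by simp
  moreover have "- (norm ys * norm (y t - yb t)) \<le> ys \<bullet> (y t - yb t)"
    using Cauchy_Schwarz_ineq2[of ys "y t - yb t"] by linarith
  moreover have "norm ys * norm (y t - yb t) \<le> norm ys * (2 * \<kappa> t)" using elim(2)
      by (intro mult_left_mono) auto
  ultimately have "2 * e * ?\<tau> - norm ys * (2 * \<kappa> t) \<le> smoothed ys e K ?\<tau> t (y t)"
      unfolding smoothed_def by linarith
  then have "real (Suc n) * \<kappa> t * (norm (x t - c))\<^sup>2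
      \<le> real (Suc n) * \<kappa> t * (norm (xbar - c))\<^sup>2 + norm ys * (2 * \<kappa> t)"
    using min base by linarith
  also have "\<dots> = real (Suc n) * \<kappa> t * ((norm (xbar - c))\<^sup>2 + 2 * norm ys * ?\<tau>)"
    by (simp add: field_simps del: of_nat_Suc)
  finally show ?case using \<kappa>_pos[of t] by (subst (asm) mult_le_cancel_left_pos) auto
qed

text \<open>Only \<open>c\<close> is varied, with \<open>x\<close> and \<open>y\<close> frozen. The
  integrated penalty is an exact quadratic in \<open>c\<close>, its gradient is the integral in the
  conclusion, and the remaining nonsmooth term has slope \<open>2 * e\<close>. The strict inequality
  for \<open>c\<close> makes all small variations admissible.\<close>

lemma penalised_min_stationary:
  assumes P: "penalised_min xs ys e K \<delta> n c x y" and e: "0 \<le> e"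
    and \<delta>: "0 < \<delta>" "\<delta> \<le> \<rho>" and c: "norm (c - xbar) < \<delta>"
  shows "integrable M (\<lambda>t. (- 2 * (real (Suc n) * \<kappa> t)) *\<^sub>R (x t - c))"
    and "norm (xs - (\<integral>t. (- 2 * (real (Suc n) * \<kappa> t)) *\<^sub>R (x t - c) \<partial>M)) \<le> 2 * e"
proof -
  let ?\<tau> = "inverse (real (Suc n))" and ?k = "real (Suc n)" and ?I = "\<integral>t. \<kappa> t \<partial>M"
  let ?p = "\<lambda>t. (- 2 * (?k * \<kappa> t)) *\<^sub>R (x t - c)"
  note PD = penalised_minD[OF P, unfolded relaxed_def]
  note [measurable] = admissible_meas[OF PD(2)]
  have c\<rho>: "c \<in> cball xbar \<rho>" using PD(1) \<delta> by auto
  have bd: "AE t in M. norm (x t - c) \<le> 2 * \<rho>"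
  proof -
    have "AE t in M. x t \<in> cball xbar \<rho> \<and> y t \<in> \<Phi> t (x t)" using PD(2) by (simp add: admissible_def)
    then show ?thesis
    proof eventually_elim
      case (elim t)
      have "dist (x t) c \<le> dist xbar (x t) + dist xbar c" by (rule dist_triangle3)
      then show ?case using elim c\<rho> by (simp add: dist_norm)
    qed
  qed
  show int_p: "integrable M ?p"
  proof (rule Bochner_Integration.integrable_bound)
    show "integrable M (\<lambda>t. (4 * ?k * \<rho>) * \<kappa> t)" using \<kappa>_int by simp
    show "?p \<in> borel_measurable M" by measurable
    show "AE t in M. norm (?p t) \<le> norm ((4 * ?k * \<rho>) * \<kappa> t)"
      using bd
    proof eventually_elim
      case (elim t)
      have "2 * (?k * \<kappa> t) * norm (x t - c) \<le> 2 * (?k * \<kappa> t) * (2 * \<rho>)"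
        using elim \<kappa>_pos[of t] by (intro mult_left_mono) auto
      then show ?case using \<kappa>_pos[of t] \<rho>_pos by (simp add: abs_mult mult_ac del: of_nat_Suc)
    qed
  qed
  show "norm (xs - (\<integral>t. ?p t \<partial>M)) \<le> 2 * e"
  proof (rule norm_le_of_linear_growth)
    show "0 < \<delta> - norm (c - xbar)" using c by simp
    show "0 \<le> 2 * e" using e by simp
    fix h :: 'a assume h: "norm h < \<delta> - norm (c - xbar)"
    have "norm (c + h - xbar) \<le> norm (c - xbar) + norm h"
      using norm_triangle_ineq[of "c - xbar" h] by (simp add: algebra_simps)
    then have ch: "c + h \<in> cball xbar \<delta>" using h by (simp add: dist_norm norm_minus_commute)
    then have ch\<rho>: "c + h \<in> cball xbar \<rho>" using \<delta> by auto
    let ?S = "\<integral>t. smoothed ys e K ?\<tau> t (y t) \<partial>M"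
    have tot: "(\<integral>t. smoothed ys e K ?\<tau> t (y t) + ?k * \<kappa> t * (norm (x t - c'))\<^sup>2 \<partial>M)
        = ?S + ?k * (\<integral>t. \<kappa> t * (norm (x t - c'))\<^sup>2 \<partial>M)" if c': "c' \<in> cball xbar \<rho>" for c'
      using PD(5) penalty_integrable[OF PD(2) c'] by (simp add: mult.assoc)
    have "?k * (\<integral>t. \<kappa> t * (norm (x t - (c + h)))\<^sup>2 \<partial>M) - ?k * (\<integral>t. \<kappa> t * (norm (x t - c))\<^sup>2 \<partial>M)
        = (\<integral>t. ?k * (\<kappa> t * (norm (x t - (c + h)))\<^sup>2) - ?k * (\<kappa> t * (norm (x t - c))\<^sup>2) \<partial>M)"
      using penalty_integrable[OF PD(2) ch\<rho>] penalty_integrable[OF PD(2) c\<rho>] by simp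
    also have "\<dots> = (\<integral>t. ?p t \<bullet> h + ?k * (norm h)\<^sup>2 * \<kappa> t \<partial>M)"
    proof (rule Bochner_Integration.integral_cong[OF refl])
      fix t
      have *: "(norm (x t - (c + h)))\<^sup>2 = (norm (x t - c))\<^sup>2 - 2 * ((x t - c) \<bullet> h) + (norm h)\<^sup>2"
        unfolding power2_norm_eq_inner
            by (simp add: inner_diff_left inner_diff_right inner_add_left inner_add_right
                inner_commute)
      then show "?k * (\<kappa> t * (norm (x t - (c + h)))\<^sup>2) - ?k * (\<kappa> t * (norm (x t - c))\<^sup>2)
          = ?p t \<bullet> h + ?k * (norm h)\<^sup>2 * \<kappa> t"
        unfolding * by (simp add: algebra_simps del: of_nat_Suc)
    qed
    also have "\<dots> = (\<integral>t. ?p t \<partial>M) \<bullet> h + ?k * (norm h)\<^sup>2 * ?I"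
    proof -
      have "(\<integral>t. ?p t \<bullet> h + ?k * (norm h)\<^sup>2 * \<kappa> t \<partial>M) = (\<integral>t. ?p t \<bullet> h \<partial>M) + (\<integral>t. ?k * (norm h)\<^sup>2 * \<kappa> t \<partial>M)"
        by (intro Bochner_Integration.integral_add integrable_inner_left integrable_mult_right int_p \<kappa>_int)
      then show ?thesis by (simp only: integral_inner_left[OF int_p] integral_mult_right_zero)
    qed
    finally have diff:
        "?k * (\<integral>t. \<kappa> t * (norm (x t - (c + h)))\<^sup>2 \<partial>M) - ?k * (\<integral>t. \<kappa> t * (norm (x t - c))\<^sup>2 \<partial>M)
        = (\<integral>t. ?p t \<partial>M) \<bullet> h + ?k * (norm h)\<^sup>2 * ?I" .
    have "(2 * e * norm (c - xbar) - xs \<bullet> (c - xbar)) + (?S + ?k * (\<integral>t. \<kappa> t * (norm (x t - c))\<^sup>2 \<partial>M))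
        \<le> (2 * e * norm (c + h - xbar) - xs \<bullet> (c + h - xbar)) + (?S + ?k * (\<integral>t. \<kappa> t * (norm (x t -
            (c + h)))\<^sup>2 \<partial>M))"
      using PD(4)[OF ch PD(2)] unfolding tot[OF c\<rho>] tot[OF ch\<rho>] .
    moreover have "2 * e * norm (c + h - xbar) \<le> 2 * e * norm (c - xbar) + 2 * e * norm h"
      using \<open>norm (c + h - xbar) \<le> norm (c - xbar) + norm h\<close> e
      unfolding distrib_left[symmetric] by (intro mult_left_mono) auto
    moreover have "xs \<bullet> (c + h - xbar) = xs \<bullet> (c - xbar) + xs \<bullet> h"
        by (simp add: inner_diff_right inner_add_right)
    ultimately have "xs \<bullet> h \<le> 2 * e * norm h + ((\<integral>t. ?p t \<partial>M) \<bullet> h + ?k * (norm h)\<^sup>2 * ?I)"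
      using diff by linarith
    then show "(xs - (\<integral>t. ?p t \<partial>M)) \<bullet> h \<le> 2 * e * norm h + (?k * ?I) * (norm h)\<^sup>2"
      by (simp add: inner_diff_left mult_ac)
  qed
qed

lemma penalised_min_fermat:
  assumes P: "penalised_min xs ys e K \<delta> n c x y" and e: "0 \<le> e" and K: "0 \<le> K"
  shows "AE t in M. norm (x t - xbar) < \<rho> \<longrightarrow>
    (- 2 * (real (Suc n) * \<kappa> t)) *\<^sub>R (x t - c) \<in> regular_coderivative (\<Phi> t) (x t) (y t)
      (ys + ((2 * e / sqrt ((norm (y t - yb t))\<^sup>2 + (inverse (real (Suc n)))\<^sup>2)) *\<^sub>R (y t - yb t) +
          (2 * (K / \<kappa> t)) *\<^sub>R (y t - yb t)))"
proof -
  have "AE t in M. x t \<in> cball xbar \<rho> \<and> y t \<in> \<Phi> t (x t)"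
    using penalised_minD(2)[OF P] by (simp add: admissible_def)
  then show ?thesis
    using penalised_minD(3)[OF P, unfolded relaxed_def]
  proof eventually_elim
    case (elim t)
    show ?case
    proof
      assume x: "norm (x t - xbar) < \<rho>"
      show "(- 2 * (real (Suc n) * \<kappa> t)) *\<^sub>R (x t - c) \<in> regular_coderivative (\<Phi> t) (x t) (y t)
      (ys + ((2 * e / sqrt ((norm (y t - yb t))\<^sup>2 + (inverse (real (Suc n)))\<^sup>2)) *\<^sub>R (y t - yb t) +
          (2 * (K / \<kappa> t)) *\<^sub>R (y t - yb t)))"
      proof (rule penalised_fermat[OF _ x])
        show "y t \<in> \<Phi> t (x t)" using elim(1) by simp
        show "0 \<le> real (Suc n) * \<kappa> t" "0 \<le> K / \<kappa> t" using \<kappa>_pos[of t] K by auto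
        fix u v assume "u \<in> cball xbar \<rho>" "v \<in> \<Phi> t u"
        then show "ys \<bullet> (y t - yb t) + 2 * e * sqrt ((norm (y t - yb t))\<^sup>2 + (inverse (real (Suc n)))\<^sup>2)
           + K / \<kappa> t * (norm (y t - yb t))\<^sup>2 + real (Suc n) * \<kappa> t * (norm (x t - c))\<^sup>2
          \<le> ys \<bullet> (v - yb t) + 2 * e * sqrt ((norm (v - yb t))\<^sup>2 + (inverse (real (Suc n)))\<^sup>2)
           + K / \<kappa> t * (norm (v - yb t))\<^sup>2 + real (Suc n) * \<kappa> t * (norm (u - c))\<^sup>2"
          using elim(2)[rule_format, of u v] by (simp only: smoothed_def)
      qed (use e in auto)
    qed
  qed
qed

text \<open>A limit \<open>(c0, s0)\<close> of the parameters and integrals lies on the graph of the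
  expected map by \<open>expected_map_closed\<close>. There normality bounds \<open>A\<close> below
  by e |c0 - xbar|, while minimality bounds it above by 0. Hence \<open>c0 = xbar\<close>, and since
  \<open>A\<close> vanishes in the limit, nothing is left for the L1 distance
  \<open>\<nu>\<close>.\<close>

lemma penalised_min_converges:
  assumes P: "\<And>n. penalised_min xs ys e (K * (\<integral>t. \<kappa> t \<partial>M)) \<delta> n (c n) (x n) (y n)"
    and e: "0 < e" and K: "0 \<le> K" and \<delta>: "0 < \<delta>" "\<delta> \<le> \<rho>"
    and normal_ineq: "\<And>c s. c \<in> cball xbar \<delta> \<Longrightarrow> s \<in> expected_map M \<Phi> c \<Longrightarrow>
      xs \<bullet> (c - xbar) - ys \<bullet> (s - (\<integral>t. yb t \<partial>M))
      \<le> e * (norm (c - xbar) + norm (s - (\<integral>t. yb t \<partial>M))) + K * (norm (s - (\<integral>t. yb t \<partial>M)))\<^sup>2"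
  shows "\<exists>r. strict_mono r \<and> (\<lambda>k. c (r k)) \<longlonglongrightarrow> xbar \<and> (\<lambda>k. \<integral>t. norm (y (r k) t - yb t) \<partial>M) \<longlonglongrightarrow> 0"
proof -
  define ybar where "ybar = (\<integral>t. yb t \<partial>M)"
  define s where "s n = (\<integral>t. y n t \<partial>M)" for n
  define \<nu> where "\<nu> n = (\<integral>t. norm (y n t - yb t) \<partial>M)" for n
  define D where "D n = (\<integral>t. \<kappa> t * (norm (x n t - c n))\<^sup>2 \<partial>M)" for n
  define A where
      "A c s = (2 * e * norm (c - xbar) - xs \<bullet> (c - xbar)) + ys \<bullet> (s - ybar) + e * norm (s - ybar)
          + K * (norm (s - ybar))\<^sup>2" for c s
  define \<mu> where "\<mu> = 2 * e * measure M (space M)"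
  define I where "I = (\<integral>t. \<kappa> t \<partial>M)"
  have est: "A (c n) (s n) + e * \<nu> n + real (Suc n) * D n \<le> \<mu> * inverse (real (Suc n))" for n
    using penalised_min_estimate[OF P[of n] less_imp_le[OF e] K \<delta>]
    unfolding A_def s_def \<nu>_def D_def ybar_def \<mu>_def by (simp only: mult_ac)
  have adm: "admissible (x n) (y n)" for n by (rule penalised_minD(2)[OF P])
  have cb: "c n \<in> cball xbar \<delta>" for n by (rule penalised_minD(1)[OF P])
  have \<nu>0: "0 \<le> \<nu> n" for n unfolding \<nu>_def by (intro integral_nonneg_AE) auto
  have D0: "0 \<le> D n" for n unfolding D_def using \<kappa>_pos
    by (intro integral_nonneg_AE AE_I2 mult_nonneg_nonneg) (auto intro: less_imp_le)
  have s_bd: "norm (s n) \<le> I" for n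
    unfolding s_def I_def
    by (rule order_trans[OF integral_norm_bound integral_mono_AE])
      (intro integrable_norm admissible_integrable[OF adm] \<kappa>_int admissible_bound[OF adm])+
  have ybar_bd: "norm ybar \<le> I"
    unfolding ybar_def I_def
    by (rule order_trans[OF integral_norm_bound integral_mono_AE])
      (intro integrable_norm yb_int \<kappa>_int yb_bound)+
  \<comment> \<open>A lower bound independent of \<open>n\<close>: it makes the penalty
    \<open>D n\<close> of order 1 / (n + 1), so that the functions \<open>x n\<close> approach
    constants.\<close>
  have A_ge: "- (norm xs * \<delta> + norm ys * (2 * I)) \<le> A (c n) (s n)" for n
  proof -
    have "\<bar>xs \<bullet> (c n - xbar)\<bar> \<le> norm xs * norm (c n - xbar)" by (rule Cauchy_Schwarz_ineq2)
    also have "\<dots> \<le> norm xs * \<delta>" using cb[of n]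
        by (intro mult_left_mono) (auto simp: dist_norm norm_minus_commute)
    finally have 1: "xs \<bullet> (c n - xbar) \<le> norm xs * \<delta>" by simp
    have "\<bar>ys \<bullet> (s n - ybar)\<bar> \<le> norm ys * norm (s n - ybar)" by (rule Cauchy_Schwarz_ineq2)
    also have "\<dots> \<le> norm ys * (2 * I)"
      using norm_triangle_ineq4[of "s n" ybar] s_bd[of n] ybar_bd by (intro mult_left_mono) auto
    finally have 2: "- (norm ys * (2 * I)) \<le> ys \<bullet> (s n - ybar)" by linarith
    have 3: "0 \<le> 2 * e * norm (c n - xbar)" "0 \<le> e * norm (s n - ybar)"
        "0 \<le> K * (norm (s n - ybar))\<^sup>2" using e K by auto
    show ?thesis unfolding A_def using 1 2 3 by linarith
  qed
  have \<tau>_lim: "(\<lambda>n. inverse (real (Suc n))) \<longlonglongrightarrow> 0" by (rule LIMSEQ_inverse_real_of_nat)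
  have D_lim: "D \<longlonglongrightarrow> 0"
  proof (rule tendsto_sandwich[OF _ _ tendsto_const])
    let ?C = "\<mu> + (norm xs * \<delta> + norm ys * (2 * I))"
    have "D n \<le> ?C * inverse (real (Suc n))" for n
    proof -
      have \<mu>0: "0 \<le> \<mu>" using e by (simp add: \<mu>_def)
      have "\<mu> * inverse (real (Suc n)) \<le> \<mu> * 1" using \<mu>0
          by (intro mult_left_mono) (auto simp: inverse_le_1_iff)
      moreover have "0 \<le> e * \<nu> n" using e \<nu>0 by simp
      ultimately have "real (Suc n) * D n \<le> ?C" using est[of n] A_ge[of n] by linarith
      then show ?thesis by (simp add: field_simps del: of_nat_Suc)
    qed
    then show "eventually (\<lambda>n. D n \<le> ?C * inverse (real (Suc n))) sequentially"
        by (intro always_eventually) blast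
    show "(\<lambda>n. ?C * inverse (real (Suc n))) \<longlonglongrightarrow> 0" using tendsto_mult_right_zero[OF \<tau>_lim] .
  qed (use D0 in \<open>auto intro!: always_eventually\<close>)
  have "bounded (range (\<lambda>n. (c n, s n)))"
  proof (rule bounded_subset)
    show "bounded (cball xbar \<delta> \<times> cball 0 I)" by (intro bounded_Times bounded_cball)
    show "range (\<lambda>n. (c n, s n)) \<subseteq> cball xbar \<delta> \<times> cball 0 I" using cb s_bd by auto
  qed
  from bounded_imp_convergent_subsequence[OF this]
  obtain cs0 r1 where r1: "strict_mono r1" and lim1: "((\<lambda>n. (c n, s n)) \<circ> r1) \<longlonglongrightarrow> cs0" by auto
  obtain c0 s0 where cs0: "cs0 = (c0, s0)" by (cases cs0)
  have lim_c: "(\<lambda>k. c (r1 k)) \<longlonglongrightarrow> c0" and lim_s: "(\<lambda>k. s (r1 k)) \<longlonglongrightarrow> s0"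
    using tendsto_fst[OF lim1] tendsto_snd[OF lim1] by (simp_all add: cs0 o_def)
  define u where "u k t = \<kappa> t * (norm (x (r1 k) t - c (r1 k)))\<^sup>2" for k t
  have "\<exists>r. strict_mono r \<and> (AE t in M. (\<lambda>k. u (r k) t) \<longlonglongrightarrow> 0)"
  proof (rule tendsto_L1_AE_subseq)
    show "integrable M (u k)" for k
      unfolding u_def using cb[of "r1 k"] \<delta> by (intro penalty_integrable[OF adm]) auto
    have "(\<integral>t. norm (u k t) \<partial>M) = D (r1 k)" for k
      unfolding D_def u_def using \<kappa>_pos
          by (intro Bochner_Integration.integral_cong) (auto simp: abs_mult less_imp_le)
    then show "(\<lambda>k. \<integral>t. norm (u k t) \<partial>M) \<longlonglongrightarrow> 0" using LIMSEQ_subseq_LIMSEQ[OF D_lim r1] by (simp add: o_def)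
  qed
  then obtain r2 where r2: "strict_mono r2" and u_lim: "AE t in M. (\<lambda>k. u (r2 k) t) \<longlonglongrightarrow> 0" by blast
  define r where "r = r1 \<circ> r2"
  have r: "strict_mono r" unfolding r_def by (intro strict_mono_o r1 r2)
  have lim_c': "(\<lambda>k. c (r k)) \<longlonglongrightarrow> c0" and lim_s': "(\<lambda>k. s (r k)) \<longlonglongrightarrow> s0"
    using LIMSEQ_subseq_LIMSEQ[OF lim_c r2] LIMSEQ_subseq_LIMSEQ[OF lim_s r2] by (simp_all add: r_def o_def)
  have lim_x: "AE t in M. (\<lambda>k. x (r k) t) \<longlonglongrightarrow> c0"
    using u_lim
  proof eventually_elim
    case (elim t)
    have "(\<lambda>k. (norm (x (r k) t - c (r k)))\<^sup>2) \<longlonglongrightarrow> 0"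
    proof (rule tendsto_sandwich[OF _ _ tendsto_const elim])
      have "(norm (x (r k) t - c (r k)))\<^sup>2 \<le> u (r2 k) t" for k
        unfolding u_def r_def using \<kappa>_ge1[of t] mult_right_mono[of 1 "\<kappa> t"] by simp
      then show "eventually (\<lambda>k. (norm (x (r k) t - c (r k)))\<^sup>2 \<le> u (r2 k) t) sequentially"
        by (intro always_eventually) blast
    qed (auto intro!: always_eventually)
    then have "(\<lambda>k. sqrt ((norm (x (r k) t - c (r k)))\<^sup>2)) \<longlonglongrightarrow> sqrt 0" by (intro tendsto_intros)
    then have "(\<lambda>k. x (r k) t - c (r k)) \<longlonglongrightarrow> 0" by (simp add: tendsto_norm_zero_iff)
    from tendsto_add[OF this lim_c'] show ?case by simp
  qed
  have "s0 \<in> expected_map M \<Phi> c0"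
    by (rule expected_map_closed[where x = "\<lambda>k. x (r k)" and y = "\<lambda>k. y (r k)"])
      (use adm lim_x lim_s' in \<open>auto simp: s_def\<close>)
  moreover have "c0 \<in> cball xbar \<delta>"
    using cb by (intro closed_sequentially[OF closed_cball _ lim_c']) auto
  ultimately have
      "xs \<bullet> (c0 - xbar) - ys \<bullet> (s0 - ybar)
          \<le> e * (norm (c0 - xbar) + norm (s0 - ybar)) + K * (norm (s0 - ybar))\<^sup>2"
    unfolding ybar_def by (intro normal_ineq)
  then have A0: "e * norm (c0 - xbar) \<le> A c0 s0" by (simp add: A_def algebra_simps)
  have A_lim: "(\<lambda>k. A (c (r k)) (s (r k))) \<longlonglongrightarrow> A c0 s0"
    unfolding A_def by (intro tendsto_intros lim_c' lim_s')
  have \<tau>_lim': "(\<lambda>k. \<mu> * inverse (real (Suc (r k)))) \<longlonglongrightarrow> 0"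
    using LIMSEQ_subseq_LIMSEQ[OF tendsto_mult_right_zero[OF \<tau>_lim, of \<mu>] r] by (simp add: o_def)
  have A_le: "A (c (r k)) (s (r k)) + e * \<nu> (r k) \<le> \<mu> * inverse (real (Suc (r k)))" for k
    using est[of "r k"] D0[of "r k"] mult_nonneg_nonneg[of "real (Suc (r k))" "D (r k)"] by linarith
  have "A c0 s0 \<le> 0"
  proof (rule LIMSEQ_le[OF A_lim \<tau>_lim'])
    have "A (c (r k)) (s (r k)) \<le> \<mu> * inverse (real (Suc (r k)))" for k
      using A_le[of k] mult_nonneg_nonneg[OF less_imp_le[OF e] \<nu>0[of "r k"]] by linarith
    then show "\<exists>N. \<forall>k\<ge>N. A (c (r k)) (s (r k)) \<le> \<mu> * inverse (real (Suc (r k)))" by blast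
  qed
  then have "e * norm (c0 - xbar) \<le> 0" using A0 by linarith
  then have c0: "c0 = xbar" using e by (simp add: mult_le_0_iff)
  then have "A c0 s0 = 0" using A0 \<open>A c0 s0 \<le> 0\<close> by simp
  then have "(\<lambda>k. (\<mu> * inverse (real (Suc (r k))) - A (c (r k)) (s (r k))) / e) \<longlonglongrightarrow> (0 - 0) / e"
    using A_lim \<tau>_lim' e by (intro tendsto_intros) auto
  then have up: "(\<lambda>k. (\<mu> * inverse (real (Suc (r k))) - A (c (r k)) (s (r k))) / e) \<longlonglongrightarrow> 0" by simp
  have "(\<lambda>k. \<nu> (r k)) \<longlonglongrightarrow> 0"
  proof (rule tendsto_sandwich[OF _ _ tendsto_const up])
    have "\<nu> (r k) \<le> (\<mu> * inverse (real (Suc (r k))) - A (c (r k)) (s (r k))) / e" for k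
    proof -
      have "\<nu> (r k) * e \<le> \<mu> * inverse (real (Suc (r k))) - A (c (r k)) (s (r k))"
        using A_le[of k] by (simp add: mult.commute)
      then show ?thesis using e by (simp add: pos_le_divide_eq)
    qed
    then show "eventually (\<lambda>k. \<nu> (r k) \<le> (\<mu> * inverse (real (Suc (r k)))
        - A (c (r k)) (s (r k))) / e) sequentially"
      by (intro always_eventually) blast
  qed (use \<nu>0 in \<open>auto intro!: always_eventually\<close>)
  then show ?thesis using r lim_c' unfolding c0 \<nu>_def by blast
qed

text \<open>The error in y* has two parts: the gradient of the smoothed norm, at most
  \<open>2 * e\<close>, and that of the quadratic term, of norm \<open>b\<close>. The bound
  \<open>B\<close> on \<open>b\<close> involves \<open>K\<close> and so depends on \<open>e\<close>
  without control; smallness is claimed only for the integral of \<open>b\<close> against the given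
  \<open>l\<close>.\<close>

lemma approximate_leibniz:
  assumes N: "xs \<in> regular_coderivative (expected_map M \<Phi>) xbar (\<integral>t. yb t \<partial>M) ys"
    and l_int: "integrable M l" and l_nonneg: "AE t in M. 0 \<le> l t" and e: "0 < e"
  shows "\<exists>x y p err b B. admissible x y \<and> (AE t in M. norm (x t - xbar) \<le> e) \<and>
     (\<integral>t. norm (y t - yb t) \<partial>M) \<le> e \<and> integrable M p \<and> norm (xs - (\<integral>t. p t \<partial>M)) \<le> 2 * e \<and>
     err \<in> borel_measurable M \<and> b \<in> borel_measurable M \<and>
     (AE t in M. 0 \<le> b t \<and> b t \<le> B \<and> norm (err t) \<le> 2 * e + b t) \<and>
     integrable M (\<lambda>t. l t * b t) \<and> (\<integral>t. l t * b t \<partial>M) \<le> e \<and>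
     (AE t in M. p t \<in> regular_coderivative (\<Phi> t) (x t) (y t) (ys + err t))"
proof -
  have N': "(xs, - ys) \<in> regular_normal_cone (xbar, \<integral>t. yb t \<partial>M) (gph (expected_map M \<Phi>))"
    using N by (simp add: regular_coderivative_def)
  obtain \<delta> K where \<delta>: "0 < \<delta>" "\<delta> \<le> \<rho>" and K: "0 \<le> K" and ineq: "\<forall>c\<in>cball xbar \<delta>. \<forall>s\<in>expected_map M \<Phi> c.
     xs \<bullet> (c - xbar) - ys \<bullet> (s - (\<integral>t. yb t \<partial>M)) \<le> e * (norm (c - xbar) + norm (s - (\<integral>t. yb t \<partial>M))) +
         K * (norm (s - (\<integral>t. yb t \<partial>M)))\<^sup>2"
    using regular_normal_global_bound[OF N' e \<rho>_pos] by (elim exE conjE) (rule that)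
  define K' where "K' = K * (\<integral>t. \<kappa> t \<partial>M)"
  have "0 \<le> (\<integral>t. \<kappa> t \<partial>M)" using \<kappa>_pos by (intro integral_nonneg_AE) (auto intro: less_imp_le)
  then have K': "0 \<le> K'" using K by (simp add: K'_def)
  have "\<forall>n. \<exists>c x y. penalised_min xs ys e K' \<delta> n c x y"
    using penalised_min_exists[OF less_imp_le[OF e] K' \<delta>] by blast
  then obtain c x y where P: "\<And>n. penalised_min xs ys e K' \<delta> n (c n) (x n) (y n)" by metis
  have adm: "admissible (x n) (y n)" for n by (rule penalised_minD(2)[OF P])
  obtain r1 where r1: "strict_mono r1" "(\<lambda>k. c (r1 k)) \<longlonglongrightarrow> xbar" "(\<lambda>k. \<integral>t. norm (y (r1 k) t - yb t) \<partial>M) \<longlonglongrightarrow> 0"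
    using penalised_min_converges[of xs ys e K \<delta> c x y, OF P[unfolded K'_def] e K \<delta>] ineq by blast
  \<comment> \<open>L1 convergence does not control integrals against the merely integrable
    \<open>l\<close>. Along a subsequence the convergence is pointwise, and a multiple of
    \<open>l\<close> dominates.\<close>
  have "\<exists>r. strict_mono r \<and> (AE t in M. (\<lambda>k. y (r1 (r k)) t - yb t) \<longlonglongrightarrow> 0)"
    using r1(3)
        by (intro tendsto_L1_AE_subseq Bochner_Integration.integrable_diff admissible_integrable[OF
            adm] yb_int)
  then obtain r2 where r2: "strict_mono r2" and w_lim: "AE t in M. (\<lambda>k. y (r1 (r2 k)) t - yb t) \<longlonglongrightarrow> 0"
      by blast
  define r where "r = r1 \<circ> r2"
  have r: "strict_mono r" unfolding r_def by (intro strict_mono_o r1 r2)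
  have c_lim: "(\<lambda>k. c (r k)) \<longlonglongrightarrow> xbar" and \<nu>_lim: "(\<lambda>k. \<integral>t. norm (y (r k) t - yb t) \<partial>M) \<longlonglongrightarrow> 0"
    using LIMSEQ_subseq_LIMSEQ[OF r1(2) r2] LIMSEQ_subseq_LIMSEQ[OF r1(3) r2] by (simp_all add: r_def o_def)
  have [measurable]: "y n \<in> borel_measurable M" "x n \<in> borel_measurable M" for n
      using admissible_meas[OF adm] by auto
  have [measurable]: "l \<in> borel_measurable M" using l_int by simp
  define b where "b n t = 2 * (K' / \<kappa> t) * norm (y n t - yb t)" for n t
  have b_meas[measurable]: "b n \<in> borel_measurable M" for n unfolding b_def by measurable
  have b0: "0 \<le> b n t" for n t using K' \<kappa>_pos[of t] by (simp add: b_def)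
  have bB: "AE t in M. b n t \<le> 4 * K'" for n
    using deviation_bound[OF adm[of n]]
  proof eventually_elim
    case (elim t)
    have "b n t \<le> 2 * (K' / \<kappa> t) * (2 * \<kappa> t)"
      unfolding b_def using elim K' \<kappa>_pos[of t] by (intro mult_left_mono) auto
    then show ?case using \<kappa>_pos[of t] by simp
  qed
  have lb_bd: "AE t in M. norm (l t * b n t) \<le> 4 * K' * l t" for n
    using bB[of n] l_nonneg
  proof eventually_elim
    case (elim t)
    have "l t * b n t \<le> l t * (4 * K')" using elim by (intro mult_left_mono) auto
    then show ?case using elim b0[of n t] by (simp add: mult_ac)
  qed
  have int_4l: "integrable M (\<lambda>t. 4 * K' * l t)" using l_int by simp
  have int_lb: "integrable M (\<lambda>t. l t * b n t)" for n
    by (rule Bochner_Integration.integrable_bound[OF int_4l]) (use lb_bd[of n] in \<open>auto elim!: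
        eventually_mono\<close>)
  have lb_lim: "(\<lambda>k. \<integral>t. l t * b (r k) t \<partial>M) \<longlonglongrightarrow> (\<integral>t. 0 \<partial>M)"
  proof (rule integral_dominated_convergence[OF _ _ int_4l _ lb_bd])
    show "AE t in M. (\<lambda>k. l t * b (r k) t) \<longlonglongrightarrow> 0"
      using w_lim
    proof eventually_elim
      case (elim t)
      have "(\<lambda>k. l t * (2 * (K' / \<kappa> t) * norm (y (r k) t
          - yb t))) \<longlonglongrightarrow> l t * (2 * (K' / \<kappa> t) * norm (0 :: 'b))"
        using elim by (intro tendsto_intros) (simp add: r_def)
      then show ?case by (simp add: b_def)
    qed
  qed measurable
  \<comment> \<open>An almost everywhere bound for the distance of \<open>x (r k) t\<close> from
    \<open>xbar\<close>, through \<open>c (r k)\<close>: the root comes from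
    \<open>penalised_min_uniform\<close>, the rest from the triangle inequality.\<close>
  define h where
      "h k = sqrt ((norm (xbar - c (r k)))\<^sup>2 + 2 * norm ys * inverse (real (Suc (r k))))
          + norm (c (r k) - xbar)" for k
  have "(\<lambda>k. inverse (real (Suc (r k)))) \<longlonglongrightarrow> 0"
    using LIMSEQ_subseq_LIMSEQ[OF LIMSEQ_inverse_real_of_nat r] by (simp add: o_def)
  then have "h \<longlonglongrightarrow> sqrt ((norm (xbar - xbar))\<^sup>2 + 2 * norm ys * 0) + norm (xbar - xbar)"
    unfolding h_def by (intro tendsto_intros c_lim)
  then have h_lim: "h \<longlonglongrightarrow> 0" by simp
  have cd_lim: "(\<lambda>k. norm (c (r k) - xbar)) \<longlonglongrightarrow> 0"
      using tendsto_norm[OF tendsto_diff[OF c_lim tendsto_const[of xbar]]] by simp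
  have "min e \<rho> > 0" using e \<rho>_pos by simp
  then have "eventually (\<lambda>k. h k < min e \<rho> \<and> norm (c (r k) - xbar) < \<delta> \<and>
      (\<integral>t. norm (y (r k) t - yb t) \<partial>M) < e
      \<and> (\<integral>t. l t * b (r k) t \<partial>M) < e) sequentially"
    using h_lim cd_lim \<nu>_lim lb_lim e \<delta> by (intro eventually_conj order_tendstoD(2)) auto
  then obtain k where k: "h k < min e \<rho>" "norm (c (r k) - xbar) < \<delta>" "(\<integral>t. norm (y (r k) t - yb t) \<partial>M) < e"
      "(\<integral>t. l t * b (r k) t \<partial>M) < e"
    by (auto simp: eventually_sequentially)
  define n where "n = r k"
  let ?\<tau> = "inverse (real (Suc n))"
  have x_near: "AE t in M. norm (x n t - xbar) \<le> h k"
    using penalised_min_uniform[OF P less_imp_le[OF e] K', of n]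
  proof eventually_elim
    case (elim t)
    have "norm (x n t - xbar) \<le> norm (x n t - c n) + norm (c n - xbar)"
      using norm_triangle_ineq[of "x n t - c n" "c n - xbar"] by simp
    moreover have "norm (x n t - c n) \<le> sqrt ((norm (xbar - c n))\<^sup>2 + 2 * norm ys * ?\<tau>)"
      using elim by (rule real_le_rsqrt)
    ultimately show ?case unfolding h_def n_def[symmetric] by linarith
  qed
  define p where "p t = (- 2 * (real (Suc n) * \<kappa> t)) *\<^sub>R (x n t - c n)" for t
  define err where
      "err t = (2 * e / sqrt ((norm (y n t - yb t))\<^sup>2 + ?\<tau>\<^sup>2)) *\<^sub>R (y n t - yb t)
          + (2 * (K' / \<kappa> t)) *\<^sub>R (y n t - yb t)" for t
  have err_meas: "err \<in> borel_measurable M" unfolding err_def by measurable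
  have err_bd: "norm (err t) \<le> 2 * e + b n t" for t
  proof -
    let ?A = "sqrt ((norm (y n t - yb t))\<^sup>2 + ?\<tau>\<^sup>2)"
    have A: "norm (y n t - yb t) \<le> ?A" by (rule real_le_rsqrt) simp
    have A_pos: "0 < ?A" by (intro real_sqrt_gt_zero add_nonneg_pos) auto
    have "norm ((2 * e / ?A) *\<^sub>R (y n t - yb t)) = (2 * e / ?A) * norm (y n t - yb t)"
      using e A_pos by (simp del: real_sqrt_gt_0_iff)
    also have "\<dots> \<le> (2 * e / ?A) * ?A" using A A_pos e by (intro mult_left_mono) auto
    also have "\<dots> = 2 * e" using A_pos by simp
    finally have 1: "norm ((2 * e / ?A) *\<^sub>R (y n t - yb t)) \<le> 2 * e" .
    have 2: "norm ((2 * (K' / \<kappa> t)) *\<^sub>R (y n t - yb t)) = b n t" using K' \<kappa>_pos[of t] by (simp add: b_def)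
    show ?thesis unfolding err_def using norm_triangle_ineq[of
        "(2 * e / ?A) *\<^sub>R (y n t - yb t)"] 1 2 by (smt (verit))
  qed
  have cn: "norm (c n - xbar) < \<delta>" using k(2) by (simp add: n_def)
  have "AE t in M. p t \<in> regular_coderivative (\<Phi> t) (x n t) (y n t) (ys + err t)"
    using penalised_min_fermat[OF P less_imp_le[OF e] K', of n] x_near
  proof eventually_elim
    case (elim t)
    then have "norm (x n t - xbar) < \<rho>" using k(1) by simp
    then show ?case using elim(1) by (simp only: p_def err_def)
  qed
  moreover have "AE t in M. norm (x n t - xbar) \<le> e" using x_near k(1) by (auto elim!: eventually_mono)
  moreover have "AE t in M. 0 \<le> b n t \<and> b n t \<le> 4 * K' \<and> norm (err t) \<le> 2 * e + b n t"
    using bB[of n] b0 err_bd by (auto elim!: eventually_mono)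
  moreover have "integrable M p" "norm (xs - (\<integral>t. p t \<partial>M)) \<le> 2 * e"
    unfolding p_def using penalised_min_stationary[OF P less_imp_le[OF e] \<delta> cn] by simp_all
  moreover have "(\<integral>t. norm (y n t - yb t) \<partial>M) \<le> e" "(\<integral>t. l t * b n t \<partial>M) \<le> e" using k(3,4)
      by (simp_all add: n_def)
  ultimately show ?thesis using adm[of n] err_meas b_meas[of n] int_lb[of n]
    by (intro exI[of _ "x n"] exI[of _ "y n"] exI[of _ p] exI[of _ err] exI[of _ "b n"] exI[of _
        "4 * K'"] conjI)
qed

section \<open>The Leibniz rule\<close>

theorem leibniz_inclusion:
  assumes lip: "integrably_quasi_lipschitzian M \<Phi> xbar yb"
    and N: "xs \<in> regular_coderivative (expected_map M \<Phi>) xbar (\<integral>t. yb t \<partial>M) ys"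
  shows "xs \<in> aumann_integral M (\<lambda>t. coderivative (\<Phi> t) xbar (yb t) ys)"
proof -
  obtain \<eta> l where \<eta>: "\<eta> > 0" and l: "l \<in> L1 M {0<..}" and L: "\<forall>x\<in>Linf M. \<forall>y\<in>L1 M UNIV. \<forall>ys\<in>Linf M.
          Linf_norm M (\<lambda>t. x t - xbar) \<le> ereal \<eta> \<longrightarrow>
          L1_norm M (\<lambda>t. y t - yb t) \<le> \<eta> \<longrightarrow>
          (AE t in M. y t \<in> \<Phi> t (x t)) \<longrightarrow>
          (AE t in M. (SUP xs\<in>coderivative (\<Phi> t) (x t) (y t) (ys t). ereal (norm xs))
                        \<le> ereal (l t * norm (ys t)))"
    using lip unfolding integrably_quasi_lipschitzian_def by (elim exE conjE bexE) (rule that)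
  have l_int: "integrable M l" and l_pos: "AE t in M. 0 < l t" using l by (auto simp: L1_def)
  have l_nonneg: "AE t in M. 0 \<le> l t" using l_pos by (auto elim: eventually_mono)
  \<comment> \<open>The factor \<open>min \<eta> 1\<close> keeps \<open>x j\<close> and
    \<open>y j\<close> in the range of the quasi-Lipschitz condition. The geometric decay makes the
    series below summable, which gives a common bound and almost everywhere convergence of
    \<open>y j\<close> and \<open>b j\<close> without further subsequences.\<close>
  define \<epsilon> where "\<epsilon> j = min \<eta> 1 * (1/2) ^ j" for j :: nat
  have \<epsilon>_pos: "0 < \<epsilon> j" for j using \<eta> by (simp add: \<epsilon>_def)
  have \<epsilon>_le: "\<epsilon> j \<le> \<eta>" "\<epsilon> j \<le> 1" for j
  proof -
    have "\<epsilon> j \<le> min \<eta> 1 * 1" unfolding \<epsilon>_def using \<eta> by (intro mult_left_mono power_le_one) auto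
    then show "\<epsilon> j \<le> \<eta>" "\<epsilon> j \<le> 1" by auto
  qed
  have \<epsilon>_sum: "summable \<epsilon>" unfolding \<epsilon>_def by (intro summable_mult summable_geometric) simp
  have \<epsilon>_lim: "\<epsilon> \<longlonglongrightarrow> 0" by (rule summable_LIMSEQ_zero[OF \<epsilon>_sum])
  define good where "good e x y p err b B \<longleftrightarrow> admissible x y \<and> (AE t in M. norm (x t - xbar) \<le> e) \<and>
     (\<integral>t. norm (y t - yb t) \<partial>M) \<le> e \<and> integrable M p \<and> norm (xs - (\<integral>t. p t \<partial>M)) \<le> 2 * e \<and>
     err \<in> borel_measurable M \<and> b \<in> borel_measurable M \<and>
     (AE t in M. 0 \<le> b t \<and> b t \<le> B \<and> norm (err t) \<le> 2 * e + b t) \<and>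
     integrable M (\<lambda>t. l t * b t) \<and> (\<integral>t. l t * b t \<partial>M) \<le> e \<and>
     (AE t in M. p t \<in> regular_coderivative (\<Phi> t) (x t) (y t) (ys + err t))" for e x y p err b B
  have "\<forall>j. \<exists>x y p err b B. good (\<epsilon> j) x y p err b B"
    unfolding good_def by (intro allI approximate_leibniz N l_int l_nonneg \<epsilon>_pos)
  then obtain x y p err b B where G: "\<And>j. good (\<epsilon> j) (x j) (y j) (p j) (err j) (b j) (B j)" by metis
  have adm: "admissible (x j) (y j)" and x_near: "AE t in M. norm (x j t - xbar) \<le> \<epsilon> j"
    and y_near: "(\<integral>t. norm (y j t - yb t) \<partial>M) \<le> \<epsilon> j" and p_int: "integrable M (p j)"
    and p_near: "norm (xs - (\<integral>t. p j t \<partial>M)) \<le> 2 * \<epsilon> j"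
    and err_meas: "err j \<in> borel_measurable M" and b_meas: "b j \<in> borel_measurable M"
    and err_bd: "AE t in M. 0 \<le> b j t \<and> b j t \<le> B j \<and> norm (err j t) \<le> 2 * \<epsilon> j + b j t"
    and lb_int: "integrable M (\<lambda>t. l t * b j t)" and lb_le: "(\<integral>t. l t * b j t \<partial>M) \<le> \<epsilon> j"
    and p_cod: "AE t in M. p j t \<in> regular_coderivative (\<Phi> t) (x j t) (y j t) (ys + err j t)" for j
    using G[of j] unfolding good_def by auto
  note [measurable] = admissible_meas[OF adm] err_meas b_meas
  have lb_nonneg: "AE t in M. 0 \<le> l t * b j t" for j using l_nonneg err_bd[of j] by eventually_elim simp
  have lb_sum: "summable (\<lambda>j. \<integral>t. l t * b j t \<partial>M)"
  proof (rule summable_comparison_test'[OF \<epsilon>_sum])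
    show "norm (\<integral>t. l t * b j t \<partial>M) \<le> \<epsilon> j" for j
      using lb_le[of j] integral_nonneg_AE[OF lb_nonneg[of j]] by simp
  qed
  note lb_AE = AE_summable_of_summable_integral[OF lb_int lb_nonneg lb_sum]
  note H_int = integrable_suminf_of_summable_integral[OF lb_int lb_nonneg lb_sum]
  \<comment> \<open>The constant 2 bounds \<open>2 * \<epsilon> j\<close>, and the sum over all
    \<open>l t * b j t\<close> covers the nonuniform part of the error for every \<open>j\<close> at
    once.\<close>
  define h where "h t = l t * (norm ys + 2) + (\<Sum>j. l t * b j t)" for t
  have h_int: "integrable M h" unfolding h_def using l_int H_int by simp
  have dy_int: "integrable M (\<lambda>t. norm (y j t - yb t))" for j
    using admissible_integrable[OF adm] yb_int by simp
  have dy_sum: "summable (\<lambda>j. \<integral>t. norm (y j t - yb t) \<partial>M)"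
  proof (rule summable_comparison_test'[OF \<epsilon>_sum])
    show "norm (\<integral>t. norm (y j t - yb t) \<partial>M) \<le> \<epsilon> j" for j
      using y_near[of j] integral_nonneg_AE[of "\<lambda>t. norm (y j t - yb t)" M] by simp
  qed
  have dy_AE: "AE t in M. summable (\<lambda>j. norm (y j t - yb t))"
    by (rule AE_summable_of_summable_integral[OF dy_int _ dy_sum]) simp
  have p_bd0: "AE t in M. norm (p j t) \<le> l t * norm (ys + err j t)" for j
  proof -
    have "x j \<in> Linf M"
    proof (rule Linf_bounded)
      show "AE t in M. norm (x j t) \<le> norm xbar + \<epsilon> j"
        using x_near[of j]
      proof eventually_elim
        case (elim t)
        then show ?case using norm_triangle_ineq[of "x j t - xbar" xbar] by simp
      qed
    qed measurable
    moreover have "y j \<in> L1 M UNIV" using admissible_integrable[OF adm] by (simp add: L1_def)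
    \<comment> \<open>This is the purpose of the bound \<open>B j\<close>, which may grow with
      \<open>j\<close>.\<close>
    moreover have "(\<lambda>t. ys + err j t) \<in> Linf M"
    proof (rule Linf_bounded)
      show "AE t in M. norm (ys + err j t) \<le> norm ys + (2 * \<epsilon> j + B j)"
        using err_bd[of j]
      proof eventually_elim
        case (elim t)
        then show ?case using norm_triangle_ineq[of ys "err j t"] by linarith
      qed
    qed measurable
    moreover have "Linf_norm M (\<lambda>t. x j t - xbar) \<le> ereal \<eta>"
    proof (rule Linf_norm_le)
      show "AE t in M. norm (x j t - xbar) \<le> \<eta>"
        using x_near[of j] by eventually_elim (use \<epsilon>_le(1)[of j] in linarith)
    qed measurable
    moreover have "L1_norm M (\<lambda>t. y j t - yb t) \<le> \<eta>" using y_near[of j] \<epsilon>_le(1)[of j]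
        by (simp add: L1_norm_def)
    moreover have "AE t in M. y j t \<in> \<Phi> t (x j t)" using adm[of j]
        by (auto simp: admissible_def elim: eventually_mono)
    ultimately have "AE t in M. (SUP xs\<in>coderivative (\<Phi> t) (x j t) (y j t) (ys + err j t). ereal (norm xs))
                        \<le> ereal (l t * norm (ys + err j t))"
      using L[rule_format, of "x j" "y j" "\<lambda>t. ys + err j t"] by simp
    then show ?thesis
      using p_cod[of j]
    proof eventually_elim
      case (elim t)
      have "p j t \<in> coderivative (\<Phi> t) (x j t) (y j t) (ys + err j t)"
        using elim(2) regular_subset_limiting unfolding regular_coderivative_def coderivative_def by blast
      then have "ereal (norm (p j t)) \<le> (SUP xs\<in>coderivative (\<Phi> t) (x j t) (y j t) (ys
          + err j t). ereal (norm xs))"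
        by (rule SUP_upper)
      from order_trans[OF this elim(1)] show ?case by simp
    qed
  qed
  have all: "AE t in M. \<forall>j. 0 \<le> b j t \<and> b j t \<le> B j \<and> norm (err j t) \<le> 2 * \<epsilon> j + b j t"
    using err_bd by (simp add: AE_all_countable)
  have p_bd: "AE t in M. norm (p j t) \<le> h t" for j
    using p_bd0[of j] all lb_AE l_nonneg
  proof eventually_elim
    case (elim t)
    have "norm (ys + err j t) \<le> norm ys + 2 + b j t"
      using norm_triangle_ineq[of ys "err j t"] elim(2)[rule_format, of j] \<epsilon>_le(2)[of j] by linarith
    then have "l t * norm (ys + err j t) \<le> l t * (norm ys + 2 + b j t)" using elim(4)
        by (intro mult_left_mono)
    also have "\<dots> = l t * (norm ys + 2) + l t * b j t" by (simp add: algebra_simps)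
    also have "l t * b j t \<le> (\<Sum>j. l t * b j t)"
      using sum_le_suminf[OF elim(3), of "{j}"] elim(2,4) by simp
    finally show ?case using elim(1) by (simp add: h_def)
  qed
  have "(\<lambda>j. xs - (\<integral>t. p j t \<partial>M)) \<longlonglongrightarrow> 0"
  proof (rule Lim_null_comparison)
    show "eventually (\<lambda>j. norm (xs - (\<integral>t. p j t \<partial>M)) \<le> 2 * \<epsilon> j) sequentially"
      using p_near by (intro always_eventually) blast
    show "(\<lambda>j. 2 * \<epsilon> j) \<longlonglongrightarrow> 0" using tendsto_mult_right_zero[OF \<epsilon>_lim] .
  qed
  from tendsto_diff[OF tendsto_const[of xs] this] have p_lim: "(\<lambda>j. \<integral>t. p j t \<partial>M) \<longlonglongrightarrow> xs" by simp
  obtain v where v: "integrable M v" "(\<integral>t. v t \<partial>M) = xs"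
      and v_cl: "AE t in M. cluster_point (\<lambda>j. p j t) (v t)"
    using fatou_several_dimensions[where f = p
        and h = h, OF finite_measure_axioms dec borel_measurable_integrable[OF p_int] h_int p_bd
            p_lim]
    by (elim exE conjE) (rule that)
  have x_all: "AE t in M. \<forall>j. norm (x j t - xbar) \<le> \<epsilon> j" using x_near by (simp add: AE_all_countable)
  have p_all: "AE t in M. \<forall>j. p j t \<in> regular_coderivative (\<Phi> t) (x j t) (y j t) (ys + err j t)"
    using p_cod by (simp add: AE_all_countable)
  have "AE t in M. v t \<in> coderivative (\<Phi> t) xbar (yb t) ys"
    using v_cl x_all p_all all lb_AE dy_AE l_pos
  proof eventually_elim
    case (elim t)
    obtain r where r: "strict_mono r" "(\<lambda>k. p (r k) t) \<longlonglongrightarrow> v t" using elim(1)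
        by (auto simp: cluster_point_def)
    have "(\<lambda>j. x j t - xbar) \<longlonglongrightarrow> 0"
      by (rule Lim_null_comparison[OF _ \<epsilon>_lim]) (use elim(2) in \<open>auto intro!: always_eventually\<close>)
    from tendsto_add[OF this tendsto_const[of xbar]] have x_lim: "(\<lambda>j. x j t) \<longlonglongrightarrow> xbar" by simp
    have "(\<lambda>j. y j t - yb t) \<longlonglongrightarrow> 0"
      using summable_LIMSEQ_zero[OF elim(6)] by (simp add: tendsto_norm_zero_iff)
    from tendsto_add[OF this tendsto_const[of "yb t"]] have y_lim: "(\<lambda>j. y j t) \<longlonglongrightarrow> yb t" by simp
    \<comment> \<open>Summability is known only for \<open>l t * b j t\<close>; positivity of
      \<open>l t\<close> turns it into convergence of \<open>b j t\<close> itself.\<close>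
    have "(\<lambda>j. l t * b j t / l t) \<longlonglongrightarrow> 0 / l t"
      using summable_LIMSEQ_zero[OF elim(5)] elim(7) by (intro tendsto_intros) auto
    then have "(\<lambda>j. b j t) \<longlonglongrightarrow> 0" using elim(7) by simp
    from tendsto_add[OF tendsto_mult_right_zero[OF \<epsilon>_lim, of 2] this] have
        "(\<lambda>j. 2 * \<epsilon> j + b j t) \<longlonglongrightarrow> 0" by simp
    then have err_lim: "(\<lambda>j. err j t) \<longlonglongrightarrow> 0"
      by (rule Lim_null_comparison[rotated]) (use elim(4) in \<open>auto intro!: always_eventually\<close>)
    have "(\<lambda>k. (x (r k) t, y (r k) t)) \<longlonglongrightarrow> (xbar, yb t)"
      using LIMSEQ_subseq_LIMSEQ[OF x_lim r(1)] LIMSEQ_subseq_LIMSEQ[OF y_lim r(1)]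
      by (intro tendsto_Pair) (simp_all add: o_def)
    moreover have "(\<lambda>k. (p (r k) t, - (ys + err (r k) t))) \<longlonglongrightarrow> (v t, - (ys + 0))"
      using LIMSEQ_subseq_LIMSEQ[OF err_lim r(1)] r(2) by (intro tendsto_intros) (simp_all add: o_def)
    moreover have
        "\<forall>k. (p (r k) t, - (ys + err (r k) t))
            \<in> regular_normal_cone (x (r k) t, y (r k) t) (gph (\<Phi> t))"
      using elim(3) unfolding regular_coderivative_def by blast
    ultimately show ?case
      unfolding coderivative_def limiting_normal_cone_def mem_Collect_eq
      by (intro exI[of _ "\<lambda>k. (x (r k) t, y (r k) t)"] exI[of _
          "\<lambda>k. (p (r k) t, - (ys + err (r k) t))"]) simp
  qed
  then show ?thesis using v unfolding aumann_integral_def L1_def by auto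
qed

end

theorem theorem5p3:
  fixes M :: "'t measure"
    and T_pa T_na :: "'t set"
    and \<Phi> :: "'t \<Rightarrow> real^'n \<Rightarrow> (real^'m) set"
    and xbar :: "real^'n"
    and ybar :: "real^'m"
    and yb :: "'t \<Rightarrow> real^'m"
    and \<rho> :: real
    and \<kappa> :: "'t \<Rightarrow> real"
  assumes "finite_measure M" and "complete_measure M"
    and "atomic_decomposition M T_pa T_na"
    and "normal_integrand M \<Phi>"
    and "xbar \<in> mdom (expected_map M \<Phi>)"
    and "\<rho> > 0" and "\<kappa> \<in> L1 M {0<..}"
    and "AE t in M. t \<in> T_na \<longrightarrow> (\<forall>x\<in>cball xbar \<rho>. convex (\<Phi> t x))"
    and "AE t in M. \<forall>x\<in>cball xbar \<rho>. \<Phi> t x \<subseteq> cball 0 (\<kappa> t)"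
    and "ybar \<in> expected_map M \<Phi> xbar"
    and "yb \<in> integral_selections M \<Phi> xbar ybar"
    and "integrably_quasi_lipschitzian M \<Phi> xbar yb"
  shows "\<forall>ystar. regular_coderivative (expected_map M \<Phi>) xbar ybar ystar
           \<subseteq> aumann_integral M (\<lambda>t. coderivative (\<Phi> t) xbar (yb t) ystar)"
proof -
  have yb: "integrable M yb" "(\<integral>t. yb t \<partial>M) = ybar" "AE t in M. yb t \<in> \<Phi> t xbar"
    using assms(11) by (auto simp: integral_selections_def L1_def)
  interpret finite_measure M by fact
  interpret bounded_integrand M T_pa T_na \<Phi> xbar yb \<rho> "\<lambda>t. max 1 (\<kappa> t)"
  proof unfold_locales
    show "integrable M (\<lambda>t. max 1 (\<kappa> t))" using assms(7) by (auto simp: L1_def)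
    show "AE t in M. \<forall>x\<in>cball xbar \<rho>. \<Phi> t x \<subseteq> cball 0 (max 1 (\<kappa> t))"
      using assms(9) by eventually_elim force
  qed (use assms yb in auto)
  show ?thesis
    using leibniz_inclusion[OF assms(12)] unfolding yb(2) by blast
qed

end
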